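(* Let $\delta>0$ and let $(U,c)$ be the family of periodic travelling waves described in the context. Fix $(k_\star,M_\star)$ and let the subscript $\star$ denote evaluation at $(k_\star,M_\star)$. For $\nu\in i\mathbb{R}$ with $|\nu|\ll1$, consider eigenvalues $\lambda$ and $1$-periodic eigenfunctions $\hat u$ of $$k_\star(\tfrac{d}{dx}+\nu)\big((6U_\star-c_\star)\hat u\big)+k_\star^3(\tfrac{d}{dx}+\nu)^3\hat u+\delta\big[k_\star^2(\tfrac{d}{dx}+\nu)^2\hat u+k_\star^4(\tfrac{d}{dx}+\nu)^4\hat u\big]=-\lambda\hat u$$ that expand as $\lambda=\nu\lambda_0+\nu^2\lambda_1+O(\nu^3)$ and $\hat u=\hat u_0+\nu\hat u_1+\nu^2\hat u_2+O(\nu^3)$. Set $\tilde\lambda_0=\lambda_0/k_\star$ and $\tilde\lambda_1=\lambda_1/k_\star$. (a) First order. There are constants $k_0,k_1$ such that, with $M_0=\langle\hat u_1\rangle$, $$\hat u_0=\tfrac{k_0}{k_\star}U_\star',\qquad\hat u_1=k_0\,\partial_kU_\star+M_0\,\partial_MU_\star+\tfrac{k_1}{k_\star}U_\star',$$ $$\tilde\lambda_0k_0+k_\star\,\mathrm{d}c_\star(k_0,M_0)=0,\qquad(\tilde\lambda_0-c_\star)M_0+\mathrm{d}\langle3U^2\rangle_\star(k_0,M_0)=0.$$ (b) Second order. Define $$\begin{aligned}\hat v^k=\ &(\tilde\lambda_0-c_\star)\partial_kU_\star+3\,\partial_k(U^2-\langle U^2\rangle)_\star+3k_\star(U_\star+k_\star\partial_kU_\star)''\\&+\delta\big(U_\star'+6k_\star^2U_\star'''+2k_\star(\partial_kU_\star)'+4k_\star^3(\partial_kU_\star)'''\big),\\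 \hat v^M=\ &(\tilde\lambda_0-c_\star)\,\partial_MU_\star+3\,\partial_M(U^2-\langle U^2\rangle)_\star .\end{aligned}$$ Then $\hat v^k$ and $\hat v^M$ are mean free, and therefore there are unique mean free $\hat f^k,\hat f^M$ such that $\mathcal{L}_\star[\hat f^k]=k_\star\hat v^k$ and $\mathcal{L}_\star[\hat f^M]=k_\star\hat v^M$. With $M_1=\langle\hat u_2\rangle$ one has $$\hat u_2=\mathrm{d}U_\star(k_1,M_1)+k_0(\langle\hat f^k\rangle-\hat f^k)+M_0(\langle\hat f^M\rangle-\hat f^M)+\tfrac{k_2}{k_\star}U_\star'$$ for some constant $k_2$, together with $$\tilde\lambda_1k_0+\tilde\lambda_0k_1+k_\star\,\mathrm{d}c_\star(k_1,M_1)=-6k_\star\big(k_0\langle\hat f^k\rangle+M_0\langle\hat f^M\rangle\big),$$ $$\begin{aligned}(\tilde\lambda_0-c_\star)M_1+\tilde\lambda_1M_0+3\,\mathrm{d}\langle U^2\rangle_\star(k_1,M_1)=\ &-\delta k_\star M_0+\langle6U_\star(\hat f^k-\langle\hat f^k\rangle)\rangle k_0\\&+\langle6U_\star(\hat f^M-\langle\hat f^M\rangle)\rangle M_0 .\end{aligned}$$ (c) Relation with the second order Whitham system. Consider $$\partial_Tk+\partial_X(k\,c(k,M))=-\varepsilon\,\partial_X\langle6k f\rangle,\qquad\partial_TM+\partial_X\langle3U^2\rangle=\varepsilon\,\partial_X\langle6U(f-\langle f\rangle)\rangle-\varepsilon\delta\,\partial_X^2M,$$ where $f$ is determined by $\langle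 f\,U'\rangle=0$ and $$\begin{aligned}\mathcal{L}_{k,M}[f]=\ &\partial_T(U-\langle U\rangle)+3\,\partial_X(U^2-\langle U^2\rangle)+3\big(k^2\partial_X\partial_y^2U+k\,\partial_Xk\,\partial_y^2U\big)\\&+\delta\big(2k\,\partial_X\partial_yU+\partial_Xk\,\partial_yU\big)+\delta\big(4k^3\partial_X\partial_y^3U+6k^2\partial_Xk\,\partial_y^3U\big).\end{aligned}$$ Rescale $\varepsilon$ to $1$ through $(x,t)=(X/\varepsilon,T/\varepsilon)$ and linearize about $(k_\star,M_\star)$ in the co-moving frame of speed $c_\star$. This gives $$\partial_t\tilde k+k_\star\,\mathrm{d}c_\star(\partial_x\tilde k,\partial_x\tilde M)=-6k_\star\,\partial_x\langle g\rangle,$$ $$\partial_t\tilde M+\mathrm{d}\langle3U^2\rangle_\star(\partial_x\tilde k,\partial_x\tilde M)-c_\star\partial_x\tilde M=\partial_x\langle6U_\star(g-\langle g\rangle)\rangle-\delta\,\partial_x^2\tilde M,$$ where $\langle g\,U_\star'\rangle=0$ and $$\begin{aligned}\mathcal{L}_\star[g]=\ &\partial_kU_\star(\partial_t\tilde k-c_\star\partial_x\tilde k)+\partial_k(3U^2-\langle3U^2\rangle)_\star\partial_x\tilde k+\partial_M(3U^2-\langle3U^2\rangle)_\star\partial_x\tilde M\\&+3\big(k_\star^2(\partial_kU_\star)''+k_\star U_\star''\big)\partial_x\tilde k+\delta\big(U_\star'+2k_\star(\partial_kU_\star)'+6k_\star^2U_\star'''+4k_\star^3(\partial_kU_\star)'''\big)\partial_x\tilde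 k .\end{aligned}$$ Insert plane waves $e^{\hat\lambda(\nu)t+\nu k_\star x}(\hat k(\nu),\hat M(\nu))$ with $$\hat\lambda=\nu k_\star\tilde\lambda_0+(\nu k_\star)^2\tilde\lambda_1+O(\nu^3),\quad \hat k=k_0+\nu k_\star k_1+O(\nu^2),\quad \hat M=M_0+\nu k_\star M_1+O(\nu^2).$$ Then identifying the $O(\nu)$ terms yields the two scalar relations of (a), and identifying the $O(\nu^2)$ terms yields the two scalar relations of (b).
   Context: $\langle f\rangle=\int_0^1 f(y)\,dy$ for $1$-periodic $f$. The symbol $\mathrm{d}$ denotes the differential with respect to the parameters $(k,M)$, so $\mathrm{d}F_\star(a,b)=a\,\partial_kF_\star+b\,\partial_MF_\star$. "Mean free" means of zero average. Primes denote derivatives with respect to the periodic variable. Travelling wave family: $U(\cdot\,;k,M)$ is $1$-periodic with $\langle U\rangle=M$, it has speed $c(k,M)$, it depends smoothly on the wavenumber $k$ and the mean $M$, and it satisfies $$-kcU'+6kUU'+k^3U'''+\delta(k^2U''+k^4U'''')=0 .$$ It is normalized so that $U(\cdot\,;k,M)=M+U^{(0)}(\cdot\,;k)$ and $c(k,M)=6M+c^{(0)}(k)$. These are travelling waves of the generalized Kuramoto-Sivashinsky equation $\partial_tu+6u\,\partial_xu+\partial_x^3u+\delta(\partial_x^2u+\partial_x^4u)=0$. On $1$-periodic functions, $$\mathcal{L}_{k,M}f=k\big((6U-c)f\big)'+k^3f'''+\delta(k^2f''+k^4f'''') .$$ Its kernel is one-dimensional and spanned by $U'$; its adjoint is Fredholm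 of index $0$ with one-dimensional kernel spanned by the constant function $1$. $\mathcal{L}_\star=\mathcal{L}_{k_\star,M_\star}$. In the Whitham system, $k$ and $M$ are functions of $(X,T)$, $U=U(y;k(X,T),M(X,T))$, $f$ is $1$-periodic in $y$, and $\varepsilon$ is the characteristic wavenumber of the modulation.
   Formalization: Corrected: v^M has ∂_M(U−⟨U⟩) in place of ∂_M U; f^k, f^M are unique under ⟨fU'⟩=0, not "mean free" (relations hold for every solution); plane waves use λ̂=νk⋆λ̃0+ν²k⋆λ̃1, k̂=k0+νk1, M̂=M0+νM1, without the extra factors k⋆. *)

theory Defs
  imports "HOL-Analysis.Analysis" "HOL-Library.Landau_Symbols"
begin

section \<open>Calculus on the line\<close>

definition D :: "(real \<Rightarrow> 'a::real_normed_vector) \<Rightarrow> real \<Rightarrow> 'a" where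
  "D f x = vector_derivative f (at x)"

definition avg :: "(real \<Rightarrow> 'a::real_normed_vector) \<Rightarrow> 'a" where
  "avg f = integral {0..1} f"

text \<open>\<open>Cper n\<close>: 1-periodic functions of class \<open>C^n\<close>.\<close>

definition Cper :: "nat \<Rightarrow> (real \<Rightarrow> 'a::real_normed_vector) set" where
  "Cper n = {f. (\<forall>x. f (x + 1) = f x) \<and> (\<forall>j<n. \<forall>x. (D ^^ j) f differentiable (at x)) \<and>
                continuous_on UNIV ((D ^^ n) f)}"

text \<open>\<open>C^n\<close> and \<open>C^\<infinity>\<close> functions of several real variables on an open set.\<close>

primrec Ck_on :: "nat \<Rightarrow> 'a::euclidean_space set \<Rightarrow> ('a \<Rightarrow> real) \<Rightarrow> bool" where
  "Ck_on 0 S f \<longleftrightarrow> continuous_on S f"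
| "Ck_on (Suc n) S f \<longleftrightarrow> (\<forall>x\<in>S. f differentiable (at x)) \<and>
     (\<forall>b\<in>Basis. Ck_on n S (\<lambda>x. frechet_derivative f (at x) b))"

definition smooth_on :: "'a::euclidean_space set \<Rightarrow> ('a \<Rightarrow> real) \<Rightarrow> bool" where
  "smooth_on S f \<longleftrightarrow> (\<forall>n. Ck_on n S f)"

text \<open>Partial derivatives in the parameters \<open>(k, M)\<close>, and the differential
  \<open>dF(a, b)\<close>, where \<open>a\<close> and \<open>b\<close> may be complex.\<close>

definition dk :: "(real \<Rightarrow> real \<Rightarrow> real) \<Rightarrow> real \<Rightarrow> real \<Rightarrow> real" where
  "dk F k M = D (\<lambda>k'. F k' M) k"

definition dM :: "(real \<Rightarrow> real \<Rightarrow> real) \<Rightarrow> real \<Rightarrow> real \<Rightarrow> real" where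
  "dM F k M = D (\<lambda>M'. F k M') M"

definition dpar :: "(real \<Rightarrow> real \<Rightarrow> real) \<Rightarrow> real \<Rightarrow> real \<Rightarrow> 'a \<Rightarrow> 'a \<Rightarrow> 'a::real_normed_vector" where
  "dpar F k M a b = dk F k M *\<^sub>R a + dM F k M *\<^sub>R b"


section \<open>The family of travelling waves and its linearized operators\<close>

text \<open>\<open>U k M\<close> is the profile with wavenumber \<open>k\<close> and mean \<open>M\<close>; the parameters \<open>(k, M)\<close>
  range over the open set \<open>\<Omega>\<close>.\<close>

definition wave_family ::
  "real \<Rightarrow> (real \<times> real) set \<Rightarrow> (real \<Rightarrow> real \<Rightarrow> real \<Rightarrow> real) \<Rightarrow> (real \<Rightarrow> real \<Rightarrow> real) \<Rightarrow> bool" where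
  "wave_family \<delta> \<Omega> U c \<longleftrightarrow>
     open \<Omega> \<and> (\<forall>(k, M)\<in>\<Omega>. k > 0) \<and>
     smooth_on (\<Omega> \<times> UNIV) (\<lambda>((k, M), y). U k M y) \<and>
     smooth_on \<Omega> (\<lambda>(k, M). c k M) \<and>
     (\<forall>(k, M)\<in>\<Omega>. (\<forall>y. U k M (y + 1) = U k M y) \<and> avg (U k M) = M \<and>
        (\<forall>y. - k * c k M * D (U k M) y + 6 * k * U k M y * D (U k M) y + k^3 * (D ^^ 3) (U k M) y
             + \<delta> * (k^2 * (D ^^ 2) (U k M) y + k^4 * (D ^^ 4) (U k M) y) = 0)) \<and>
     (\<exists>U0 c0. \<forall>(k, M)\<in>\<Omega>. (\<forall>y. U k M y = M + U0 k y) \<and> c k M = 6 * M + c0 k)"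

definition Lop ::
  "real \<Rightarrow> real \<Rightarrow> real \<Rightarrow> (real \<Rightarrow> real) \<Rightarrow> (real \<Rightarrow> 'a::real_normed_vector) \<Rightarrow> real \<Rightarrow> 'a" where
  "Lop \<delta> k s V f y =
     k *\<^sub>R D (\<lambda>z. (6 * V z - s) *\<^sub>R f z) y + k^3 *\<^sub>R (D ^^ 3) f y
     + \<delta> *\<^sub>R (k^2 *\<^sub>R (D ^^ 2) f y + k^4 *\<^sub>R (D ^^ 4) f y)"

text \<open>The \<open>L\<^sup>2\<close>-adjoint of \<open>Lop \<delta> k s V\<close> on 1-periodic functions.\<close>

definition Ladj ::
  "real \<Rightarrow> real \<Rightarrow> real \<Rightarrow> (real \<Rightarrow> real) \<Rightarrow> (real \<Rightarrow> 'a::real_normed_vector) \<Rightarrow> real \<Rightarrow> 'a" where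
  "Ladj \<delta> k s V f y =
     - ((k * (6 * V y - s)) *\<^sub>R D f y) - k^3 *\<^sub>R (D ^^ 3) f y
     + \<delta> *\<^sub>R (k^2 *\<^sub>R (D ^^ 2) f y + k^4 *\<^sub>R (D ^^ 4) f y)"

text \<open>\<open>quot_dim V W n\<close>: the complex vector space \<open>V / W\<close> has dimension \<open>n\<close>.\<close>

definition quot_dim :: "(real \<Rightarrow> complex) set \<Rightarrow> (real \<Rightarrow> complex) set \<Rightarrow> nat \<Rightarrow> bool" where
  "quot_dim V W n \<longleftrightarrow>
     (\<exists>b. (\<forall>i<n. b i \<in> V) \<and>
          (\<forall>h\<in>V. \<exists>!a. a \<in> extensional {..<n} \<and> (\<lambda>x. h x - (\<Sum>i<n. a i * b i x)) \<in> W))"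

definition kernel :: "((real \<Rightarrow> complex) \<Rightarrow> real \<Rightarrow> complex) \<Rightarrow> (real \<Rightarrow> complex) set" where
  "kernel A = {f \<in> Cper 4. \<forall>x. A f x = 0}"

text \<open>Fredholm of index 0 from periodic \<open>C^4\<close> to periodic continuous functions: kernel and
  cokernel have the same finite dimension. Finite codimension already makes the range of a bounded
  operator between Banach spaces closed.\<close>

definition fredholm_index_0 :: "((real \<Rightarrow> complex) \<Rightarrow> real \<Rightarrow> complex) \<Rightarrow> bool" where
  "fredholm_index_0 A \<longleftrightarrow>
     (\<exists>n. quot_dim (kernel A) {\<lambda>x. 0} n \<and> quot_dim (Cper 0) (A ` Cper 4) n)"

text \<open>By duality and elliptic regularity, the operator is Fredholm of index 0 exactly if its adjoint
  is; both forms are listed.\<close>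

definition spectral_structure ::
  "real \<Rightarrow> (real \<times> real) set \<Rightarrow> (real \<Rightarrow> real \<Rightarrow> real \<Rightarrow> real) \<Rightarrow> (real \<Rightarrow> real \<Rightarrow> real) \<Rightarrow> bool" where
  "spectral_structure \<delta> \<Omega> U c \<longleftrightarrow>
     (\<forall>(k, M)\<in>\<Omega>.
        (\<exists>y. D (U k M) y \<noteq> 0) \<and>
        kernel (Lop \<delta> k (c k M) (U k M)) = range (\<lambda>a y. a * complex_of_real (D (U k M) y)) \<and>
        kernel (Ladj \<delta> k (c k M) (U k M)) = range (\<lambda>a y. a) \<and>
        fredholm_index_0 (Lop \<delta> k (c k M) (U k M)) \<and>
        fredholm_index_0 (Ladj \<delta> k (c k M) (U k M)))"


section \<open>The Bloch eigenvalue problem\<close>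

definition bloch_D :: "complex \<Rightarrow> (real \<Rightarrow> complex) \<Rightarrow> real \<Rightarrow> complex" where
  "bloch_D \<nu> f x = D f x + \<nu> * f x"

definition bloch_op ::
  "real \<Rightarrow> real \<Rightarrow> real \<Rightarrow> (real \<Rightarrow> real) \<Rightarrow> complex \<Rightarrow> (real \<Rightarrow> complex) \<Rightarrow> real \<Rightarrow> complex" where
  "bloch_op \<delta> k s V \<nu> f x =
     k * bloch_D \<nu> (\<lambda>z. complex_of_real (6 * V z - s) * f z) x + k^3 * (bloch_D \<nu> ^^ 3) f x
     + \<delta> * (k^2 * (bloch_D \<nu> ^^ 2) f x + k^4 * (bloch_D \<nu> ^^ 4) f x)"

text \<open>\<open>\<nu> \<rightarrow> 0\<close> along the imaginary axis.\<close>

definition im0 :: "complex filter" where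
  "im0 = at 0 within {\<nu>. Re \<nu> = 0}"

text \<open>Eigenpairs that expand in \<open>\<nu>\<close>; the remainder of the eigenfunction is \<open>O(\<nu>^3)\<close> in the
  \<open>C^4\<close> norm, the norm of the domain of the operator.\<close>

definition bloch_expansion ::
  "real \<Rightarrow> real \<Rightarrow> real \<Rightarrow> (real \<Rightarrow> real) \<Rightarrow> (complex \<Rightarrow> complex) \<Rightarrow> (complex \<Rightarrow> real \<Rightarrow> complex) \<Rightarrow>
   complex \<Rightarrow> complex \<Rightarrow> (real \<Rightarrow> complex) \<Rightarrow> (real \<Rightarrow> complex) \<Rightarrow> (real \<Rightarrow> complex) \<Rightarrow> bool" where
  "bloch_expansion \<delta> k s V lam u l0 l1 u0 u1 u2 \<longleftrightarrow>
     (\<forall>\<^sub>F \<nu> in im0. u \<nu> \<in> Cper 4 \<and> (\<exists>x. u \<nu> x \<noteq> 0) \<and>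
        (\<forall>x. bloch_op \<delta> k s V \<nu> (u \<nu>) x = - lam \<nu> * u \<nu> x)) \<and>
     (\<lambda>\<nu>. lam \<nu> - (\<nu> * l0 + \<nu>^2 * l1)) \<in> O[im0](\<lambda>\<nu>. \<nu>^3) \<and>
     u0 \<in> Cper 4 \<and> u1 \<in> Cper 4 \<and> u2 \<in> Cper 4 \<and>
     (\<exists>B. \<forall>\<^sub>F \<nu> in im0. \<forall>j\<le>4. \<forall>x.
        norm ((D ^^ j) (\<lambda>z. u \<nu> z - (u0 z + \<nu> * u1 z + \<nu>^2 * u2 z)) x) \<le> B * norm \<nu> ^ 3)"


section \<open>The scalar relations\<close>

text \<open>Each relation is written as left-hand side minus right-hand side. Here \<open>l0\<close>, \<open>l1\<close> stand for
  the rescaled coefficients \<open>\<lambda>\<^sub>0 / k\<close>, \<open>\<lambda>\<^sub>1 / k\<close>.\<close>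

definition rel1_k ::
  "(real \<Rightarrow> real \<Rightarrow> real) \<Rightarrow> real \<Rightarrow> real \<Rightarrow> complex \<Rightarrow> complex \<Rightarrow> complex \<Rightarrow> complex" where
  "rel1_k c k M l0 k0 M0 = l0 * k0 + k * dpar c k M k0 M0"

definition rel1_M ::
  "(real \<Rightarrow> real \<Rightarrow> real \<Rightarrow> real) \<Rightarrow> (real \<Rightarrow> real \<Rightarrow> real) \<Rightarrow> real \<Rightarrow> real \<Rightarrow>
   complex \<Rightarrow> complex \<Rightarrow> complex \<Rightarrow> complex" where
  "rel1_M U c k M l0 k0 M0 =
     (l0 - complex_of_real (c k M)) * M0 + dpar (\<lambda>k M. avg (\<lambda>y. 3 * (U k M y)^2)) k M k0 M0"

definition rel2_k ::
  "(real \<Rightarrow> real \<Rightarrow> real) \<Rightarrow> real \<Rightarrow> real \<Rightarrow> complex \<Rightarrow> complex \<Rightarrow> complex \<Rightarrow> complex \<Rightarrow>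
   complex \<Rightarrow> complex \<Rightarrow> (real \<Rightarrow> complex) \<Rightarrow> (real \<Rightarrow> complex) \<Rightarrow> complex" where
  "rel2_k c k M l0 l1 k0 M0 k1 M1 fk fM =
     (l1 * k0 + l0 * k1 + k * dpar c k M k1 M1) - (- 6 * k * (k0 * avg fk + M0 * avg fM))"

definition rel2_M ::
  "real \<Rightarrow> (real \<Rightarrow> real \<Rightarrow> real \<Rightarrow> real) \<Rightarrow> (real \<Rightarrow> real \<Rightarrow> real) \<Rightarrow> real \<Rightarrow> real \<Rightarrow>
   complex \<Rightarrow> complex \<Rightarrow> complex \<Rightarrow> complex \<Rightarrow> complex \<Rightarrow> complex \<Rightarrow>
   (real \<Rightarrow> complex) \<Rightarrow> (real \<Rightarrow> complex) \<Rightarrow> complex" where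
  "rel2_M \<delta> U c k M l0 l1 k0 M0 k1 M1 fk fM =
     ((l0 - complex_of_real (c k M)) * M1 + l1 * M0 + 3 * dpar (\<lambda>k M. avg (\<lambda>y. (U k M y)^2)) k M k1 M1)
     - (- \<delta> * k * M0 + avg (\<lambda>y. complex_of_real (6 * U k M y) * (fk y - avg fk)) * k0
                     + avg (\<lambda>y. complex_of_real (6 * U k M y) * (fM y - avg fM)) * M0)"

definition vk ::
  "real \<Rightarrow> (real \<Rightarrow> real \<Rightarrow> real \<Rightarrow> real) \<Rightarrow> (real \<Rightarrow> real \<Rightarrow> real) \<Rightarrow> real \<Rightarrow> real \<Rightarrow>
   complex \<Rightarrow> real \<Rightarrow> complex" where
  "vk \<delta> U c k M l0 y =
     (let Uk = (\<lambda>z. dk (\<lambda>k M. U k M z) k M) in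
      (l0 - complex_of_real (c k M)) * complex_of_real (Uk y)
      + complex_of_real (3 * dk (\<lambda>k M. (U k M y)^2 - avg (\<lambda>z. (U k M z)^2)) k M)
      + complex_of_real (3 * k * (D ^^ 2) (\<lambda>z. U k M z + k * Uk z) y)
      + complex_of_real (\<delta> * (D (U k M) y + 6 * k^2 * (D ^^ 3) (U k M) y
                               + 2 * k * D Uk y + 4 * k^3 * (D ^^ 3) Uk y)))"

text \<open>The first term carries \<open>\<partial>\<^sub>M(U - \<langle>U\<rangle>)\<close>, as in the equation for \<open>f\<close> in the Whitham system:
  with \<open>\<partial>\<^sub>M U = 1\<close> in its place, \<open>vM\<close> would have mean \<open>l0 - c\<close> instead of 0. In \<open>vk\<close> this makes no
  difference, because \<open>\<partial>\<^sub>k\<langle>U\<rangle> = 0\<close>.\<close>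

definition vM ::
  "(real \<Rightarrow> real \<Rightarrow> real \<Rightarrow> real) \<Rightarrow> (real \<Rightarrow> real \<Rightarrow> real) \<Rightarrow> real \<Rightarrow> real \<Rightarrow>
   complex \<Rightarrow> real \<Rightarrow> complex" where
  "vM U c k M l0 y =
     (l0 - complex_of_real (c k M)) * complex_of_real (dM (\<lambda>k M. U k M y - avg (U k M)) k M)
     + complex_of_real (3 * dM (\<lambda>k M. (U k M y)^2 - avg (\<lambda>z. (U k M z)^2)) k M)"


section \<open>The second order Whitham system\<close>

text \<open>Residuals (left-hand side minus right-hand side) of the four equations, for fields
  \<open>\<kappa> X T\<close>, \<open>\<mu> X T\<close> (wavenumber and mean) and \<open>f X T y\<close>.\<close>

definition whitham_k ::
  "real \<Rightarrow> (real \<Rightarrow> real \<Rightarrow> real) \<Rightarrow> (real \<Rightarrow> real \<Rightarrow> real) \<Rightarrow> (real \<Rightarrow> real \<Rightarrow> real) \<Rightarrow>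
   (real \<Rightarrow> real \<Rightarrow> real \<Rightarrow> real) \<Rightarrow> real \<Rightarrow> real \<Rightarrow> real" where
  "whitham_k \<epsilon> c \<kappa> \<mu> f X T =
     D (\<lambda>T. \<kappa> X T) T + D (\<lambda>X. \<kappa> X T * c (\<kappa> X T) (\<mu> X T)) X
     - (- \<epsilon> * D (\<lambda>X. avg (\<lambda>y. 6 * \<kappa> X T * f X T y)) X)"

definition whitham_M ::
  "real \<Rightarrow> real \<Rightarrow> (real \<Rightarrow> real \<Rightarrow> real \<Rightarrow> real) \<Rightarrow> (real \<Rightarrow> real \<Rightarrow> real) \<Rightarrow>
   (real \<Rightarrow> real \<Rightarrow> real) \<Rightarrow> (real \<Rightarrow> real \<Rightarrow> real \<Rightarrow> real) \<Rightarrow> real \<Rightarrow> real \<Rightarrow> real" where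
  "whitham_M \<epsilon> \<delta> U \<kappa> \<mu> f X T =
     D (\<lambda>T. \<mu> X T) T + D (\<lambda>X. avg (\<lambda>y. 3 * (U (\<kappa> X T) (\<mu> X T) y)^2)) X
     - (\<epsilon> * D (\<lambda>X. avg (\<lambda>y. 6 * U (\<kappa> X T) (\<mu> X T) y * (f X T y - avg (f X T)))) X
        - \<epsilon> * \<delta> * (D ^^ 2) (\<lambda>X. \<mu> X T) X)"

definition whitham_f ::
  "real \<Rightarrow> (real \<Rightarrow> real \<Rightarrow> real \<Rightarrow> real) \<Rightarrow> (real \<Rightarrow> real \<Rightarrow> real) \<Rightarrow> (real \<Rightarrow> real \<Rightarrow> real) \<Rightarrow>
   (real \<Rightarrow> real \<Rightarrow> real) \<Rightarrow> (real \<Rightarrow> real \<Rightarrow> real \<Rightarrow> real) \<Rightarrow> real \<Rightarrow> real \<Rightarrow> real \<Rightarrow> real" where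
  "whitham_f \<delta> U c \<kappa> \<mu> f X T y =
     (let V = (\<lambda>X T. U (\<kappa> X T) (\<mu> X T)); k = \<kappa> X T; kX = D (\<lambda>X. \<kappa> X T) X in
      Lop \<delta> k (c (\<kappa> X T) (\<mu> X T)) (V X T) (f X T) y
      - (D (\<lambda>T. V X T y - avg (V X T)) T
         + 3 * D (\<lambda>X. (V X T y)^2 - avg (\<lambda>z. (V X T z)^2)) X
         + 3 * (k^2 * D (\<lambda>X. (D ^^ 2) (V X T) y) X + k * kX * (D ^^ 2) (V X T) y)
         + \<delta> * (2 * k * D (\<lambda>X. D (V X T) y) X + kX * D (V X T) y)
         + \<delta> * (4 * k^3 * D (\<lambda>X. (D ^^ 3) (V X T) y) X + 6 * k^2 * kX * (D ^^ 3) (V X T) y)))"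

definition whitham_orth ::
  "(real \<Rightarrow> real \<Rightarrow> real \<Rightarrow> real) \<Rightarrow> (real \<Rightarrow> real \<Rightarrow> real) \<Rightarrow> (real \<Rightarrow> real \<Rightarrow> real) \<Rightarrow>
   (real \<Rightarrow> real \<Rightarrow> real \<Rightarrow> real) \<Rightarrow> real \<Rightarrow> real \<Rightarrow> real" where
  "whitham_orth U \<kappa> \<mu> f X T = avg (\<lambda>y. f X T y * D (U (\<kappa> X T) (\<mu> X T)) y)"

definition whitham_solution ::
  "real \<Rightarrow> real \<Rightarrow> (real \<Rightarrow> real \<Rightarrow> real \<Rightarrow> real) \<Rightarrow> (real \<Rightarrow> real \<Rightarrow> real) \<Rightarrow>
   (real \<Rightarrow> real \<Rightarrow> real) \<Rightarrow> (real \<Rightarrow> real \<Rightarrow> real) \<Rightarrow> (real \<Rightarrow> real \<Rightarrow> real \<Rightarrow> real) \<Rightarrow> bool" where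
  "whitham_solution \<epsilon> \<delta> U c \<kappa> \<mu> f \<longleftrightarrow>
     (\<forall>X T. whitham_k \<epsilon> c \<kappa> \<mu> f X T = 0 \<and> whitham_M \<epsilon> \<delta> U \<kappa> \<mu> f X T = 0 \<and>
            whitham_orth U \<kappa> \<mu> f X T = 0 \<and> (\<forall>y. whitham_f \<delta> U c \<kappa> \<mu> f X T y = 0))"

definition smooth_params ::
  "(real \<Rightarrow> real \<Rightarrow> real) \<Rightarrow> (real \<Rightarrow> real \<Rightarrow> real) \<Rightarrow> bool" where
  "smooth_params \<kappa> \<mu> \<longleftrightarrow> smooth_on UNIV (\<lambda>(x, t). \<kappa> x t) \<and> smooth_on UNIV (\<lambda>(x, t). \<mu> x t)"

definition smooth_periodic_field :: "(real \<Rightarrow> real \<Rightarrow> real \<Rightarrow> real) \<Rightarrow> bool" where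
  "smooth_periodic_field f \<longleftrightarrow>
     smooth_on UNIV (\<lambda>(x, t, y). f x t y) \<and> (\<forall>x t y. f x t (y + 1) = f x t y)"


section \<open>The linearized Whitham system in the co-moving frame\<close>

text \<open>Residuals of the linear equations at \<open>(k, M)\<close>, for real or complex fields
  \<open>\<kappa> x t\<close>, \<open>\<mu> x t\<close>, \<open>g x t y\<close>.\<close>

definition lin_k ::
  "(real \<Rightarrow> real \<Rightarrow> real) \<Rightarrow> real \<Rightarrow> real \<Rightarrow> (real \<Rightarrow> real \<Rightarrow> 'a) \<Rightarrow> (real \<Rightarrow> real \<Rightarrow> 'a) \<Rightarrow>
   (real \<Rightarrow> real \<Rightarrow> real \<Rightarrow> 'a) \<Rightarrow> real \<Rightarrow> real \<Rightarrow> 'a::real_normed_vector" where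
  "lin_k c k M \<kappa> \<mu> g x t =
     D (\<lambda>t. \<kappa> x t) t + k *\<^sub>R dpar c k M (D (\<lambda>x. \<kappa> x t) x) (D (\<lambda>x. \<mu> x t) x)
     - (- (6 * k) *\<^sub>R D (\<lambda>x. avg (g x t)) x)"

definition lin_M ::
  "real \<Rightarrow> (real \<Rightarrow> real \<Rightarrow> real \<Rightarrow> real) \<Rightarrow> (real \<Rightarrow> real \<Rightarrow> real) \<Rightarrow> real \<Rightarrow> real \<Rightarrow>
   (real \<Rightarrow> real \<Rightarrow> 'a) \<Rightarrow> (real \<Rightarrow> real \<Rightarrow> 'a) \<Rightarrow>
   (real \<Rightarrow> real \<Rightarrow> real \<Rightarrow> 'a) \<Rightarrow> real \<Rightarrow> real \<Rightarrow> 'a::real_normed_vector" where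
  "lin_M \<delta> U c k M \<kappa> \<mu> g x t =
     D (\<lambda>t. \<mu> x t) t
     + dpar (\<lambda>k M. avg (\<lambda>y. 3 * (U k M y)^2)) k M (D (\<lambda>x. \<kappa> x t) x) (D (\<lambda>x. \<mu> x t) x)
     - c k M *\<^sub>R D (\<lambda>x. \<mu> x t) x
     - (D (\<lambda>x. avg (\<lambda>y. (6 * U k M y) *\<^sub>R (g x t y - avg (g x t)))) x
        - \<delta> *\<^sub>R (D ^^ 2) (\<lambda>x. \<mu> x t) x)"

definition lin_f ::
  "real \<Rightarrow> (real \<Rightarrow> real \<Rightarrow> real \<Rightarrow> real) \<Rightarrow> (real \<Rightarrow> real \<Rightarrow> real) \<Rightarrow> real \<Rightarrow> real \<Rightarrow>
   (real \<Rightarrow> real \<Rightarrow> 'a) \<Rightarrow> (real \<Rightarrow> real \<Rightarrow> 'a) \<Rightarrow>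
   (real \<Rightarrow> real \<Rightarrow> real \<Rightarrow> 'a) \<Rightarrow> real \<Rightarrow> real \<Rightarrow> real \<Rightarrow> 'a::real_normed_vector" where
  "lin_f \<delta> U c k M \<kappa> \<mu> g x t y =
     (let Uk = (\<lambda>z. dk (\<lambda>k M. U k M z) k M);
          Q = (\<lambda>k M. 3 * (U k M y)^2 - avg (\<lambda>z. 3 * (U k M z)^2));
          kx = D (\<lambda>x. \<kappa> x t) x; Mx = D (\<lambda>x. \<mu> x t) x in
      Lop \<delta> k (c k M) (U k M) (g x t) y
      - (Uk y *\<^sub>R (D (\<lambda>t. \<kappa> x t) t - c k M *\<^sub>R kx) + dk Q k M *\<^sub>R kx + dM Q k M *\<^sub>R Mx
         + (3 * (k^2 * (D ^^ 2) Uk y + k * (D ^^ 2) (U k M) y)) *\<^sub>R kx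
         + (\<delta> * (D (U k M) y + 2 * k * D Uk y + 6 * k^2 * (D ^^ 3) (U k M) y
                 + 4 * k^3 * (D ^^ 3) Uk y)) *\<^sub>R kx))"

definition lin_orth ::
  "(real \<Rightarrow> real \<Rightarrow> real \<Rightarrow> real) \<Rightarrow> real \<Rightarrow> real \<Rightarrow>
   (real \<Rightarrow> real \<Rightarrow> real \<Rightarrow> 'a) \<Rightarrow> real \<Rightarrow> real \<Rightarrow> 'a::real_normed_vector" where
  "lin_orth U k M g x t = avg (\<lambda>y. D (U k M) y *\<^sub>R g x t y)"

text \<open>The conditions that determine \<open>g\<close> from \<open>\<kappa>\<close> and \<open>\<mu>\<close>.\<close>

definition lin_corrector ::
  "real \<Rightarrow> (real \<Rightarrow> real \<Rightarrow> real \<Rightarrow> real) \<Rightarrow> (real \<Rightarrow> real \<Rightarrow> real) \<Rightarrow> real \<Rightarrow> real \<Rightarrow>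
   (real \<Rightarrow> real \<Rightarrow> 'a::real_normed_vector) \<Rightarrow> (real \<Rightarrow> real \<Rightarrow> 'a) \<Rightarrow>
   (real \<Rightarrow> real \<Rightarrow> real \<Rightarrow> 'a) \<Rightarrow> bool" where
  "lin_corrector \<delta> U c k M \<kappa> \<mu> g \<longleftrightarrow>
     (\<forall>x t. g x t \<in> Cper 4 \<and> lin_orth U k M g x t = 0 \<and> (\<forall>y. lin_f \<delta> U c k M \<kappa> \<mu> g x t y = 0))"

definition plane_wave :: "real \<Rightarrow> complex \<Rightarrow> complex \<Rightarrow> real \<Rightarrow> real \<Rightarrow> complex" where
  "plane_wave k \<nu> l x t = exp (l * t + \<nu> * k * x)"

end

theory Submission
  imports Defs
begin

text \<open>\<open>\<L>\<^sub>\<star>\<close> maps into derivatives of periodic functions, so its range is contained in the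
  mean free functions; since the kernel is a line and the index is 0, it is
  equal to them. Differentiating the profile equation gives \<open>\<L>\<^sub>\<star>[\<partial>\<^sub>k U]\<close> and \<open>\<L>\<^sub>\<star>[1] = 6 k U'\<close>. With these
  the orders \<open>\<nu>\<close> and \<open>\<nu>^2\<close> of the eigenvalue equation read \<open>\<L>\<^sub>\<star>[w] = 6 k B U'\<close>, hence \<open>w - B\<close> is a
  multiple of \<open>U'\<close>, and the average of \<open>w\<close> identifies \<open>B\<close>: this is the relation for \<open>k\<close>. The relation
  for \<open>M\<close> is the average of the eigenvalue equation, which carries an additional factor \<open>\<nu>\<close>.
  The residuals of the Whitham system at a perturbation of size \<open>s\<close> of a constant state are \<open>s\<close> times a
  continuous function of \<open>s\<close>, whose value at 0 is the linearization. On plane waves the corrector \<open>g\<close> is,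
  up to a multiple of \<open>U'\<close>, a combination of \<open>f\<^sup>k\<close>, \<open>f\<^sup>M\<close> and a solution of \<open>\<L>\<^sub>\<star>[h] = \<partial>\<^sub>k U\<close>.\<close>

subsection \<open>Periodic functions\<close>

text \<open>Being mean free does not single out f^k and f^M: since <U'> = 0, adding a multiple of U'
  changes neither L[f] nor <f>, while adding a constant changes L[f]. So all solutions have the same
  mean and form a line. The normalization <f U'> = 0, the one of the Whitham corrector, picks one of
  them because <U'^2> is not 0. The second order relations are proved for every solution: as <U'> =
  <U U'> = 0, the averages in them do not depend on the choice, and only k2 does. The second order
  relation for M belongs to the power \<nu>^3, one more than the expansion of the eigenfunction
  provides. It is accessible because averaging annihilates L, the only place where a coefficient of
  order three could enter, and because <u0> = 0. For plane waves the corrector involves the exact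
  rate of growth, whereas f^k is built with its leading coefficient. The defect is a multiple of
  \<partial>_k U of size O(\<nu>^2); the outer x-derivative adds one more factor \<nu>, so it stays
  below the orders that are compared.\<close>

lemma D_eqI: "(f has_vector_derivative d) (at x) \<Longrightarrow> D f x = d"
  by (simp add: D_def vector_derivative_at)

lemma D_eqI_real: "(f has_real_derivative d) (at x) \<Longrightarrow> D f x = d"
  by (simp add: D_eqI has_real_derivative_iff_has_vector_derivative)

lemma D_works: "f differentiable (at x) \<Longrightarrow> (f has_vector_derivative D f x) (at x)"
  by (simp add: D_def vector_derivative_works)

lemma D_const [simp]: "D (\<lambda>x. a) = (\<lambda>x. 0)"
  by (rule ext, rule D_eqI) (rule has_vector_derivative_const)

lemma D_funpow_const [simp]: "0 < n \<Longrightarrow> (D ^^ n) (\<lambda>x. a) = (\<lambda>x. 0)"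
proof (induction n)
  case (Suc n)
  then show ?case by (cases n) auto
qed auto

lemma D_numeral:
  "(D ^^ 2) f = D (D f)" "(D ^^ 3) f = D (D (D f))" "(D ^^ 4) f = D (D (D (D f)))"
  by (simp_all add: numeral_eq_Suc)

text \<open>\<open>D\<close> is a choice term, so it suffices that both functions admit the same
  candidates d. This covers points without a derivative as well.\<close>

lemma D_cong_ev:
  assumes "\<forall>\<^sub>F x in nhds a. f x = g x"
  shows "D f a = D g a"
proof -
  have e: "f a = g a" using assms by (rule eventually_nhds_x_imp_x)
  have "(f has_vector_derivative d) (at a) \<longleftrightarrow> (g has_vector_derivative d) (at a)" for d
    using has_vector_derivative_cong_ev[of UNIV f g a d] assms e
    by (auto elim: eventually_mono)
  then show ?thesis by (simp add: D_def vector_derivative_def)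
qed

lemma has_vector_derivative_translate:
  assumes "(f has_vector_derivative d) (at (x + a))"
  shows "((\<lambda>x. f (x + a)) has_vector_derivative d) (at x)"
proof -
  have "((\<lambda>x. x + a) has_vector_derivative 1) (at x)"
    by (auto intro!: derivative_eq_intros)
  then have "(f \<circ> (\<lambda>x. x + a) has_vector_derivative (1::real) *\<^sub>R d) (at x)"
    by (rule vector_diff_chain_at) (use assms in simp)
  then show ?thesis by (simp add: o_def)
qed

lemma D_periodic:
  assumes "\<And>x. f (x + 1) = f x"
  shows "D f (x + 1) = D f x"
proof -
  have e: "(\<lambda>x. f (x + 1)) = f" "(\<lambda>x. f (x + (-1))) = f"
    using assms assms[of "y - 1" for y] by auto
  have "(f has_vector_derivative d) (at (x + 1)) \<longleftrightarrow> (f has_vector_derivative d) (at x)" for d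
    using has_vector_derivative_translate[of f d x 1]
      has_vector_derivative_translate[of f d "x + 1" "-1"] e by auto
  then show ?thesis by (simp add: D_def vector_derivative_def)
qed

lemma Cper_0: "f \<in> Cper 0 \<longleftrightarrow> (\<forall>x. f (x + 1) = f x) \<and> continuous_on UNIV f"
  by (simp add: Cper_def)

text \<open>Peeling off the innermost derivative, where the definition peels off the outermost,
  allows inductions on the order with the function generalized to \<open>D f\<close>.\<close>

lemma Cper_Suc:
  "f \<in> Cper (Suc n) \<longleftrightarrow> (\<forall>x. f (x + 1) = f x) \<and> (\<forall>x. f differentiable (at x)) \<and> D f \<in> Cper n"
proof -
  have "(\<forall>j<Suc n. \<forall>x. (D ^^ j) f differentiable (at x)) \<longleftrightarrow>
     (\<forall>x. f differentiable (at x)) \<and> (\<forall>j<n. \<forall>x. (D ^^ j) (D f) differentiable (at x))"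
    by (auto simp: less_Suc_eq_0_disj funpow_swap1)
  then show ?thesis
    using D_periodic[of f] by (auto simp: Cper_def funpow_swap1)
qed

lemma Cper_SucI:
  assumes "\<And>x. f (x + 1) = f x" "\<And>x. (f has_vector_derivative f' x) (at x)" "f' \<in> Cper n"
  shows "f \<in> Cper (Suc n)"
proof -
  have "D f = f'" using assms(2) D_eqI by blast
  then show ?thesis
    using assms differentiableI_vector[OF assms(2)] by (auto simp: Cper_Suc)
qed

lemma Cper_D: "f \<in> Cper (Suc n) \<Longrightarrow> D f \<in> Cper n"
  by (simp add: Cper_Suc)

lemma Cper_Suc_D: "f \<in> Cper (Suc n) \<Longrightarrow> (f has_vector_derivative D f x) (at x)"
  by (simp add: Cper_Suc D_works)

lemma Cper_periodic: "f \<in> Cper n \<Longrightarrow> f (x + 1) = f x"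
  by (simp add: Cper_def)

lemma Cper_Suc_Cper: "f \<in> Cper (Suc n) \<Longrightarrow> f \<in> Cper n"
proof (induction n arbitrary: f)
  case 0
  then show ?case
    by (auto simp: Cper_0 Cper_Suc continuous_on_eq_continuous_at
        intro!: differentiable_imp_continuous_within)
next
  case (Suc n)
  then show ?case by (subst Cper_Suc) (auto simp: Cper_Suc[of _ "Suc n"])
qed

lemma Cper_mono: "f \<in> Cper n \<Longrightarrow> m \<le> n \<Longrightarrow> f \<in> Cper m"
  by (induction n) (auto simp: le_Suc_eq dest: Cper_Suc_Cper)

lemma Cper_cont: "f \<in> Cper n \<Longrightarrow> continuous_on A f"
  using Cper_mono[of f n 0] continuous_on_subset by (auto simp: Cper_0)

lemma Cper_D4:
  assumes "f \<in> Cper 4"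
  shows "D f \<in> Cper 3" "D (D f) \<in> Cper 2" "D (D (D f)) \<in> Cper 1" "D (D (D (D f))) \<in> Cper 0"
  using assms by (auto simp: numeral_eq_Suc Cper_Suc)

lemma Cper_D4_deriv:
  assumes "f \<in> Cper 4"
  shows "(f has_vector_derivative D f x) (at x)"
    "(D f has_vector_derivative D (D f) x) (at x)"
    "(D (D f) has_vector_derivative D (D (D f)) x) (at x)"
    "(D (D (D f)) has_vector_derivative D (D (D (D f))) x) (at x)"
  using assms by (auto simp: numeral_eq_Suc Cper_Suc D_works)

lemma Cper_const [simp]: "(\<lambda>x. a) \<in> Cper n"
  by (induction n arbitrary: a) (auto simp: Cper_0 Cper_Suc)

text \<open>Taken for a general real-linear map so that it serves constant factors, the embedding of
  the reals into the complex numbers, and the real part alike.\<close>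

lemma Cper_blin:
  assumes h: "bounded_linear h"
  shows "f \<in> Cper n \<Longrightarrow> (\<lambda>x. h (f x)) \<in> Cper n"
proof (induction n arbitrary: f)
  case 0
  then show ?case
    by (auto simp: Cper_0 intro!: bounded_linear.continuous_on[OF h])
next
  case (Suc n)
  show ?case
    by (rule Cper_SucI[where f'="\<lambda>x. h (D f x)"])
       (use Suc in \<open>auto simp: Cper_Suc intro!: bounded_linear.has_vector_derivative[OF h] D_works\<close>)
qed

lemma D_blin:
  assumes "bounded_linear h" "f \<in> Cper (Suc n)"
  shows "D (\<lambda>x. h (f x)) = (\<lambda>x. h (D f x))"
  by (intro ext D_eqI bounded_linear.has_vector_derivative[OF assms(1)] Cper_Suc_D[OF assms(2)])

lemma D_pow_blin:
  assumes h: "bounded_linear h"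
  shows "f \<in> Cper n \<Longrightarrow> j \<le> n \<Longrightarrow> (D ^^ j) (\<lambda>x. h (f x)) = (\<lambda>x. h ((D ^^ j) f x))"
proof (induction j arbitrary: f n)
  case (Suc j)
  then obtain m where m: "n = Suc m" by (cases n) auto
  then have "(D ^^ j) (D (\<lambda>x. h (f x))) = (D ^^ j) (\<lambda>x. h (D f x))"
    using D_blin[OF h] Suc.prems by simp
  also have "\<dots> = (\<lambda>x. h ((D ^^ j) (D f) x))"
    using Suc m by (intro Suc.IH[of _ m]) (auto simp: Cper_Suc)
  finally show ?case by (simp add: funpow_swap1)
qed auto

lemma Cper_add: "f \<in> Cper n \<Longrightarrow> g \<in> Cper n \<Longrightarrow> (\<lambda>x. f x + g x) \<in> Cper n"
proof (induction n arbitrary: f g)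
  case 0
  then show ?case by (auto simp: Cper_0 intro!: continuous_intros)
next
  case (Suc n)
  show ?case
    by (rule Cper_SucI[where f'="\<lambda>x. D f x + D g x"])
       (use Suc in \<open>auto simp: Cper_Suc intro!: has_vector_derivative_add D_works\<close>)
qed

lemma D_pow_add:
  "f \<in> Cper n \<Longrightarrow> g \<in> Cper n \<Longrightarrow> j \<le> n \<Longrightarrow>
     (D ^^ j) (\<lambda>x. f x + g x) = (\<lambda>x. (D ^^ j) f x + (D ^^ j) g x)"
proof (induction j arbitrary: f g n)
  case (Suc j)
  then obtain m where m: "n = Suc m" by (cases n) auto
  then have "D (\<lambda>x. f x + g x) = (\<lambda>x. D f x + D g x)"
    using Suc.prems
    by (auto intro!: ext D_eqI derivative_eq_intros simp: Cper_Suc D_works)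
  then have "(D ^^ j) (D (\<lambda>x. f x + g x)) = (D ^^ j) (\<lambda>x. D f x + D g x)" by simp
  also have "\<dots> = (\<lambda>x. (D ^^ j) (D f) x + (D ^^ j) (D g) x)"
    using Suc m by (intro Suc.IH[of _ m]) (auto simp: Cper_Suc)
  finally show ?case by (simp add: funpow_swap1)
qed auto

lemma Cper_mult:
  fixes f g :: "real \<Rightarrow> 'a::real_normed_algebra"
  shows "f \<in> Cper n \<Longrightarrow> g \<in> Cper n \<Longrightarrow> (\<lambda>x. f x * g x) \<in> Cper n"
proof (induction n arbitrary: f g)
  case 0
  then show ?case by (auto simp: Cper_0 intro!: continuous_intros)
next
  case (Suc n)
  show ?case
    by (rule Cper_SucI[where f'="\<lambda>x. f x * D g x + D f x * g x"])
       (use Suc Cper_Suc_Cper[OF Suc.prems(1)] Cper_Suc_Cper[OF Suc.prems(2)] in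
        \<open>auto simp: Cper_Suc intro!: has_vector_derivative_mult D_works Cper_add\<close>)
qed

lemmas bl_cmult = bounded_linear_mult_right
lemmas bl_of_real = bounded_linear_of_real
lemmas bl_scaleR = bounded_linear_scaleR_right

lemma Cper_cmult:
  fixes f :: "real \<Rightarrow> 'a::real_normed_algebra"
  shows "f \<in> Cper n \<Longrightarrow> (\<lambda>x. a * f x) \<in> Cper n"
  by (rule Cper_blin[OF bl_cmult])

lemma Cper_scaleR: "f \<in> Cper n \<Longrightarrow> (\<lambda>x. a *\<^sub>R f x) \<in> Cper n"
  by (rule Cper_blin[OF bl_scaleR])

lemma Cper_of_real:
  "f \<in> Cper n \<Longrightarrow> (\<lambda>x. of_real (f x) :: 'a::{real_normed_algebra_1}) \<in> Cper n"
  by (rule Cper_blin[OF bl_of_real])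

lemma Cper_uminus: "f \<in> Cper n \<Longrightarrow> (\<lambda>x. - f x) \<in> Cper n"
  using Cper_scaleR[of f n "-1"] by simp

lemma Cper_diff: "f \<in> Cper n \<Longrightarrow> g \<in> Cper n \<Longrightarrow> (\<lambda>x. f x - g x) \<in> Cper n"
  using Cper_add[of f n "\<lambda>x. - g x"] Cper_uminus[of g n] by simp

lemma D_pow_of_real:
  assumes "f \<in> Cper n" "j \<le> n"
  shows "(D ^^ j) (\<lambda>x. of_real (f x) :: 'a::{real_normed_algebra_1}) = (\<lambda>x. of_real ((D ^^ j) f x))"
  using D_pow_blin[OF bl_of_real assms] by simp

lemma D_pow_cmult:
  fixes f :: "real \<Rightarrow> 'a::real_normed_algebra"
  assumes "f \<in> Cper n" "j \<le> n"
  shows "(D ^^ j) (\<lambda>x. a * f x) = (\<lambda>x. a * (D ^^ j) f x)"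
  using D_pow_blin[OF bl_cmult assms] by simp

subsection \<open>Averages\<close>

lemma cont_integrable:
  fixes f :: "real \<Rightarrow> 'a::banach"
  shows "continuous_on {0..1} f \<Longrightarrow> f integrable_on {0..1}"
  by (rule integrable_continuous_real)

lemma avg_const [simp]: "avg (\<lambda>x. a :: 'a::banach) = a"
  by (simp add: avg_def)

lemma avg_add:
  fixes f g :: "real \<Rightarrow> 'a::banach"
  assumes "continuous_on {0..1} f" "continuous_on {0..1} g"
  shows "avg (\<lambda>x. f x + g x) = avg f + avg g"
  using assms by (simp add: avg_def integral_add cont_integrable)

lemma avg_diff:
  fixes f g :: "real \<Rightarrow> 'a::banach"
  assumes "continuous_on {0..1} f" "continuous_on {0..1} g"
  shows "avg (\<lambda>x. f x - g x) = avg f - avg g"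
  using assms by (simp add: avg_def integral_diff cont_integrable)

lemma avg_blin:
  fixes f :: "real \<Rightarrow> 'a::banach" and h :: "'a \<Rightarrow> 'b::banach"
  assumes "bounded_linear h" "continuous_on {0..1} f"
  shows "avg (\<lambda>x. h (f x)) = h (avg f)"
  using integral_linear[OF cont_integrable[OF assms(2)] assms(1)] by (simp add: avg_def o_def)

lemma avg_cmult:
  fixes f :: "real \<Rightarrow> 'a::{real_normed_algebra,banach}"
  assumes "continuous_on {0..1} f"
  shows "avg (\<lambda>x. a * f x) = a * avg f"
  using avg_blin[OF bl_cmult assms] .

lemma avg_of_real:
  fixes f :: "real \<Rightarrow> real"
  assumes "continuous_on {0..1} f"
  shows "avg (\<lambda>x. of_real (f x) :: 'a::{real_normed_algebra_1,banach}) = of_real (avg f)"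
  using avg_blin[OF bl_of_real assms] .

lemma avg_bound:
  fixes f :: "real \<Rightarrow> 'a::banach"
  assumes "continuous_on {0..1} f" "\<And>x. x \<in> {0..1} \<Longrightarrow> norm (f x) \<le> B"
  shows "norm (avg f) \<le> B"
  using integral_bound[of 0 1 f B] assms by (simp add: avg_def)

lemma avg_D:
  fixes f :: "real \<Rightarrow> 'a::banach"
  assumes "f \<in> Cper 1"
  shows "avg (D f) = 0"
proof -
  have "(f has_vector_derivative D f x) (at x within {0..1})" for x
    using Cper_Suc_D[of f 0 x] assms has_vector_derivative_at_within by auto
  then have "(D f has_integral (f 1 - f 0)) {0..1}"
    by (rule fundamental_theorem_of_calculus[rotated]) simp
  moreover have "f 1 = f 0" using Cper_periodic[OF assms, of 0] by simp
  ultimately show ?thesis by (simp add: avg_def integral_unique)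
qed

lemma avg_has_vector_derivative:
  fixes f :: "real \<Rightarrow> real \<Rightarrow> 'a::banach"
  assumes "open I" "x0 \<in> I"
    and d: "\<And>x y. x \<in> I \<Longrightarrow> y \<in> {0..1} \<Longrightarrow> ((\<lambda>x. f x y) has_vector_derivative f' x y) (at x)"
    and c: "\<And>x. x \<in> I \<Longrightarrow> continuous_on {0..1} (f x)"
    and c': "continuous_on (I \<times> {0..1}) (\<lambda>(x, y). f' x y)"
  shows "((\<lambda>x. avg (f x)) has_vector_derivative avg (f' x0)) (at x0)"
proof -
  obtain e where e: "e > 0" "ball x0 e \<subseteq> I" using assms openE by blast
  \<comment> \<open>The Leibniz rule asks for a convex set of parameters. \<open>I\<close> need not
    be convex, but a ball around \<open>x0\<close> is, and on an open ball the restricted derivative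
    is the full one.\<close>
  have "((\<lambda>x. integral (cbox 0 1) (f x)) has_vector_derivative integral (cbox 0 1) (f' x0))
      (at x0 within ball x0 e)"
  proof (rule leibniz_rule_vector_derivative)
    show "\<And>x t. x \<in> ball x0 e \<Longrightarrow> t \<in> cbox 0 1 \<Longrightarrow>
        ((\<lambda>x. f x t) has_vector_derivative f' x t) (at x within ball x0 e)"
      by (rule has_vector_derivative_at_within, rule d) (use e in auto)
    show "\<And>x. x \<in> ball x0 e \<Longrightarrow> f x integrable_on cbox 0 1"
      using c e by (auto intro!: cont_integrable)
    show "continuous_on (ball x0 e \<times> cbox 0 1) (\<lambda>(x, t). f' x t)"
      by (rule continuous_on_subset[OF c']) (use e in auto)
  qed (use e in auto)
  then show ?thesis using at_within_open[of x0 "ball x0 e"] e by (simp add: avg_def)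
qed

text \<open>A continuous nonnegative function with zero integral vanishes on one period, and
  periodicity carries this to the whole line. The use is <U'^2> \<noteq> 0, which turns
  orthogonality to U' into a normalization.\<close>

lemma avg_square_zero:
  fixes f :: "real \<Rightarrow> real"
  assumes f: "f \<in> Cper 0" and "avg (\<lambda>x. f x * f x) = 0"
  shows "f x = 0"
proof -
  have c: "continuous_on {0..1} (\<lambda>x. f x * f x)"
    using Cper_cont[OF f] by (intro continuous_intros)
  have "((\<lambda>x. f x * f x) has_integral 0) (cbox 0 1)"
    using integrable_integral[OF cont_integrable[OF c]] assms(2) by (simp add: avg_def)
  then have z: "f y * f y = 0" if "y \<in> {0..1}" for y
    using has_integral_0_cbox_imp_0[of 0 1 "\<lambda>x. f x * f x" y] c that by auto
  have per: "f (y + real n) = f y" for n y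
    by (induction n) (auto simp: Cper_periodic[OF f] add.assoc[symmetric] add.commute[of 1])
  have per': "f (y + of_int n) = f y" for n y
  proof (cases n)
    case (nonneg m)
    then show ?thesis using per by simp
  next
    case (neg m)
    then show ?thesis using per[of "y + of_int n" "Suc m"] by simp
  qed
  have "f x = f (frac x)" using per'[of "frac x" "\<lfloor>x\<rfloor>"] by (simp add: frac_def)
  also have "\<dots> = 0" using z[of "frac x"] frac_lt_1[of x] by (auto simp: less_imp_le)
  finally show ?thesis .
qed

subsection \<open>The linearized operator\<close>

lemma Lop_eq:
  assumes "V \<in> Cper 1" "f \<in> Cper 4"
  shows "Lop \<delta> k s V f y = k *\<^sub>R ((6 * V y - s) *\<^sub>R D f y + (6 * D V y) *\<^sub>R f y)
     + k^3 *\<^sub>R D (D (D f)) y + \<delta> *\<^sub>R (k^2 *\<^sub>R D (D f) y + k^4 *\<^sub>R D (D (D (D f))) y)"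
proof -
  have "((\<lambda>z. 6 * V z - s) has_real_derivative 6 * D V y) (at y)"
    using Cper_Suc_D[of V 0 y] assms(1)
    by (auto intro!: derivative_eq_intros simp: has_real_derivative_iff_has_vector_derivative[symmetric])
  then have "D (\<lambda>z. (6 * V z - s) *\<^sub>R f z) y = (6 * V y - s) *\<^sub>R D f y + (6 * D V y) *\<^sub>R f y"
    by (intro D_eqI has_vector_derivative_scaleR Cper_D4_deriv(1)[OF assms(2)])
  then show ?thesis by (simp add: Lop_def D_numeral)
qed

text \<open>The coefficients of the operator are real, so it commutes with every bounded real-linear
  map. Homogeneity and the passage between real and complex solutions are instances.\<close>

lemma Lop_blin:
  assumes "bounded_linear h" "V \<in> Cper 1" "f \<in> Cper 4"
  shows "Lop \<delta> k s V (\<lambda>x. h (f x)) y = h (Lop \<delta> k s V f y)"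
proof -
  interpret h: bounded_linear h by fact
  have f: "f \<in> Cper (Suc 3)" "D f \<in> Cper (Suc 2)" "D (D f) \<in> Cper (Suc 1)" "D (D (D f)) \<in> Cper (Suc 0)"
    using Cper_D4[OF assms(3)] assms(3) by (simp_all add: numeral_eq_Suc)
  note d = D_blin[OF assms(1) f(1)] D_blin[OF assms(1) f(2)] D_blin[OF assms(1) f(3)]
    D_blin[OF assms(1) f(4)]
  show ?thesis
    by (simp add: Lop_eq[OF assms(2)] assms Cper_blin d h.add h.scaleR)
qed

lemma Lop_cmult:
  fixes f :: "real \<Rightarrow> complex"
  assumes "V \<in> Cper 1" "f \<in> Cper 4"
  shows "Lop \<delta> k s V (\<lambda>x. a * f x) y = a * Lop \<delta> k s V f y"
  using Lop_blin[OF bl_cmult assms] .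

lemma Lop_scaleR:
  assumes "V \<in> Cper 1" "f \<in> Cper 4"
  shows "Lop \<delta> k s V (\<lambda>x. a *\<^sub>R f x) y = a *\<^sub>R Lop \<delta> k s V f y"
  using Lop_blin[OF bl_scaleR assms] .

lemma Lop_of_real:
  fixes f :: "real \<Rightarrow> real"
  assumes "V \<in> Cper 1" "f \<in> Cper 4"
  shows "Lop \<delta> k s V (\<lambda>x. complex_of_real (f x)) y = complex_of_real (Lop \<delta> k s V f y)"
  using Lop_blin[OF bl_of_real assms] .

lemma Lop_add:
  assumes "V \<in> Cper 1" "f \<in> Cper 4" "g \<in> Cper 4"
  shows "Lop \<delta> k s V (\<lambda>x. f x + g x) y = Lop \<delta> k s V f y + Lop \<delta> k s V g y"
proof -
  have d: "D (\<lambda>x. p x + q x) = (\<lambda>x. D p x + D q x)"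
    if "p \<in> Cper (Suc n)" "q \<in> Cper (Suc n)" for p q :: "real \<Rightarrow> 'a" and n
    using D_pow_add[OF that, of 1] by simp
  have f: "f \<in> Cper (Suc 3)" "D f \<in> Cper (Suc 2)" "D (D f) \<in> Cper (Suc 1)" "D (D (D f)) \<in> Cper (Suc 0)"
    using Cper_D4[OF assms(2)] assms(2) by (simp_all add: numeral_eq_Suc)
  have g: "g \<in> Cper (Suc 3)" "D g \<in> Cper (Suc 2)" "D (D g) \<in> Cper (Suc 1)" "D (D (D g)) \<in> Cper (Suc 0)"
    using Cper_D4[OF assms(3)] assms(3) by (simp_all add: numeral_eq_Suc)
  note d = d[OF f(1) g(1)] d[OF f(2) g(2)] d[OF f(3) g(3)] d[OF f(4) g(4)]
  show ?thesis
    by (simp add: Lop_eq[OF assms(1)] assms Cper_add d algebra_simps)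
qed

lemma Lop_diff:
  assumes "V \<in> Cper 1" "f \<in> Cper 4" "g \<in> Cper 4"
  shows "Lop \<delta> k s V (\<lambda>x. f x - g x) y = Lop \<delta> k s V f y - Lop \<delta> k s V g y"
  using Lop_add[OF assms(1,2) Cper_scaleR[OF assms(3)], of \<delta> k s "-1" y]
    Lop_scaleR[OF assms(1,3), of \<delta> k s "-1" y] by simp

lemma Lop_const:
  fixes a :: "'a::real_normed_vector"
  assumes "V \<in> Cper 1"
  shows "Lop \<delta> k s V (\<lambda>x. a) y = (6 * k * D V y) *\<^sub>R a"
  by (simp add: Lop_eq[OF assms] algebra_simps)

lemma Lop_Cper0:
  assumes "V \<in> Cper 1" "f \<in> Cper 4"
  shows "Lop \<delta> k s V f \<in> Cper 0"
proof -
  have V: "V \<in> Cper 0" "D V \<in> Cper 0" using assms(1) Cper_Suc_Cper[of V 0] Cper_D[of V 0] by simp_all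
  have f: "f \<in> Cper 0" "D f \<in> Cper 0" "D (D f) \<in> Cper 0" "D (D (D f)) \<in> Cper 0"
      "D (D (D (D f))) \<in> Cper 0"
    using Cper_D4[OF assms(2)] assms(2) by (auto dest: Cper_mono)
  have "Lop \<delta> k s V f = (\<lambda>y. k *\<^sub>R ((6 * V y - s) *\<^sub>R D f y + (6 * D V y) *\<^sub>R f y)
     + k^3 *\<^sub>R D (D (D f)) y + \<delta> *\<^sub>R (k^2 *\<^sub>R D (D f) y + k^4 *\<^sub>R D (D (D (D f))) y))"
    using Lop_eq[OF assms] by auto
  also have "\<dots> \<in> Cper 0"
    using V f by (auto simp: Cper_0 intro!: continuous_intros)
  finally show ?thesis .
qed

lemma avg_Lop:
  fixes f :: "real \<Rightarrow> 'a::banach"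
  assumes "V \<in> Cper 1" "f \<in> Cper 4"
  shows "avg (Lop \<delta> k s V f) = 0"
proof -
  \<comment> \<open>The flux: each term of the operator with one derivative stripped off.\<close>
  let ?F = "\<lambda>y. k *\<^sub>R ((6 * V y - s) *\<^sub>R f y) + k^3 *\<^sub>R D (D f) y
     + \<delta> *\<^sub>R (k^2 *\<^sub>R D f y + k^4 *\<^sub>R D (D (D f)) y)"
  have "((\<lambda>z. 6 * V z - s) has_real_derivative 6 * D V y) (at y)" for y
    using Cper_Suc_D[of V 0 y] assms(1)
    by (auto intro!: derivative_eq_intros simp: has_real_derivative_iff_has_vector_derivative[symmetric])
  then have "((\<lambda>z. (6 * V z - s) *\<^sub>R f z) has_vector_derivative
      (6 * V y - s) *\<^sub>R D f y + (6 * D V y) *\<^sub>R f y) (at y)" for y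
    by (intro has_vector_derivative_scaleR Cper_D4_deriv(1)[OF assms(2)])
  note d = this Cper_D4_deriv[OF assms(2)]
  have F: "(?F has_vector_derivative Lop \<delta> k s V f y) (at y)" for y
    unfolding Lop_eq[OF assms]
    by (intro has_vector_derivative_add bounded_linear.has_vector_derivative[OF bl_scaleR] d)
  have "?F \<in> Cper (Suc 0)"
    by (rule Cper_SucI[OF _ F])
      (use Cper_D4[OF assms(2)] assms Lop_Cper0[OF assms] in \<open>auto simp: Cper_periodic\<close>)
  then have "avg (D ?F) = 0" using avg_D[of ?F] by simp
  also have "D ?F = Lop \<delta> k s V f" using F by (intro ext D_eqI)
  finally show ?thesis .
qed

section \<open>The range of a Fredholm operator of index 0 whose kernel is a line\<close>

lemma quot_dim_line:
  assumes n: "quot_dim (range (\<lambda>a y. a * g y)) {\<lambda>x. 0} n" and g: "g y0 \<noteq> (0::complex)"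
  shows "n = 1"
proof -
  let ?V = "range (\<lambda>a y. a * g y)"
  obtain b where b: "\<forall>i<n. b i \<in> ?V"
    and u: "\<forall>h\<in>?V. \<exists>!a. a \<in> extensional {..<n} \<and> (\<lambda>x. h x - (\<Sum>i<n. a i * b i x)) \<in> {\<lambda>x. 0}"
    using n unfolding quot_dim_def by blast
  have "\<forall>i<n. \<exists>\<alpha>. b i = (\<lambda>y. \<alpha> * g y)" using b by auto
  then obtain \<alpha> where \<alpha>: "\<And>i. i < n \<Longrightarrow> b i = (\<lambda>y. \<alpha> i * g y)" by metis
  \<comment> \<open>Uniqueness of the coordinates of the zero function is linear independence of the
    b i. Zero is written as \<open>0 * g x\<close> to make it visibly an element of the
    range.\<close>
  have "\<exists>!a. a \<in> extensional {..<n} \<and> (\<lambda>x. (0 * g x) - (\<Sum>i<n. a i * b i x)) \<in> {\<lambda>x. 0}"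
    using bspec[OF u, of "\<lambda>y. 0 * g y"] by blast
  then have uniq: "a = a'"
    if "a \<in> extensional {..<n}" "a' \<in> extensional {..<n}"
      "\<And>x. (\<Sum>i<n. a i * b i x) = 0" "\<And>x. (\<Sum>i<n. a' i * b i x) = 0" for a a'
    using that by auto
  have tr: "a i = 0" if "(\<Sum>i<n. a i * \<alpha> i) = 0" "i < n" for a i
  proof -
    \<comment> \<open>\<open>quot_dim\<close> compares coordinates only among extensional families,
      hence the restrictions.\<close>
    have "(\<lambda>i\<in>{..<n}. a i) = (\<lambda>i\<in>{..<n}. 0)"
    proof (rule uniq)
      fix x
      have "(\<Sum>i<n. (\<lambda>i\<in>{..<n}. a i) i * b i x) = (\<Sum>i<n. a i * \<alpha> i) * g x"
        using \<alpha> by (auto simp: sum_distrib_right intro!: sum.cong)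
      then show "(\<Sum>i<n. (\<lambda>i\<in>{..<n}. a i) i * b i x) = 0" using that by simp
    qed auto
    then show ?thesis using that(2) by (metis lessThan_iff restrict_apply')
  qed
  have "n \<noteq> 0"
  proof
    assume "n = 0"
    moreover have "(\<lambda>y. 1 * g y) \<in> ?V" by (rule rangeI)
    ultimately have "(\<lambda>x. 1 * g x) = (\<lambda>x. 0)"
      using bspec[OF u, of "\<lambda>y. 1 * g y"] by auto
    then show False using g by (auto dest: fun_cong[of _ _ y0])
  qed
  moreover have "\<not> 2 \<le> n"
  proof
    assume n2: "2 \<le> n"
    have s: "(\<Sum>i<n. (if i = 0 then p else if i = 1 then q else 0) * \<alpha> i) = p * \<alpha> 0 + q * \<alpha> 1" for p q
    proof -
      have "(\<Sum>i<n. (if i = 0 then p else if i = 1 then q else 0) * \<alpha> i)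
          = (\<Sum>i\<in>{0,1}. (if i = 0 then p else if i = 1 then q else 0) * \<alpha> i)"
        by (rule sum.mono_neutral_right) (use n2 in auto)
      then show ?thesis by simp
    qed
    \<comment> \<open>Two multiples of g are dependent: the coefficients (\<alpha> 1, - \<alpha> 0)
      represent zero, so \<alpha> 1 = 0; then (0, 1) represents zero too, although its second entry
      is 1.\<close>
    have "\<alpha> 1 = 0"
      using tr[of "\<lambda>i. if i = 0 then \<alpha> 1 else if i = 1 then - \<alpha> 0 else 0" 0] s[of "\<alpha> 1" "- \<alpha> 0"] n2
      by simp
    then show False
      using tr[of "\<lambda>i. if i = 0 then 0 else if i = 1 then 1 else 0" 1] s[of 0 1] n2 by simp
  qed
  ultimately show ?thesis by simp
qed

lemma fredholm_range:
  assumes fr: "fredholm_index_0 A" and ker: "kernel A = range (\<lambda>a y. a * g y)" and g: "g y0 \<noteq> 0"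
    and A: "\<And>f. f \<in> Cper 4 \<Longrightarrow> A f \<in> Cper 0 \<and> avg (A f) = 0"
    and h: "h \<in> Cper 0" "avg h = 0"
  shows "\<exists>f\<in>Cper 4. A f = h"
proof -
  obtain n where n: "quot_dim (kernel A) {\<lambda>x. 0} n" "quot_dim (Cper 0) (A ` Cper 4) n"
    using fr unfolding fredholm_index_0_def by blast
  have "n = 1" using quot_dim_line[of g n y0] n(1) g unfolding ker by blast
  then have "quot_dim (Cper 0) (A ` Cper 4) 1" using n(2) by simp
  then obtain b :: "nat \<Rightarrow> real \<Rightarrow> complex" where b': "\<forall>i<1. b i \<in> Cper 0"
    and u': "\<forall>h\<in>Cper 0. \<exists>!a. a \<in> extensional {..<1} \<and>
      (\<lambda>x. h x - (\<Sum>i<1. a i * b i x)) \<in> A ` Cper 4"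
    unfolding quot_dim_def by (elim exE conjE) blast
  have b: "b 0 \<in> Cper 0" using b' by simp
  have u: "\<exists>a. (\<lambda>x. h x - a (0::nat) * b 0 x) \<in> A ` Cper 4" if hh: "h \<in> Cper 0" for h
  proof -
    obtain a where "(\<lambda>x. h x - (\<Sum>i<1. a i * b i x)) \<in> A ` Cper 4"
      using ex1_implies_ex[OF bspec[OF u' hh]] by (elim exE conjE) blast
    then have "(\<lambda>x. h x - a 0 * b 0 x) \<in> A ` Cper 4" by simp
    then show ?thesis by blast
  qed
  have av: "avg (\<lambda>x. h x - a * b 0 x) = avg h - a * avg (b 0)" if "h \<in> Cper 0" for h a
    using Cper_cont[OF that, of "{0..1}"] Cper_cont[OF b, of "{0..1}"]
    by (simp add: avg_diff avg_cmult continuous_intros)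
  \<comment> \<open>The constant 1 has mean 1 and elements of the range have mean 0, so the
    complementary function \<open>b 0\<close> must have nonzero mean. Consequently a mean free h has
    coefficient 0 along it.\<close>
  have b0: "avg (b 0) \<noteq> 0"
  proof
    assume "avg (b 0) = 0"
    moreover obtain a where "(\<lambda>x. 1 - a (0::nat) * b 0 x) \<in> A ` Cper 4" using u[of "\<lambda>x. 1"] by auto
    then have "avg (\<lambda>x. 1 - a 0 * b 0 x) = 0" using A by auto
    ultimately show False using av[of "\<lambda>x. 1" "a 0"] by simp
  qed
  obtain a where a: "(\<lambda>x. h x - a (0::nat) * b 0 x) \<in> A ` Cper 4" using u[OF h(1)] by auto
  then have "avg (\<lambda>x. h x - a 0 * b 0 x) = 0" using A by auto
  then have "a 0 = 0" using av[OF h(1), of "a 0"] h(2) b0 by simp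
  then show ?thesis using a by (auto simp: image_iff)
qed

text \<open>One fixed wave, detached from the family. \<open>V\<close> lies in \<open>Cper 5\<close>
  so that \<open>D V\<close> belongs to the domain \<open>Cper 4\<close> of the operator.\<close>

locale wave_op =
  fixes \<delta> k s :: real and V :: "real \<Rightarrow> real"
  assumes V: "V \<in> Cper 5"
    and V_nonconst: "\<exists>y. D V y \<noteq> 0"
    and ker: "kernel (Lop \<delta> k s V) = range (\<lambda>a y. a * complex_of_real (D V y))"
    and fred: "fredholm_index_0 (Lop \<delta> k s V)"
begin

lemma V1: "V \<in> Cper 1"
  using V by (rule Cper_mono) simp

lemma DV: "D V \<in> Cper 4" "j \<le> 4 \<Longrightarrow> D V \<in> Cper j"
  using Cper_D[of V 4] V Cper_mono by (auto simp: numeral_eq_Suc)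

lemma avg_DV_sq: "avg (\<lambda>y. D V y * D V y) \<noteq> 0"
proof
  assume "avg (\<lambda>y. D V y * D V y) = 0"
  then have "D V y = 0" for y by (rule avg_square_zero[OF DV(2)[of 0], rotated]) simp
  then show False using V_nonconst by simp
qed

lemma avg_DV_sq_complex: "avg (\<lambda>y. complex_of_real (D V y) * complex_of_real (D V y)) \<noteq> 0"
proof -
  have "avg (\<lambda>y. complex_of_real (D V y * D V y)) = complex_of_real (avg (\<lambda>y. D V y * D V y))"
    by (rule avg_of_real) (intro continuous_intros Cper_cont[OF DV(1)])
  then show ?thesis using avg_DV_sq by simp
qed

lemma Lop_DV: "Lop \<delta> k s V (\<lambda>y. a * complex_of_real (D V y)) y = 0"
  using ker by (auto simp: kernel_def set_eq_iff)

lemma Lop_zero: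
  assumes "f \<in> Cper 4" "\<And>y. Lop \<delta> k s V f y = 0"
  obtains a where "f = (\<lambda>y. a * complex_of_real (D V y))"
proof -
  have "f \<in> kernel (Lop \<delta> k s V)" using assms by (simp add: kernel_def)
  then show ?thesis using that unfolding ker by auto
qed

lemma Lop_solve:
  fixes h :: "real \<Rightarrow> complex"
  assumes "h \<in> Cper 0" "avg h = 0"
  obtains f where "f \<in> Cper 4" "\<And>y. Lop \<delta> k s V f y = h y"
proof -
  obtain y0 where "D V y0 \<noteq> 0" using V_nonconst by auto
  then have "\<exists>f\<in>Cper 4. Lop \<delta> k s V f = h"
    by (intro fredholm_range[OF fred ker _ _ assms]) (auto intro: Lop_Cper0 avg_Lop V1)
  then show ?thesis using that by auto
qed

text \<open>The difference is a multiple a of V'. Pairing it with V' gives a <V'^2>, and <V'^2> is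
  not 0.\<close>

lemma Lop_unique:
  fixes f g :: "real \<Rightarrow> complex"
  assumes "f \<in> Cper 4" "g \<in> Cper 4" "\<And>y. Lop \<delta> k s V f y = Lop \<delta> k s V g y"
    "avg (\<lambda>y. complex_of_real (D V y) * f y) = avg (\<lambda>y. complex_of_real (D V y) * g y)"
  shows "f = g"
proof -
  have "(\<lambda>y. f y - g y) \<in> Cper 4" "\<And>y. Lop \<delta> k s V (\<lambda>y. f y - g y) y = 0"
    using assms by (auto intro: Cper_diff simp: Lop_diff[OF V1])
  then obtain a where a: "(\<lambda>y. f y - g y) = (\<lambda>y. a * complex_of_real (D V y))"
    by (rule Lop_zero)
  have c: "continuous_on {0..1} (D V)" by (rule Cper_cont[OF DV(1)])
  have "avg (\<lambda>y. complex_of_real (D V y) * f y - complex_of_real (D V y) * g y) = 0"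
    using assms(4) c Cper_cont[OF assms(1)] Cper_cont[OF assms(2)]
    by (subst avg_diff) (auto intro!: continuous_intros)
  also have "(\<lambda>y. complex_of_real (D V y) * f y - complex_of_real (D V y) * g y)
      = (\<lambda>y. a * (complex_of_real (D V y) * complex_of_real (D V y)))"
    using fun_cong[OF a] by (auto simp: algebra_simps)
  also have "avg \<dots> = a * avg (\<lambda>y. complex_of_real (D V y) * complex_of_real (D V y))"
    using c by (intro avg_cmult continuous_intros)
  finally have "a = 0" using avg_DV_sq_complex by simp
  then show ?thesis using a by (auto simp: fun_eq_iff)
qed

lemma Lop_ex1:
  fixes h :: "real \<Rightarrow> complex"
  assumes h: "h \<in> Cper 0" "avg h = 0"
  shows "\<exists>!f. f \<in> Cper 4 \<and> avg (\<lambda>y. complex_of_real (D V y) * f y) = 0 \<and>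
           (\<forall>y. Lop \<delta> k s V f y = h y)"
proof -
  obtain f where f: "f \<in> Cper 4" "\<And>y. Lop \<delta> k s V f y = h y" using Lop_solve[OF h] by blast
  let ?S = "avg (\<lambda>y. complex_of_real (D V y) * complex_of_real (D V y))"
  \<comment> \<open>Coefficient of the projection onto V'; subtracting that multiple of V' enforces
    orthogonality and does not change the image under the operator.\<close>
  define a where "a = avg (\<lambda>y. complex_of_real (D V y) * f y) / ?S"
  let ?f = "\<lambda>y. f y - a * complex_of_real (D V y)"
  have c: "continuous_on {0..1} (D V)" by (rule Cper_cont[OF DV(1)])
  have aV: "(\<lambda>y. a * complex_of_real (D V y)) \<in> Cper 4"
    by (intro Cper_cmult Cper_of_real DV(1))
  have "?f \<in> Cper 4" using f aV by (intro Cper_diff)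
  moreover have "Lop \<delta> k s V ?f y = h y" for y
    using f aV by (simp add: Lop_diff[OF V1] Lop_DV)
  moreover have "avg (\<lambda>y. complex_of_real (D V y) * ?f y) = 0"
  proof -
    have "avg (\<lambda>y. complex_of_real (D V y) * ?f y) = avg (\<lambda>y. complex_of_real (D V y) * f y
        - a * (complex_of_real (D V y) * complex_of_real (D V y)))"
      by (simp add: algebra_simps)
    also have "\<dots> = avg (\<lambda>y. complex_of_real (D V y) * f y) - a * ?S"
      using c Cper_cont[OF f(1)]
      by (subst avg_diff) (auto intro!: continuous_intros avg_cmult)
    also have "\<dots> = 0" using avg_DV_sq_complex by (simp add: a_def)
    finally show ?thesis .
  qed
  ultimately show ?thesis
    using Lop_unique by (intro ex1I[of _ ?f]) auto
qed

text \<open>The Fredholm hypothesis concerns complex functions. A real solution is the real part of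
  the complex one, and a competing real solution is embedded into the complex functions and compared
  there.\<close>

lemma Lop_ex1_real:
  fixes h :: "real \<Rightarrow> real"
  assumes h: "h \<in> Cper 0" "avg h = 0"
  shows "\<exists>!f. f \<in> Cper 4 \<and> avg (\<lambda>y. D V y * f y) = 0 \<and> (\<forall>y. Lop \<delta> k s V f y = h y)"
proof -
  have "\<exists>!f. f \<in> Cper 4 \<and> avg (\<lambda>y. complex_of_real (D V y) * f y) = 0 \<and>
           (\<forall>y. Lop \<delta> k s V f y = complex_of_real (h y))"
    using h by (intro Lop_ex1 Cper_of_real) (simp_all add: avg_of_real Cper_cont[OF h(1)])
  then obtain F where F: "F \<in> Cper 4" "avg (\<lambda>y. complex_of_real (D V y) * F y) = 0"
    "\<And>y. Lop \<delta> k s V F y = complex_of_real (h y)" by blast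
  have c: "continuous_on {0..1} (D V)" by (rule Cper_cont[OF DV(1)])
  have emb: "avg (\<lambda>y. complex_of_real (D V y) * complex_of_real (f y))
      = complex_of_real (avg (\<lambda>y. D V y * f y))" if "f \<in> Cper 4" for f
    using avg_of_real[of "\<lambda>y. D V y * f y", where 'a=complex] c Cper_cont[OF that]
    by (simp add: continuous_intros)
  show ?thesis
  proof (rule ex1I[of _ "\<lambda>y. Re (F y)"], safe)
    show "(\<lambda>y. Re (F y)) \<in> Cper 4" by (rule Cper_blin[OF bounded_linear_Re F(1)])
    show "Lop \<delta> k s V (\<lambda>y. Re (F y)) y = h y" for y
      using Lop_blin[OF bounded_linear_Re V1 F(1)] F(3) by simp
    have "avg (\<lambda>y. Re (complex_of_real (D V y) * F y)) = 0"
      using F(2) c Cper_cont[OF F(1)]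
      by (subst avg_blin[OF bounded_linear_Re]) (auto intro!: continuous_intros)
    then show "avg (\<lambda>y. D V y * Re (F y)) = 0" by simp
  next
    fix f :: "real \<Rightarrow> real"
    assume f: "f \<in> Cper 4" "avg (\<lambda>y. D V y * f y) = 0" "\<forall>y. Lop \<delta> k s V f y = h y"
    have "(\<lambda>y. complex_of_real (f y)) = F"
      using f F by (intro Lop_unique) (auto intro: Cper_of_real simp: Lop_of_real[OF V1] emb)
    then show "f = (\<lambda>y. Re (F y))" by auto
  qed
qed

end

subsection \<open>Smooth functions of several variables\<close>

lemma frechet_derivative_cong_open:
  assumes "open S" "x \<in> S" "\<And>y. y \<in> S \<Longrightarrow> f y = g y"
  shows "f differentiable (at x) \<longleftrightarrow> g differentiable (at x)"
    "frechet_derivative f (at x) = frechet_derivative g (at x)"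
proof -
  have "(f has_derivative f') (at x) \<longleftrightarrow> (g has_derivative f') (at x)" for f'
    using has_derivative_transform_within_open[of f f' x UNIV S g]
      has_derivative_transform_within_open[of g f' x UNIV S f] assms by auto
  then show "f differentiable (at x) \<longleftrightarrow> g differentiable (at x)"
    "frechet_derivative f (at x) = frechet_derivative g (at x)"
    by (auto simp: differentiable_def frechet_derivative_def)
qed

lemma Ck_on_cong:
  assumes "open S"
  shows "(\<And>x. x \<in> S \<Longrightarrow> f x = g x) \<Longrightarrow> Ck_on n S f \<longleftrightarrow> Ck_on n S g"
proof (induction n arbitrary: f g)
  case 0
  then show ?case by (simp cong: continuous_on_cong)
next
  case (Suc n)
  have "Ck_on n S (\<lambda>x. frechet_derivative f (at x) b) \<longleftrightarrow>
      Ck_on n S (\<lambda>x. frechet_derivative g (at x) b)" for b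
    by (rule Suc.IH) (simp add: frechet_derivative_cong_open[OF assms _ Suc.prems])
  then show ?case
    using frechet_derivative_cong_open(1)[OF assms _ Suc.prems] by auto
qed

lemma smooth_on_cong:
  assumes "open S" "\<And>x. x \<in> S \<Longrightarrow> f x = g x"
  shows "smooth_on S f \<longleftrightarrow> smooth_on S g"
  using Ck_on_cong[OF assms] by (simp add: smooth_on_def)

lemma smooth_on_cont: "smooth_on S f \<Longrightarrow> continuous_on S f"
  unfolding smooth_on_def by (metis Ck_on.simps(1))

lemma smooth_on_partial:
  "smooth_on S f \<Longrightarrow> b \<in> Basis \<Longrightarrow> smooth_on S (\<lambda>x. frechet_derivative f (at x) b)"
  unfolding smooth_on_def by (metis Ck_on.simps(2))

lemma smooth_on_has_derivative:
  "smooth_on S f \<Longrightarrow> x \<in> S \<Longrightarrow> (f has_derivative frechet_derivative f (at x)) (at x)"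
  unfolding smooth_on_def by (metis Ck_on.simps(2) frechet_derivative_works)

text \<open>Coordinate lines as the curve give the partial derivatives, curves such as
  \<open>(\<kappa> s, \<mu> s)\<close> give the chain rules; both are read off from this one
  statement.\<close>

lemma smooth_on_curve:
  assumes "smooth_on S f" "(L has_vector_derivative b) (at s)" "L s \<in> S"
  shows "((\<lambda>s. f (L s)) has_real_derivative frechet_derivative f (at (L s)) b) (at s)"
proof -
  have f: "(f has_derivative frechet_derivative f (at (L s))) (at (L s))"
    by (rule smooth_on_has_derivative[OF assms(1,3)])
  interpret l: linear "frechet_derivative f (at (L s))"
    using has_derivative_linear[OF f] .
  have "((\<lambda>s. f (L s)) has_derivative (\<lambda>h. frechet_derivative f (at (L s)) (h *\<^sub>R b))) (at s)"
    using has_derivative_compose[OF assms(2)[unfolded has_vector_derivative_def] f] .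
  then show ?thesis
    by (simp add: has_field_derivative_def l.scale mult_commute_abs)
qed

lemma frechet_linear_comb:
  assumes "smooth_on S f" "x \<in> S"
  shows "frechet_derivative f (at x) (a *\<^sub>R u + b *\<^sub>R v)
    = a * frechet_derivative f (at x) u + b * frechet_derivative f (at x) v"
proof -
  interpret l: linear "frechet_derivative f (at x)"
    using has_derivative_linear[OF smooth_on_has_derivative[OF assms]] .
  show ?thesis by (simp add: l.add l.scale)
qed

text \<open>Translates Frechet derivatives along basis vectors into \<open>dk\<close> and
  \<open>dM\<close>. It is applied to functions of (k, M) and also to fields of (x, t); for the
  latter \<open>dk\<close> and \<open>dM\<close> are the derivatives in x and in t.\<close>

lemma smooth2_partials:
  fixes h :: "real \<Rightarrow> real \<Rightarrow> real"
  assumes S: "open S" and h: "smooth_on S (\<lambda>(x, t). h x t)"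
  shows smooth2_dk: "smooth_on S (\<lambda>(x, t). dk h x t)"
    and smooth2_dM: "smooth_on S (\<lambda>(x, t). dM h x t)"
    and smooth2_has_dk: "(x, t) \<in> S \<Longrightarrow> ((\<lambda>x. h x t) has_real_derivative dk h x t) (at x)"
    and smooth2_has_dM: "(x, t) \<in> S \<Longrightarrow> (h x has_real_derivative dM h x t) (at t)"
    and smooth2_chain: "(\<kappa> s, \<mu> s) \<in> S \<Longrightarrow> (\<kappa> has_real_derivative \<kappa>') (at s) \<Longrightarrow>
        (\<mu> has_real_derivative \<mu>') (at s) \<Longrightarrow>
        ((\<lambda>s. h (\<kappa> s) (\<mu> s)) has_real_derivative dk h (\<kappa> s) (\<mu> s) * \<kappa>' + dM h (\<kappa> s) (\<mu> s) * \<mu>') (at s)"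
proof -
  let ?F = "\<lambda>(x, t). h x t"
  have 1: "((\<lambda>x. h x t) has_real_derivative frechet_derivative ?F (at (x, t)) (1, 0)) (at x)"
    if "(x, t) \<in> S" for x t
  proof -
    have "((\<lambda>x. (x, t)) has_vector_derivative (1, 0)) (at x)"
      by (auto intro!: derivative_eq_intros simp: has_vector_derivative_Pair)
    from smooth_on_curve[OF h this] that show ?thesis by simp
  qed
  have 2: "(h x has_real_derivative frechet_derivative ?F (at (x, t)) (0, 1)) (at t)"
    if "(x, t) \<in> S" for x t
  proof -
    have "((\<lambda>t. (x, t)) has_vector_derivative (0, 1)) (at t)"
      by (auto intro!: derivative_eq_intros simp: has_vector_derivative_Pair)
    from smooth_on_curve[OF h this] that show ?thesis by simp
  qed
  have k: "dk h x t = frechet_derivative ?F (at (x, t)) (1, 0)"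
    and M: "dM h x t = frechet_derivative ?F (at (x, t)) (0, 1)" if "(x, t) \<in> S" for x t
    using D_eqI_real[OF 1[OF that]] D_eqI_real[OF 2[OF that]] by (simp_all add: dk_def dM_def)
  show "smooth_on S (\<lambda>(x, t). dk h x t)"
    using smooth_on_partial[OF h, of "(1, 0)"] k
    by (subst smooth_on_cong[OF S, of _ "\<lambda>x. frechet_derivative ?F (at x) (1, 0)"])
      (auto simp: Basis_prod_def)
  show "smooth_on S (\<lambda>(x, t). dM h x t)"
    using smooth_on_partial[OF h, of "(0, 1)"] M
    by (subst smooth_on_cong[OF S, of _ "\<lambda>x. frechet_derivative ?F (at x) (0, 1)"])
      (auto simp: Basis_prod_def)
  show "(x, t) \<in> S \<Longrightarrow> ((\<lambda>x. h x t) has_real_derivative dk h x t) (at x)"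
    using 1[of x t] k[of x t] by simp
  show "(x, t) \<in> S \<Longrightarrow> (h x has_real_derivative dM h x t) (at t)"
    using 2[of x t] M[of x t] by simp
  show "((\<lambda>s. h (\<kappa> s) (\<mu> s)) has_real_derivative dk h (\<kappa> s) (\<mu> s) * \<kappa>' + dM h (\<kappa> s) (\<mu> s) * \<mu>') (at s)"
    if "(\<kappa> s, \<mu> s) \<in> S" and d: "(\<kappa> has_real_derivative \<kappa>') (at s)" "(\<mu> has_real_derivative \<mu>') (at s)"
  proof -
    have "((\<lambda>s. (\<kappa> s, \<mu> s)) has_vector_derivative (\<kappa>', \<mu>')) (at s)"
      using d by (auto intro!: has_vector_derivative_Pair simp: has_real_derivative_iff_has_vector_derivative)
    from smooth_on_curve[OF h this] that(1)
    show ?thesis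
      using frechet_linear_comb[OF h that(1), of \<kappa>' "(1, 0)" \<mu>' "(0, 1)"]
      by (simp add: k[OF that(1)] M[OF that(1)] mult.commute)
  qed
qed

section \<open>Smooth families of profiles, their partial derivatives and the exchange of
  these\<close>

definition smooth_family :: "(real \<times> real) set \<Rightarrow> (real \<Rightarrow> real \<Rightarrow> real \<Rightarrow> real) \<Rightarrow> bool" where
  "smooth_family \<Omega> W \<longleftrightarrow> open \<Omega> \<and> smooth_on (\<Omega> \<times> UNIV) (\<lambda>((k, M), y). W k M y)"

abbreviation fam_k :: "(real \<Rightarrow> real \<Rightarrow> real \<Rightarrow> real) \<Rightarrow> real \<Rightarrow> real \<Rightarrow> real \<Rightarrow> real" where
  "fam_k W k M y \<equiv> dk (\<lambda>k M. W k M y) k M"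

abbreviation fam_M :: "(real \<Rightarrow> real \<Rightarrow> real \<Rightarrow> real) \<Rightarrow> real \<Rightarrow> real \<Rightarrow> real \<Rightarrow> real" where
  "fam_M W k M y \<equiv> dM (\<lambda>k M. W k M y) k M"

abbreviation fam_D :: "(real \<Rightarrow> real \<Rightarrow> real \<Rightarrow> real) \<Rightarrow> real \<Rightarrow> real \<Rightarrow> real \<Rightarrow> real" where
  "fam_D W k M \<equiv> D (W k M)"

lemma smooth_family_partials:
  assumes W: "smooth_family \<Omega> W"
  shows smooth_family_k: "smooth_family \<Omega> (fam_k W)"
    and smooth_family_M: "smooth_family \<Omega> (fam_M W)"
    and smooth_family_D: "smooth_family \<Omega> (fam_D W)"
    and fam_has_k: "(k, M) \<in> \<Omega> \<Longrightarrow> ((\<lambda>k. W k M y) has_real_derivative fam_k W k M y) (at k)"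
    and fam_has_M: "(k, M) \<in> \<Omega> \<Longrightarrow> ((\<lambda>M. W k M y) has_real_derivative fam_M W k M y) (at M)"
    and fam_has_D: "(k, M) \<in> \<Omega> \<Longrightarrow> (W k M has_real_derivative fam_D W k M y) (at y)"
    and fam_chain: "(\<kappa> s, \<mu> s) \<in> \<Omega> \<Longrightarrow> (\<kappa> has_real_derivative \<kappa>') (at s) \<Longrightarrow>
        (\<mu> has_real_derivative \<mu>') (at s) \<Longrightarrow> ((\<lambda>s. W (\<kappa> s) (\<mu> s) y) has_real_derivative
          fam_k W (\<kappa> s) (\<mu> s) y * \<kappa>' + fam_M W (\<kappa> s) (\<mu> s) y * \<mu>') (at s)"
proof -
  let ?F = "\<lambda>((k, M), y). W k M y" and ?S = "\<Omega> \<times> (UNIV :: real set)"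
  have S: "open ?S" and O: "open \<Omega>" and h: "smooth_on ?S ?F"
    using W by (auto simp: smooth_family_def intro: open_Times)
  have 1: "((\<lambda>k. W k M y) has_real_derivative frechet_derivative ?F (at ((k, M), y)) ((1, 0), 0)) (at k)"
    if "(k, M) \<in> \<Omega>" for k M y
  proof -
    have "((\<lambda>k. ((k, M), y)) has_vector_derivative ((1, 0), 0)) (at k)"
      by (auto intro!: derivative_eq_intros simp: has_vector_derivative_Pair)
    from smooth_on_curve[OF h this] that show ?thesis by simp
  qed
  have 2: "((\<lambda>M. W k M y) has_real_derivative frechet_derivative ?F (at ((k, M), y)) ((0, 1), 0)) (at M)"
    if "(k, M) \<in> \<Omega>" for k M y
  proof -
    have "((\<lambda>M. ((k, M), y)) has_vector_derivative ((0, 1), 0)) (at M)"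
      by (auto intro!: derivative_eq_intros simp: has_vector_derivative_Pair)
    from smooth_on_curve[OF h this] that show ?thesis by simp
  qed
  have 3: "(W k M has_real_derivative frechet_derivative ?F (at ((k, M), y)) ((0, 0), 1)) (at y)"
    if "(k, M) \<in> \<Omega>" for k M y
  proof -
    have "((\<lambda>y. ((k, M), y)) has_vector_derivative ((0, 0), 1)) (at y)"
      by (auto intro!: derivative_eq_intros simp: has_vector_derivative_Pair)
    from smooth_on_curve[OF h this] that show ?thesis by (simp add: zero_prod_def)
  qed
  have k: "fam_k W k M y = frechet_derivative ?F (at ((k, M), y)) ((1, 0), 0)"
    and M: "fam_M W k M y = frechet_derivative ?F (at ((k, M), y)) ((0, 1), 0)"
    and y: "fam_D W k M y = frechet_derivative ?F (at ((k, M), y)) ((0, 0), 1)"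
    if "(k, M) \<in> \<Omega>" for k M y
    using D_eqI_real[OF 1[OF that]] D_eqI_real[OF 2[OF that]] D_eqI_real[OF 3[OF that]]
    by (simp_all add: dk_def dM_def)
  have B: "((1, 0), 0) \<in> (Basis :: ((real \<times> real) \<times> real) set)"
    "((0, 1), 0) \<in> (Basis :: ((real \<times> real) \<times> real) set)"
    "((0, 0), 1) \<in> (Basis :: ((real \<times> real) \<times> real) set)"
    by (auto simp: Basis_prod_def zero_prod_def)
  show "smooth_family \<Omega> (fam_k W)"
    unfolding smooth_family_def
    using smooth_on_partial[OF h B(1)] k O
    by (subst smooth_on_cong[OF S, of _ "\<lambda>x. frechet_derivative ?F (at x) ((1, 0), 0)"]) auto
  show "smooth_family \<Omega> (fam_M W)"
    unfolding smooth_family_def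
    using smooth_on_partial[OF h B(2)] M O
    by (subst smooth_on_cong[OF S, of _ "\<lambda>x. frechet_derivative ?F (at x) ((0, 1), 0)"]) auto
  show "smooth_family \<Omega> (fam_D W)"
    unfolding smooth_family_def
    using smooth_on_partial[OF h B(3)] y O
    by (subst smooth_on_cong[OF S, of _ "\<lambda>x. frechet_derivative ?F (at x) ((0, 0), 1)"]) auto
  show "(k, M) \<in> \<Omega> \<Longrightarrow> ((\<lambda>k. W k M y) has_real_derivative fam_k W k M y) (at k)"
    using 1[of k M y] k[of k M y] by simp
  show "(k, M) \<in> \<Omega> \<Longrightarrow> ((\<lambda>M. W k M y) has_real_derivative fam_M W k M y) (at M)"
    using 2[of k M y] M[of k M y] by simp
  show "(k, M) \<in> \<Omega> \<Longrightarrow> (W k M has_real_derivative fam_D W k M y) (at y)"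
    using 3[of k M y] y[of k M y] by simp
  show "((\<lambda>s. W (\<kappa> s) (\<mu> s) y) has_real_derivative
          fam_k W (\<kappa> s) (\<mu> s) y * \<kappa>' + fam_M W (\<kappa> s) (\<mu> s) y * \<mu>') (at s)"
    if o: "(\<kappa> s, \<mu> s) \<in> \<Omega>"
      and d: "(\<kappa> has_real_derivative \<kappa>') (at s)" "(\<mu> has_real_derivative \<mu>') (at s)"
  proof -
    have "((\<lambda>s. ((\<kappa> s, \<mu> s), y)) has_vector_derivative ((\<kappa>', \<mu>'), 0)) (at s)"
      using d by (auto intro!: has_vector_derivative_Pair simp: has_real_derivative_iff_has_vector_derivative)
    from smooth_on_curve[OF h this] o
    show ?thesis
      using frechet_linear_comb[OF h, of "((\<kappa> s, \<mu> s), y)" \<kappa>' "((1, 0), 0)" \<mu>' "((0, 1), 0)"] o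
      by (simp add: k[OF o] M[OF o] mult.commute)
  qed
qed

lemma smooth_family_cont:
  assumes "smooth_family \<Omega> W" "continuous_on X \<kappa>" "continuous_on X \<mu>" "continuous_on X \<eta>"
    "\<And>x. x \<in> X \<Longrightarrow> (\<kappa> x, \<mu> x) \<in> \<Omega>"
  shows "continuous_on X (\<lambda>x. W (\<kappa> x) (\<mu> x) (\<eta> x))"
proof -
  have "continuous_on (\<Omega> \<times> UNIV) (\<lambda>((k, M), y). W k M y)"
    using assms(1) by (auto simp: smooth_family_def intro: smooth_on_cont)
  moreover have "continuous_on X (\<lambda>x. ((\<kappa> x, \<mu> x), \<eta> x))"
    by (intro continuous_intros assms)
  ultimately have "continuous_on X (\<lambda>x. (\<lambda>((k, M), y). W k M y) ((\<kappa> x, \<mu> x), \<eta> x))"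
    by (rule continuous_on_compose2) (use assms(5) in auto)
  then show ?thesis by simp
qed

lemma open_slice: "open \<Omega> \<Longrightarrow> open {x. (x, M) \<in> \<Omega>}" "open \<Omega> \<Longrightarrow> open {x. (k, x) \<in> \<Omega>}"
  using open_vimage[of \<Omega> "\<lambda>x. (x, M)"] open_vimage[of \<Omega> "\<lambda>x. (k, x)"]
  by (simp_all add: vimage_def continuous_intros)

text \<open>Exchange of \<partial>_s and \<partial>_y, along a curve of parameters so that one proof
  covers k and M. The profile is written as its value at a base point plus the integral of its
  y-derivative; the Leibniz rule differentiates this in s, and the resulting integral of
  \<open>Q\<close> is then differentiated in its upper limit.\<close>

lemma fam_mixed:
  assumes W: "smooth_family \<Omega> W" and I: "open I" "s0 \<in> I"
    and o: "\<And>s. s \<in> I \<Longrightarrow> (\<kappa> s, \<mu> s) \<in> \<Omega>"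
    and c: "continuous_on I \<kappa>" "continuous_on I \<mu>"
    and d: "\<And>s y. s \<in> I \<Longrightarrow> ((\<lambda>s. W (\<kappa> s) (\<mu> s) y) has_real_derivative P s y) (at s)"
    and d': "\<And>s y. s \<in> I \<Longrightarrow> ((\<lambda>s. fam_D W (\<kappa> s) (\<mu> s) y) has_real_derivative Q s y) (at s)"
    and Q: "continuous_on (I \<times> UNIV) (\<lambda>(s, y). Q s y)"
  shows "(P s0 has_real_derivative Q s0 y) (at y)"
proof -
  \<comment> \<open>Any base point below y would do for the integral; y has to be interior to the
    interval so that the one-sided derivative becomes a full one.\<close>
  let ?a = "y - 1" and ?b = "y + 1"
  obtain e where e: "e > 0" "ball s0 e \<subseteq> I" using I openE by blast
  have DW: "smooth_family \<Omega> (fam_D W)" by (rule smooth_family_D[OF W])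
  have cD: "continuous_on X (fam_D W (\<kappa> s) (\<mu> s))" if "s \<in> I" for s X
    using smooth_family_cont[OF DW, of X "\<lambda>_. \<kappa> s" "\<lambda>_. \<mu> s" "\<lambda>y. y"] o[OF that]
    by (auto intro: continuous_intros)
  have cQ: "continuous_on X (Q s0)" for X
  proof -
    have "continuous_on X (\<lambda>y. case (s0, y) of (s, y) \<Rightarrow> Q s y)"
      by (rule continuous_on_compose2[OF Q]) (use I in \<open>auto intro!: continuous_intros\<close>)
    then show ?thesis by simp
  qed
  have eq: "P s0 z = P s0 ?a + integral {?a..z} (Q s0)" if "z \<in> {?a..?b}" for z
  proof -
    have z: "W (\<kappa> s) (\<mu> s) z = W (\<kappa> s) (\<mu> s) ?a + integral (cbox ?a z) (fam_D W (\<kappa> s) (\<mu> s))"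
      if "s \<in> I" for s
    proof -
      have "(W (\<kappa> s) (\<mu> s) has_vector_derivative fam_D W (\<kappa> s) (\<mu> s) x) (at x within {?a..z})" for x
        using fam_has_D[OF W o[OF that], of x] has_vector_derivative_at_within
        by (auto simp: has_real_derivative_iff_has_vector_derivative)
      then have "(fam_D W (\<kappa> s) (\<mu> s) has_integral W (\<kappa> s) (\<mu> s) z - W (\<kappa> s) (\<mu> s) ?a) {?a..z}"
        by (rule fundamental_theorem_of_calculus[rotated]) (use \<open>z \<in> _\<close> in auto)
      then show ?thesis by (simp add: integral_unique)
    qed
    have "((\<lambda>s. integral (cbox ?a z) (fam_D W (\<kappa> s) (\<mu> s))) has_field_derivative
        integral (cbox ?a z) (Q s0)) (at s0 within ball s0 e)"
    proof (rule leibniz_rule_field_derivative)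
      show "\<And>x t. x \<in> ball s0 e \<Longrightarrow> t \<in> cbox ?a z \<Longrightarrow>
          ((\<lambda>s. fam_D W (\<kappa> s) (\<mu> s) t) has_real_derivative Q x t) (at x within ball s0 e)"
        by (rule has_field_derivative_at_within, rule d') (use e in auto)
      show "\<And>x. x \<in> ball s0 e \<Longrightarrow> fam_D W (\<kappa> x) (\<mu> x) integrable_on cbox ?a z"
        using cD e by (auto intro!: integrable_continuous_real)
      show "continuous_on (ball s0 e \<times> cbox ?a z) (\<lambda>(x, t). Q x t)"
        by (rule continuous_on_subset[OF Q]) (use e in auto)
    qed (use e in auto)
    then have "((\<lambda>s. integral (cbox ?a z) (fam_D W (\<kappa> s) (\<mu> s))) has_real_derivative
        integral (cbox ?a z) (Q s0)) (at s0)"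
      using e at_within_open[of s0 "ball s0 e"] by simp
    from DERIV_add[OF d[OF I(2), of ?a] this]
    have "((\<lambda>s. W (\<kappa> s) (\<mu> s) z) has_real_derivative P s0 ?a + integral (cbox ?a z) (Q s0)) (at s0)"
      by (rule has_field_derivative_transform_within_open[OF _ I]) (simp add: z)
    from DERIV_unique[OF d[OF I(2), of z] this] show ?thesis by simp
  qed
  have "((\<lambda>z. P s0 ?a + integral {?a..z} (Q s0)) has_vector_derivative 0 + Q s0 y) (at y within {?a..?b})"
    by (intro has_vector_derivative_add has_vector_derivative_const integral_has_vector_derivative cQ) auto
  moreover have "at y within {?a..?b} = at y" by (rule at_within_interior) auto
  ultimately have "((\<lambda>z. P s0 ?a + integral {?a..z} (Q s0)) has_real_derivative Q s0 y) (at y)"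
    by (simp add: has_real_derivative_iff_has_vector_derivative)
  then show ?thesis
    by (rule has_field_derivative_transform_within_open[of _ _ _ "{?a<..<?b}"]) (simp_all add: eq[symmetric])
qed

lemma fam_mixed_k:
  assumes W: "smooth_family \<Omega> W" and o: "(k, M) \<in> \<Omega>"
  shows "fam_D (fam_k W) k M y = fam_k (fam_D W) k M y"
proof -
  have DW: "smooth_family \<Omega> (fam_D W)" and O: "open \<Omega>"
    using smooth_family_D[OF W] W by (auto simp: smooth_family_def)
  have "continuous_on ({k. (k, M) \<in> \<Omega>} \<times> UNIV) (\<lambda>x. fam_k (fam_D W) (fst x) M (snd x))"
    by (rule smooth_family_cont[OF smooth_family_k[OF DW]]) (auto intro: continuous_intros)
  note c = this
  have "(fam_k W k M has_real_derivative fam_k (fam_D W) k M y) (at y)"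
  proof (rule fam_mixed[OF W open_slice(1)[OF O], where \<kappa>="\<lambda>s. s" and \<mu>="\<lambda>_. M"
        and P="\<lambda>s. fam_k W s M" and Q="\<lambda>s. fam_k (fam_D W) s M"])
    show "k \<in> {x. (x, M) \<in> \<Omega>}" using o by simp
    show "((\<lambda>s. s) s, (\<lambda>_. M) s) \<in> \<Omega>" if "s \<in> {x. (x, M) \<in> \<Omega>}" for s using that by simp
    show "((\<lambda>s. W ((\<lambda>s. s) s) ((\<lambda>_. M) s) y) has_real_derivative (\<lambda>s. fam_k W s M) s y) (at s)"
      if "s \<in> {x. (x, M) \<in> \<Omega>}" for s y using fam_has_k[OF W] that by simp
    show "((\<lambda>s. fam_D W ((\<lambda>s. s) s) ((\<lambda>_. M) s) y) has_real_derivative (\<lambda>s. fam_k (fam_D W) s M) s y) (at s)"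
      if "s \<in> {x. (x, M) \<in> \<Omega>}" for s y using fam_has_k[OF DW] that by simp
  qed (use c in \<open>simp_all add: continuous_intros split_beta\<close>)
  then show ?thesis by (rule D_eqI_real)
qed

lemma fam_mixed_M:
  assumes W: "smooth_family \<Omega> W" and o: "(k, M) \<in> \<Omega>"
  shows "fam_D (fam_M W) k M y = fam_M (fam_D W) k M y"
proof -
  have DW: "smooth_family \<Omega> (fam_D W)" and O: "open \<Omega>"
    using smooth_family_D[OF W] W by (auto simp: smooth_family_def)
  have "continuous_on ({M. (k, M) \<in> \<Omega>} \<times> UNIV) (\<lambda>x. fam_M (fam_D W) k (fst x) (snd x))"
    by (rule smooth_family_cont[OF smooth_family_M[OF DW]]) (auto intro: continuous_intros)
  note c = this
  have "(fam_M W k M has_real_derivative fam_M (fam_D W) k M y) (at y)"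
  proof (rule fam_mixed[OF W open_slice(2)[OF O], where \<kappa>="\<lambda>_. k" and \<mu>="\<lambda>s. s"
        and P="\<lambda>s. fam_M W k s" and Q="\<lambda>s. fam_M (fam_D W) k s"])
    show "M \<in> {x. (k, x) \<in> \<Omega>}" using o by simp
    show "((\<lambda>_. k) s, (\<lambda>s. s) s) \<in> \<Omega>" if "s \<in> {x. (k, x) \<in> \<Omega>}" for s using that by simp
    show "((\<lambda>s. W ((\<lambda>_. k) s) ((\<lambda>s. s) s) y) has_real_derivative (\<lambda>s. fam_M W k s) s y) (at s)"
      if "s \<in> {x. (k, x) \<in> \<Omega>}" for s y using fam_has_M[OF W] that by simp
    show "((\<lambda>s. fam_D W ((\<lambda>_. k) s) ((\<lambda>s. s) s) y) has_real_derivative (\<lambda>s. fam_M (fam_D W) k s) s y) (at s)"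
      if "s \<in> {x. (k, x) \<in> \<Omega>}" for s y using fam_has_M[OF DW] that by simp
  qed (use c in \<open>simp_all add: continuous_intros split_beta\<close>)
  then show ?thesis by (rule D_eqI_real)
qed

lemma smooth_family_Cper:
  assumes "smooth_family \<Omega> W" "\<And>k M y. (k, M) \<in> \<Omega> \<Longrightarrow> W k M (y + 1) = W k M y" "(k, M) \<in> \<Omega>"
  shows "W k M \<in> Cper n"
  using assms
proof (induction n arbitrary: W)
  case 0
  then show ?case
    using smooth_family_cont[OF 0(1), of UNIV "\<lambda>_. k" "\<lambda>_. M" "\<lambda>y. y"]
    by (auto simp: Cper_0 continuous_intros)
next
  case (Suc n)
  have "fam_D W k M \<in> Cper n"
    using Suc.prems by (intro Suc.IH smooth_family_D D_periodic)
  then show ?case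
    using fam_has_D[OF Suc.prems(1,3)] Suc.prems
    by (intro Cper_SucI[of _ "fam_D W k M"]) (auto simp: has_real_derivative_iff_has_vector_derivative)
qed

subsection \<open>Identities for the wave family\<close>

lemma real_deriv_vec: "(f has_real_derivative d) F \<Longrightarrow> (f has_vector_derivative d) F"
  by (simp add: has_real_derivative_iff_has_vector_derivative)

lemma vec_deriv_real: "(f has_vector_derivative d) F \<Longrightarrow> (f has_real_derivative d) F"
  by (simp add: has_real_derivative_iff_has_vector_derivative)

lemma avg_mult_real: "avg (\<lambda>y. a * f y :: real) = a * avg f"
  by (simp add: avg_def)

lemma avg_scale_const:
  fixes f g :: "real \<Rightarrow> real"
  assumes "continuous_on {0..1} f" "continuous_on {0..1} g"
  shows "avg (\<lambda>y. a * f y + b * g y) = a * avg f + b * avg g"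
  using assms by (subst avg_add) (auto intro!: continuous_intros simp: avg_mult_real)

locale waves =
  fixes \<delta> :: real and \<Omega> :: "(real \<times> real) set"
    and U :: "real \<Rightarrow> real \<Rightarrow> real \<Rightarrow> real" and c :: "real \<Rightarrow> real \<Rightarrow> real"
  assumes wf: "wave_family \<delta> \<Omega> U c" and sp: "spectral_structure \<delta> \<Omega> U c"
begin

abbreviation "Uk \<equiv> fam_k U"

lemma O: "open \<Omega>" using wf by (simp add: wave_family_def)

lemma k_pos: "(k, M) \<in> \<Omega> \<Longrightarrow> k > 0" using wf by (auto simp: wave_family_def)

lemma smU: "smooth_family \<Omega> U" using wf by (simp add: wave_family_def smooth_family_def)

lemma smc: "smooth_on \<Omega> (\<lambda>(k, M). c k M)" using wf by (simp add: wave_family_def)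

lemma U_per: "(k, M) \<in> \<Omega> \<Longrightarrow> U k M (y + 1) = U k M y" using wf by (auto simp: wave_family_def)

lemma avg_U: "(k, M) \<in> \<Omega> \<Longrightarrow> avg (U k M) = M" using wf by (auto simp: wave_family_def)

lemma wave_eq:
  assumes "(k, M) \<in> \<Omega>"
  shows "- k * c k M * D (U k M) y + 6 * k * U k M y * D (U k M) y + k^3 * D (D (D (U k M))) y
             + \<delta> * (k^2 * D (D (U k M)) y + k^4 * D (D (D (D (U k M)))) y) = 0"
  using wf assms by (auto simp: wave_family_def D_numeral)

lemma U_Cper: "(k, M) \<in> \<Omega> \<Longrightarrow> U k M \<in> Cper n"
  by (rule smooth_family_Cper[OF smU U_per])

lemma smUk: "smooth_family \<Omega> Uk" by (rule smooth_family_k[OF smU])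

lemma ev_k: "(k, M) \<in> \<Omega> \<Longrightarrow> \<forall>\<^sub>F k in nhds k. (k, M) \<in> \<Omega>"
  using open_slice(1)[OF O, of M] by (auto simp: eventually_nhds)

lemma ev_M: "(k, M) \<in> \<Omega> \<Longrightarrow> \<forall>\<^sub>F M in nhds M. (k, M) \<in> \<Omega>"
  using open_slice(2)[OF O, of k] by (auto simp: eventually_nhds)

lemma Uk_per: "(k, M) \<in> \<Omega> \<Longrightarrow> Uk k M (y + 1) = Uk k M y"
  unfolding dk_def by (rule D_cong_ev, rule eventually_mono[OF ev_k]) (auto simp: U_per)

lemma Uk_Cper: "(k, M) \<in> \<Omega> \<Longrightarrow> Uk k M \<in> Cper n"
  by (rule smooth_family_Cper[OF smUk Uk_per])

lemma U_cont: "(k, M) \<in> \<Omega> \<Longrightarrow> continuous_on A (U k M)"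
  using U_Cper[of k M 0] by (rule Cper_cont)

lemma Uk_cont: "(k, M) \<in> \<Omega> \<Longrightarrow> continuous_on A (Uk k M)"
  using Uk_Cper[of k M 0] by (rule Cper_cont)

text \<open>The Galilean normalization: M only shifts the profile. Hence the y-derivatives of U do
  not vary with M, and dU(a, b) is a \<partial>_k U + b.\<close>

lemma U_M: "(k, M) \<in> \<Omega> \<Longrightarrow> fam_M U k M y = 1"
proof -
  assume o: "(k, M) \<in> \<Omega>"
  obtain U0 where U0: "\<forall>(k, M)\<in>\<Omega>. \<forall>y. U k M y = M + U0 k y"
    using wf unfolding wave_family_def by blast
  have "fam_M U k M y = D (\<lambda>M. M + U0 k y) M"
    unfolding dM_def by (rule D_cong_ev, rule eventually_mono[OF ev_M[OF o]]) (use U0 in auto)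
  also have "\<dots> = 1" by (rule D_eqI_real) (auto intro!: derivative_eq_intros)
  finally show ?thesis .
qed

lemma c_M: "(k, M) \<in> \<Omega> \<Longrightarrow> dM c k M = 6"
proof -
  assume o: "(k, M) \<in> \<Omega>"
  obtain c0 where c0: "\<forall>(k, M)\<in>\<Omega>. c k M = 6 * M + c0 k"
    using wf unfolding wave_family_def by blast
  have "dM c k M = D (\<lambda>M. 6 * M + c0 k) M"
    unfolding dM_def by (rule D_cong_ev, rule eventually_mono[OF ev_M[OF o]]) (use c0 in auto)
  also have "\<dots> = 6" by (rule D_eqI_real) (auto intro!: derivative_eq_intros)
  finally show ?thesis .
qed

text \<open>Four orders, as many as the profile equation contains; each is obtained by exchanging
  one more y-derivative with \<partial>_k.\<close>

lemma DU_k: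
  assumes "(k, M) \<in> \<Omega>"
  shows "fam_k (fam_D U) k M = D (Uk k M)"
    "fam_k (fam_D (fam_D U)) k M = D (D (Uk k M))"
    "fam_k (fam_D (fam_D (fam_D U))) k M = D (D (D (Uk k M)))"
    "fam_k (fam_D (fam_D (fam_D (fam_D U)))) k M = D (D (D (D (Uk k M))))"
proof -
  note s1 = smooth_family_D[OF smU] and s = smooth_family_D
  have 1: "fam_k (fam_D U) k M = D (Uk k M)"
    using fam_mixed_k[OF smU assms] by auto
  have 2: "fam_k (fam_D (fam_D U)) k M = D (D (Uk k M))"
    using fam_mixed_k[OF s1 assms] 1 by auto
  have 3: "fam_k (fam_D (fam_D (fam_D U))) k M = D (D (D (Uk k M)))"
    using fam_mixed_k[OF s[OF s1] assms] 2 by auto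
  have 4: "fam_k (fam_D (fam_D (fam_D (fam_D U)))) k M = D (D (D (D (Uk k M))))"
    using fam_mixed_k[OF s[OF s[OF s1]] assms] 3 by auto
  show "fam_k (fam_D U) k M = D (Uk k M)"
    "fam_k (fam_D (fam_D U)) k M = D (D (Uk k M))"
    "fam_k (fam_D (fam_D (fam_D U))) k M = D (D (D (Uk k M)))"
    "fam_k (fam_D (fam_D (fam_D (fam_D U)))) k M = D (D (D (D (Uk k M))))" by fact+
qed

lemma DU_M:
  assumes "(k, M) \<in> \<Omega>"
  shows "fam_M (fam_D U) k M = (\<lambda>y. 0)" "fam_M (fam_D (fam_D U)) k M = (\<lambda>y. 0)"
    "fam_M (fam_D (fam_D (fam_D U))) k M = (\<lambda>y. 0)"
proof -
  note s1 = smooth_family_D[OF smU] and s = smooth_family_D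
  have "fam_M U k M = (\<lambda>y. 1)" using U_M[OF assms] by auto
  then show 1: "fam_M (fam_D U) k M = (\<lambda>y. 0)"
    using fam_mixed_M[OF smU assms] by auto
  show 2: "fam_M (fam_D (fam_D U)) k M = (\<lambda>y. 0)"
    using fam_mixed_M[OF s1 assms] 1 by auto
  show "fam_M (fam_D (fam_D (fam_D U))) k M = (\<lambda>y. 0)"
    using fam_mixed_M[OF s[OF s1] assms] 2 by auto
qed

lemmas DU_k_at = DU_k[THEN fun_cong] and DU_M_at = DU_M[THEN fun_cong]

lemma wave_op: "(k, M) \<in> \<Omega> \<Longrightarrow> wave_op \<delta> k (c k M) (U k M)"
  by unfold_locales (use sp in \<open>auto simp: spectral_structure_def U_Cper\<close>)

text \<open>The derivative of the profile equation with respect to the wavenumber.\<close>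

lemma Lop_Uk:
  assumes o: "(k, M) \<in> \<Omega>"
  shows "Lop \<delta> k (c k M) (U k M) (Uk k M) y = k * dk c k M * D (U k M) y
     - (- c k M * D (U k M) y + 6 * U k M y * D (U k M) y + 3 * k^2 * D (D (D (U k M))) y
        + \<delta> * (2 * k * D (D (U k M)) y + 4 * k^3 * D (D (D (D (U k M)))) y))"
proof -
  note s = smooth_family_D and s1 = smooth_family_D[OF smU]
  note s2 = s[OF s1] note s3 = s[OF s2] note s4 = s[OF s3]
  note d = fam_has_k[OF smU o, of y] fam_has_k[OF s1 o, of y] fam_has_k[OF s2 o, of y]
    fam_has_k[OF s3 o, of y] fam_has_k[OF s4 o, of y] smooth2_has_dk[OF O smc o]
  have "((\<lambda>k. - k * c k M * D (U k M) y + 6 * k * U k M y * D (U k M) y + k^3 * D (D (D (U k M))) y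
       + \<delta> * (k^2 * D (D (U k M)) y + k^4 * D (D (D (D (U k M)))) y)) has_real_derivative
     - c k M * D (U k M) y - k * dk c k M * D (U k M) y - k * c k M * D (Uk k M) y
     + 6 * U k M y * D (U k M) y + 6 * k * Uk k M y * D (U k M) y + 6 * k * U k M y * D (Uk k M) y
     + 3 * k^2 * D (D (D (U k M))) y + k^3 * D (D (D (Uk k M))) y
     + \<delta> * (2 * k * D (D (U k M)) y + k^2 * D (D (Uk k M)) y
         + 4 * k^3 * D (D (D (D (U k M)))) y + k^4 * D (D (D (D (Uk k M)))) y)) (at k)"
    by (rule derivative_eq_intros d refl)+ (simp add: DU_k_at[OF o] algebra_simps power2_eq_square)
  \<comment> \<open>The profile expression vanishes for every k in the open slice, so the derivative
    computed above by the product rule must be 0. Its terms with \<partial>_k U make up the operator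
    applied to \<partial>_k U.\<close>
  moreover have "((\<lambda>k. - k * c k M * D (U k M) y + 6 * k * U k M y * D (U k M) y + k^3 * D (D (D (U k M))) y
       + \<delta> * (k^2 * D (D (U k M)) y + k^4 * D (D (D (D (U k M)))) y)) has_real_derivative 0) (at k)"
  proof (rule has_field_derivative_transform_within_open[of "\<lambda>_. 0" _ _ "{k. (k, M) \<in> \<Omega>}"])
    show "((\<lambda>_. 0) has_real_derivative 0) (at k)" by simp
    show "open {k. (k, M) \<in> \<Omega>}" by (rule open_slice(1)[OF O])
    show "k \<in> {k. (k, M) \<in> \<Omega>}" using o by simp
  qed (rule wave_eq[symmetric], simp)
  ultimately have "- c k M * D (U k M) y - k * dk c k M * D (U k M) y - k * c k M * D (Uk k M) y
     + 6 * U k M y * D (U k M) y + 6 * k * Uk k M y * D (U k M) y + 6 * k * U k M y * D (Uk k M) y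
     + 3 * k^2 * D (D (D (U k M))) y + k^3 * D (D (D (Uk k M))) y
     + \<delta> * (2 * k * D (D (U k M)) y + k^2 * D (D (Uk k M)) y
         + 4 * k^3 * D (D (D (D (U k M)))) y + k^4 * D (D (D (D (Uk k M)))) y) = 0"
    by (rule DERIV_unique)
  then show ?thesis
    by (simp add: Lop_eq[OF U_Cper[OF o] Uk_Cper[OF o]] algebra_simps)
qed

subsection \<open>Averages over the wave family\<close>

text \<open>Half of the k-derivative of <U^2>; the corresponding half of the M-derivative is simply
  M.\<close>

definition UUk :: "real \<Rightarrow> real \<Rightarrow> real" where
  "UUk k M = avg (\<lambda>y. U k M y * Uk k M y)"

lemma U_chain:
  assumes "(\<kappa> s, \<mu> s) \<in> \<Omega>" "(\<kappa> has_real_derivative \<kappa>') (at s)" "(\<mu> has_real_derivative \<mu>') (at s)"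
  shows "((\<lambda>s. U (\<kappa> s) (\<mu> s) y) has_real_derivative Uk (\<kappa> s) (\<mu> s) y * \<kappa>' + \<mu>') (at s)"
    "((\<lambda>s. D (U (\<kappa> s) (\<mu> s)) y) has_real_derivative D (Uk (\<kappa> s) (\<mu> s)) y * \<kappa>') (at s)"
    "((\<lambda>s. D (D (U (\<kappa> s) (\<mu> s))) y) has_real_derivative D (D (Uk (\<kappa> s) (\<mu> s))) y * \<kappa>') (at s)"
    "((\<lambda>s. D (D (D (U (\<kappa> s) (\<mu> s)))) y) has_real_derivative D (D (D (Uk (\<kappa> s) (\<mu> s)))) y * \<kappa>') (at s)"
  using fam_chain[OF smU assms, of y] fam_chain[OF smooth_family_D[OF smU] assms, of y]
    fam_chain[OF smooth_family_D[OF smooth_family_D[OF smU]] assms, of y]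
    fam_chain[OF smooth_family_D[OF smooth_family_D[OF smooth_family_D[OF smU]]] assms, of y]
  by (simp_all add: DU_k_at[OF assms(1)] DU_M_at[OF assms(1)] U_M[OF assms(1)])

text \<open>Used twice: with the profile itself as f it differentiates <U^2>, with the corrector as
  f it differentiates the flux in the equation for M.\<close>

lemma avg_U_field_curve:
  assumes I: "open I" "s0 \<in> I"
    and o: "\<And>s. s \<in> I \<Longrightarrow> (\<kappa> s, \<mu> s) \<in> \<Omega>"
    and d: "\<And>s. s \<in> I \<Longrightarrow> (\<kappa> has_real_derivative \<kappa>' s) (at s)"
      "\<And>s. s \<in> I \<Longrightarrow> (\<mu> has_real_derivative \<mu>' s) (at s)"
    and c': "continuous_on I \<kappa>'" "continuous_on I \<mu>'"
    and f: "\<And>s y. s \<in> I \<Longrightarrow> ((\<lambda>s. f s y) has_real_derivative f' s y) (at s)"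
    and cf: "continuous_on (I \<times> {0..1}) (\<lambda>(s, y). f s y)"
    and cf': "continuous_on (I \<times> {0..1}) (\<lambda>(s, y). f' s y)"
  shows "((\<lambda>s. avg (\<lambda>y. U (\<kappa> s) (\<mu> s) y * f s y)) has_real_derivative
     \<kappa>' s0 * avg (\<lambda>y. Uk (\<kappa> s0) (\<mu> s0) y * f s0 y) + \<mu>' s0 * avg (f s0)
     + avg (\<lambda>y. U (\<kappa> s0) (\<mu> s0) y * f' s0 y)) (at s0)"
proof -
  let ?g = "\<lambda>s y. (Uk (\<kappa> s) (\<mu> s) y * \<kappa>' s + \<mu>' s) * f s y + U (\<kappa> s) (\<mu> s) y * f' s y"
  have ck: "continuous_on I \<kappa>" "continuous_on I \<mu>"
    using d I by (auto simp: continuous_on_eq_continuous_at intro: DERIV_isCont)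
  have cs: "continuous_on {0..1} (f s)" "continuous_on {0..1} (f' s)" if "s \<in> I" for s
    using continuous_on_compose2[OF cf, of "{0..1}" "\<lambda>y. (s, y)"]
      continuous_on_compose2[OF cf', of "{0..1}" "\<lambda>y. (s, y)"] that
    by (auto simp: continuous_intros image_subset_iff)
  have "((\<lambda>s. avg (\<lambda>y. U (\<kappa> s) (\<mu> s) y * f s y)) has_vector_derivative avg (?g s0)) (at s0)"
  proof (rule avg_has_vector_derivative[OF I])
    fix s y assume s: "s \<in> I"
    show "((\<lambda>s. U (\<kappa> s) (\<mu> s) y * f s y) has_vector_derivative ?g s y) (at s)"
      using DERIV_mult[OF U_chain(1)[of \<kappa> s \<mu>, OF o[OF s] d(1)[OF s] d(2)[OF s]] f[OF s]]
      by (intro real_deriv_vec) (simp add: algebra_simps)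
  next
    fix s assume s: "s \<in> I"
    show "continuous_on {0..1} (\<lambda>y. U (\<kappa> s) (\<mu> s) y * f s y)"
      by (intro continuous_intros U_cont o s cs)
  next
    have p: "continuous_on (I \<times> {0..1}) (\<lambda>x. \<kappa> (fst x))" "continuous_on (I \<times> {0..1}) (\<lambda>x. \<mu> (fst x))"
      "continuous_on (I \<times> {0..1}) (\<lambda>x. \<kappa>' (fst x))" "continuous_on (I \<times> {0..1}) (\<lambda>x. \<mu>' (fst x))"
      by (auto intro!: continuous_on_compose2[OF ck(1)] continuous_on_compose2[OF ck(2)]
          continuous_on_compose2[OF c'(1)] continuous_on_compose2[OF c'(2)] continuous_intros)
    have q: "continuous_on (I \<times> {0..1}) (\<lambda>x. U (\<kappa> (fst x)) (\<mu> (fst x)) (snd x))"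
      "continuous_on (I \<times> {0..1}) (\<lambda>x. Uk (\<kappa> (fst x)) (\<mu> (fst x)) (snd x))"
      by (rule smooth_family_cont[OF smU] smooth_family_cont[OF smUk];
          use o p in \<open>auto intro!: continuous_intros\<close>)+
    show "continuous_on (I \<times> {0..1}) (\<lambda>(s, y). ?g s y)"
      using cf cf' unfolding split_beta by (intro continuous_intros p q) auto
  qed
  moreover have "avg (?g s0) = \<kappa>' s0 * avg (\<lambda>y. Uk (\<kappa> s0) (\<mu> s0) y * f s0 y) + \<mu>' s0 * avg (f s0)
     + avg (\<lambda>y. U (\<kappa> s0) (\<mu> s0) y * f' s0 y)"
  proof -
    note cc = U_cont[OF o[OF I(2)], of "{0..1}"] Uk_cont[OF o[OF I(2)], of "{0..1}"] cs[OF I(2)]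
    have "avg (?g s0) = avg (\<lambda>y. \<kappa>' s0 * (Uk (\<kappa> s0) (\<mu> s0) y * f s0 y) + \<mu>' s0 * f s0 y
        + U (\<kappa> s0) (\<mu> s0) y * f' s0 y)"
      by (simp add: algebra_simps)
    also have "\<dots> = avg (\<lambda>y. \<kappa>' s0 * (Uk (\<kappa> s0) (\<mu> s0) y * f s0 y) + \<mu>' s0 * f s0 y)
        + avg (\<lambda>y. U (\<kappa> s0) (\<mu> s0) y * f' s0 y)"
      using cc by (intro avg_add continuous_intros)
    finally show ?thesis
      using cc by (simp add: avg_scale_const continuous_intros)
  qed
  ultimately show ?thesis by (simp add: has_real_derivative_iff_has_vector_derivative)
qed

text \<open>Differentiate <U> = M in k, with M held fixed.\<close>

lemma avg_Uk: assumes o: "(k, M) \<in> \<Omega>" shows "avg (Uk k M) = 0"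
proof -
  let ?I = "{k. (k, M) \<in> \<Omega>}"
  have I: "open ?I" "k \<in> ?I" using open_slice(1)[OF O, of M] o by auto
  have d: "((\<lambda>k. avg (U k M)) has_vector_derivative avg (Uk k M)) (at k)"
  proof (rule avg_has_vector_derivative[OF I])
    show "continuous_on (?I \<times> {0..1}) (\<lambda>(k, y). Uk k M y)"
      unfolding split_beta
      by (rule smooth_family_cont[OF smUk]) (auto intro!: continuous_intros)
  qed (auto intro: real_deriv_vec fam_has_k[OF smU] U_cont)
  have "((\<lambda>k. avg (U k M)) has_real_derivative 0) (at k)"
    by (rule has_field_derivative_transform_within_open[of "\<lambda>_. M", OF _ I]) (auto simp: avg_U)
  from DERIV_unique[OF vec_deriv_real[OF d] this] show ?thesis .
qed

lemma avg_U_square_curve: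
  assumes I: "open I" "s0 \<in> I"
    and o: "\<And>s. s \<in> I \<Longrightarrow> (\<kappa> s, \<mu> s) \<in> \<Omega>"
    and d: "\<And>s. s \<in> I \<Longrightarrow> (\<kappa> has_real_derivative \<kappa>' s) (at s)"
      "\<And>s. s \<in> I \<Longrightarrow> (\<mu> has_real_derivative \<mu>' s) (at s)"
    and c': "continuous_on I \<kappa>'" "continuous_on I \<mu>'"
  shows "((\<lambda>s. avg (\<lambda>y. (U (\<kappa> s) (\<mu> s) y)^2)) has_real_derivative
     2 * UUk (\<kappa> s0) (\<mu> s0) * \<kappa>' s0 + 2 * \<mu> s0 * \<mu>' s0) (at s0)"
proof -
  have ck: "continuous_on I \<kappa>" "continuous_on I \<mu>"
    using d I by (auto simp: continuous_on_eq_continuous_at intro: DERIV_isCont)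
  have p: "continuous_on (I \<times> {0..1}) (\<lambda>x. \<kappa> (fst x))" "continuous_on (I \<times> {0..1}) (\<lambda>x. \<mu> (fst x))"
      "continuous_on (I \<times> {0..1}) (\<lambda>x. \<kappa>' (fst x))" "continuous_on (I \<times> {0..1}) (\<lambda>x. \<mu>' (fst x))"
    by (auto intro!: continuous_on_compose2[OF ck(1)] continuous_on_compose2[OF ck(2)]
        continuous_on_compose2[OF c'(1)] continuous_on_compose2[OF c'(2)] continuous_intros)
  have q: "continuous_on (I \<times> {0..1}) (\<lambda>x. U (\<kappa> (fst x)) (\<mu> (fst x)) (snd x))"
      "continuous_on (I \<times> {0..1}) (\<lambda>x. Uk (\<kappa> (fst x)) (\<mu> (fst x)) (snd x))"
    by (rule smooth_family_cont[OF smU] smooth_family_cont[OF smUk];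
        use o p in \<open>auto intro!: continuous_intros\<close>)+
  have "((\<lambda>s. avg (\<lambda>y. U (\<kappa> s) (\<mu> s) y * U (\<kappa> s) (\<mu> s) y)) has_real_derivative
     \<kappa>' s0 * avg (\<lambda>y. Uk (\<kappa> s0) (\<mu> s0) y * U (\<kappa> s0) (\<mu> s0) y) + \<mu>' s0 * avg (U (\<kappa> s0) (\<mu> s0))
     + avg (\<lambda>y. U (\<kappa> s0) (\<mu> s0) y * (Uk (\<kappa> s0) (\<mu> s0) y * \<kappa>' s0 + \<mu>' s0))) (at s0)"
  proof (rule avg_U_field_curve[OF I o d c'])
    show "((\<lambda>s. U (\<kappa> s) (\<mu> s) y) has_real_derivative Uk (\<kappa> s) (\<mu> s) y * \<kappa>' s + \<mu>' s) (at s)"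
      if "s \<in> I" for s y
      using U_chain(1)[of \<kappa> s \<mu>, OF o[OF that] d(1)[OF that] d(2)[OF that]] .
    show "continuous_on (I \<times> {0..1}) (\<lambda>(s, y). U (\<kappa> s) (\<mu> s) y)"
      "continuous_on (I \<times> {0..1}) (\<lambda>(s, y). Uk (\<kappa> s) (\<mu> s) y * \<kappa>' s + \<mu>' s)"
      unfolding split_beta by (intro continuous_intros p q)+
  qed
  moreover have "avg (\<lambda>y. U (\<kappa> s0) (\<mu> s0) y * (Uk (\<kappa> s0) (\<mu> s0) y * \<kappa>' s0 + \<mu>' s0))
    = \<kappa>' s0 * UUk (\<kappa> s0) (\<mu> s0) + \<mu>' s0 * \<mu> s0"
  proof -
    note cc = U_cont[OF o[OF I(2)], of "{0..1}"] Uk_cont[OF o[OF I(2)], of "{0..1}"]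
    have "avg (\<lambda>y. U (\<kappa> s0) (\<mu> s0) y * (Uk (\<kappa> s0) (\<mu> s0) y * \<kappa>' s0 + \<mu>' s0))
      = avg (\<lambda>y. \<kappa>' s0 * (U (\<kappa> s0) (\<mu> s0) y * Uk (\<kappa> s0) (\<mu> s0) y) + \<mu>' s0 * U (\<kappa> s0) (\<mu> s0) y)"
      by (simp add: algebra_simps)
    also have "\<dots> = \<kappa>' s0 * UUk (\<kappa> s0) (\<mu> s0) + \<mu>' s0 * \<mu> s0"
      unfolding UUk_def
      by (subst avg_scale_const) (auto intro!: continuous_intros cc simp: avg_U[OF o[OF I(2)]])
    finally show ?thesis .
  qed
  ultimately show ?thesis
    by (simp add: power2_eq_square UUk_def mult.commute[of "Uk _ _ _"] avg_U[OF o[OF I(2)]] algebra_simps)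
qed

lemma avg_sq_k:
  assumes o: "(k, M) \<in> \<Omega>"
  shows "((\<lambda>k. avg (\<lambda>y. (U k M y)^2)) has_real_derivative 2 * UUk k M) (at k)"
proof -
  have "((\<lambda>k. avg (\<lambda>y. (U k M y)^2)) has_real_derivative 2 * UUk k M * 1 + 2 * M * 0) (at k)"
    by (rule avg_U_square_curve[OF open_slice(1)[OF O, of M], where \<kappa>="\<lambda>s. s" and \<mu>="\<lambda>_. M"
          and \<kappa>'="\<lambda>_. 1" and \<mu>'="\<lambda>_. 0"]) (use o in simp_all)
  then show ?thesis by simp
qed

lemma avg_sq_M:
  assumes o: "(k, M) \<in> \<Omega>"
  shows "((\<lambda>M. avg (\<lambda>y. (U k M y)^2)) has_real_derivative 2 * M) (at M)"
proof -
  have "((\<lambda>M. avg (\<lambda>y. (U k M y)^2)) has_real_derivative 2 * UUk k M * 0 + 2 * M * 1) (at M)"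
    by (rule avg_U_square_curve[OF open_slice(2)[OF O, of k], where \<kappa>="\<lambda>_. k" and \<mu>="\<lambda>s. s"
          and \<kappa>'="\<lambda>_. 0" and \<mu>'="\<lambda>_. 1"]) (use o in simp_all)
  then show ?thesis by simp
qed

lemma dpar_avg_sq:
  assumes o: "(k, M) \<in> \<Omega>"
  shows "dpar (\<lambda>k M. avg (\<lambda>y. (U k M y)^2)) k M a b = (2 * UUk k M) *\<^sub>R a + (2 * M) *\<^sub>R b"
    "dpar (\<lambda>k M. avg (\<lambda>y. 3 * (U k M y)^2)) k M a b = (6 * UUk k M) *\<^sub>R a + (6 * M) *\<^sub>R b"
proof -
  show "dpar (\<lambda>k M. avg (\<lambda>y. (U k M y)^2)) k M a b = (2 * UUk k M) *\<^sub>R a + (2 * M) *\<^sub>R b"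
    using D_eqI_real[OF avg_sq_k[OF o]] D_eqI_real[OF avg_sq_M[OF o]]
    by (simp add: dpar_def dk_def dM_def)
  show "dpar (\<lambda>k M. avg (\<lambda>y. 3 * (U k M y)^2)) k M a b = (6 * UUk k M) *\<^sub>R a + (6 * M) *\<^sub>R b"
    using D_eqI_real[OF DERIV_cmult[OF avg_sq_k[OF o], of 3]] D_eqI_real[OF DERIV_cmult[OF avg_sq_M[OF o], of 3]]
    by (simp add: dpar_def dk_def dM_def avg_mult_real)
qed

lemma dk_Q:
  assumes o: "(k, M) \<in> \<Omega>"
  shows "dk (\<lambda>k M. (U k M y)^2 - avg (\<lambda>z. (U k M z)^2)) k M = 2 * (U k M y * Uk k M y - UUk k M)"
    "dk (\<lambda>k M. 3 * (U k M y)^2 - avg (\<lambda>z. 3 * (U k M z)^2)) k M = 6 * (U k M y * Uk k M y - UUk k M)"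
    "dM (\<lambda>k M. (U k M y)^2 - avg (\<lambda>z. (U k M z)^2)) k M = 2 * (U k M y - M)"
    "dM (\<lambda>k M. 3 * (U k M y)^2 - avg (\<lambda>z. 3 * (U k M z)^2)) k M = 6 * (U k M y - M)"
    "dM (\<lambda>k M. U k M y - avg (U k M)) k M = 0"
proof -
  note k = fam_has_k[OF smU o, of y] avg_sq_k[OF o]
    and M = fam_has_M[OF smU o, of y, unfolded U_M[OF o]] avg_sq_M[OF o]
  show "dk (\<lambda>k M. (U k M y)^2 - avg (\<lambda>z. (U k M z)^2)) k M = 2 * (U k M y * Uk k M y - UUk k M)"
    "dk (\<lambda>k M. 3 * (U k M y)^2 - avg (\<lambda>z. 3 * (U k M z)^2)) k M = 6 * (U k M y * Uk k M y - UUk k M)"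
    unfolding dk_def[of "\<lambda>k M. (U k M y)^2 - _ k M"] dk_def[of "\<lambda>k M. 3 * (U k M y)^2 - _ k M"] avg_mult_real
    by (rule D_eqI_real, (rule derivative_eq_intros k refl)+, simp)+
  show "dM (\<lambda>k M. (U k M y)^2 - avg (\<lambda>z. (U k M z)^2)) k M = 2 * (U k M y - M)"
    "dM (\<lambda>k M. 3 * (U k M y)^2 - avg (\<lambda>z. 3 * (U k M z)^2)) k M = 6 * (U k M y - M)"
    unfolding dM_def avg_mult_real
    by (rule D_eqI_real, (rule derivative_eq_intros M refl)+, simp)+
  have "((\<lambda>M. U k M y - M) has_real_derivative 0) (at M)"
    by (rule derivative_eq_intros M refl)+ simp
  then have "((\<lambda>M. U k M y - avg (U k M)) has_real_derivative 0) (at M)"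
    by (rule has_field_derivative_transform_within_open[OF _ open_slice(2)[OF O, of k]]) (use o in \<open>auto simp: avg_U\<close>)
  then show "dM (\<lambda>k M. U k M y - avg (U k M)) k M = 0"
    unfolding dM_def by (rule D_eqI_real)
qed

end

subsection \<open>Expansions along the imaginary axis\<close>

text \<open>Coefficients are identified by uniqueness of limits, which requires 0 to be a limit
  point of the imaginary axis.\<close>

lemma im0_not_bot: "im0 \<noteq> bot"
proof -
  have "(0::complex) islimpt {\<nu>. Re \<nu> = 0}"
  proof (rule islimptI)
    fix T :: "complex set" assume "0 \<in> T" "open T"
    then obtain e where e: "e > 0" "ball 0 e \<subseteq> T" using openE by blast
    let ?z = "\<i> * of_real (e / 2) :: complex"
    have "norm ?z < e" using e by (simp add: norm_mult)
    then have "?z \<in> T" using e by (auto simp: subset_iff)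
    moreover have "?z \<noteq> 0" using e by simp
    ultimately show "\<exists>y\<in>{\<nu>. Re \<nu> = 0}. y \<in> T \<and> y \<noteq> 0" by (intro bexI[of _ ?z]) auto
  qed
  then show ?thesis by (simp add: im0_def trivial_limit_within)
qed

lemma im0_tendsto: "((\<lambda>\<nu>. \<nu>) \<longlongrightarrow> 0) im0"
  unfolding im0_def by (rule tendsto_ident_at)

lemma im0_nonzero: "\<forall>\<^sub>F \<nu> in im0. \<nu> \<noteq> 0"
  unfolding im0_def by (simp add: eventually_at_filter)

lemma im0_pow_tendsto: "n > 0 \<Longrightarrow> ((\<lambda>\<nu>. \<nu>^n) \<longlongrightarrow> 0) im0"
  using tendsto_power[OF im0_tendsto, of n] by (simp add: power_0_left)

abbreviation nuO :: "nat \<Rightarrow> (complex \<Rightarrow> complex) set" where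
  "nuO n \<equiv> O[im0](\<lambda>\<nu>. \<nu>^n)"

text \<open>Coefficients are read off one at a time: the limit \<nu> \<rightarrow> 0 isolates a, and
  once a = 0 one factor \<nu> cancels on both sides. Convergence of r ensures that \<nu> r(\<nu>)
  disappears in the limit.\<close>

lemma bigo_im0_peel:
  assumes f: "(\<lambda>\<nu>. a + \<nu> * r \<nu>) \<in> nuO (Suc n)" and r: "(r \<longlongrightarrow> l) im0"
  shows "a = 0" "r \<in> nuO n"
proof -
  obtain C where C: "\<forall>\<^sub>F \<nu> in im0. norm (a + \<nu> * r \<nu>) \<le> C * norm (\<nu>^Suc n)"
    using f by (auto elim: landau_o.bigE)
  have "((\<lambda>\<nu>. C * norm (\<nu>^Suc n)) \<longlongrightarrow> C * norm (0::complex)) im0"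
    by (intro tendsto_intros im0_pow_tendsto) simp
  then have "((\<lambda>\<nu>. a + \<nu> * r \<nu>) \<longlongrightarrow> 0) im0"
    by (intro Lim_null_comparison[OF C]) simp
  moreover have "((\<lambda>\<nu>. a + \<nu> * r \<nu>) \<longlongrightarrow> a + 0 * l) im0"
    by (intro tendsto_intros im0_tendsto r)
  ultimately show a: "a = 0" using tendsto_unique[OF im0_not_bot] by fastforce
  show "r \<in> nuO n"
  proof (rule bigoI[of _ C])
    show "\<forall>\<^sub>F \<nu> in im0. norm (r \<nu>) \<le> C * norm (\<nu>^n)"
      using C im0_nonzero
      by eventually_elim (simp add: a norm_mult norm_power field_simps)
  qed
qed

lemma bigo_im0_const: "(\<lambda>\<nu>. a) \<in> nuO (Suc n) \<Longrightarrow> a = 0"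
  using bigo_im0_peel(1)[of a "\<lambda>_. 0" n 0] by simp

lemma bigo_im0_quadratic:
  assumes "(\<lambda>\<nu>. a + \<nu> * b + \<nu>^2 * d) \<in> nuO 3"
  shows "a = 0" "b = 0" "d = 0"
proof -
  have 1: "(\<lambda>\<nu>. a + \<nu> * (b + \<nu> * d)) \<in> nuO (Suc 2)"
    using assms by (simp add: algebra_simps power2_eq_square)
  have t: "((\<lambda>\<nu>. b + \<nu> * d) \<longlongrightarrow> b + 0 * d) im0" "((\<lambda>\<nu>. d) \<longlongrightarrow> d) im0"
    by (intro tendsto_intros im0_tendsto)+
  have 2: "(\<lambda>\<nu>. b + \<nu> * d) \<in> nuO (Suc 1)"
    using bigo_im0_peel(2)[OF 1 t(1)] by (simp add: numeral_2_eq_2)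
  have 3: "(\<lambda>\<nu>. d) \<in> nuO (Suc 0)"
    using bigo_im0_peel(2)[OF 2 t(2)] by simp
  show "a = 0" "b = 0" "d = 0"
    using bigo_im0_peel(1)[OF 1 t(1)] bigo_im0_peel(1)[OF 2 t(2)] bigo_im0_const[OF 3] by auto
qed

lemma bigo_im0_pow: "m \<le> n \<Longrightarrow> (\<lambda>\<nu>. \<nu>^n) \<in> nuO m"
proof (rule bigoI[of _ 1])
  assume mn: "m \<le> n"
  have "\<forall>\<^sub>F \<nu> in im0. norm \<nu> < 1"
    using tendstoD[OF im0_tendsto, of 1] by (simp add: dist_norm)
  then show "\<forall>\<^sub>F \<nu> in im0. norm (\<nu>^n) \<le> 1 * norm (\<nu>^m)"
    by eventually_elim (use mn in \<open>auto simp: norm_power intro: power_decreasing\<close>)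
qed

lemma bigo_im0_weaken: "f \<in> nuO n \<Longrightarrow> m \<le> n \<Longrightarrow> f \<in> nuO m"
  using bigo_im0_pow landau_o.big_trans by blast

lemma bigo_im0_mult:
  assumes "f \<in> nuO m" "g \<in> nuO n"
  shows "(\<lambda>\<nu>. f \<nu> * g \<nu>) \<in> nuO (m + n)"
  using landau_o.big.mult[OF assms] by (simp add: power_add)

lemma bigo_im0_mult':
  assumes "f \<in> nuO m" "g \<in> nuO n" "p \<le> m + n"
  shows "(\<lambda>\<nu>. f \<nu> * g \<nu>) \<in> nuO p"
  using bigo_im0_weaken[OF bigo_im0_mult[OF assms(1,2)] assms(3)] .

lemma bigo_im0_c: "(\<lambda>\<nu>. a) \<in> nuO 0"
  by simp

lemma bigo_im0_cmult: "f \<in> nuO n \<Longrightarrow> (\<lambda>\<nu>. a * f \<nu>) \<in> nuO n"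
  using bigo_im0_mult[OF bigo_im0_c, of f n a] by simp

lemma bigo_im0_shift:
  "f \<in> nuO n \<Longrightarrow> (\<lambda>\<nu>. \<nu>^m * f \<nu>) \<in> nuO (m + n)"
  by (rule bigo_im0_mult) auto

text \<open>\<open>A j i\<close> is the coefficient of \<open>\<nu>^j\<close> in the operator applied to \<open>u\<^sub>i\<close> at a fixed point, and \<open>R j\<close> the
  same for the remainder of \<open>u\<close>.\<close>

lemma eigen_orders:
  fixes A :: "nat \<Rightarrow> nat \<Rightarrow> complex" and R :: "nat \<Rightarrow> complex \<Rightarrow> complex"
  assumes eq: "\<forall>\<^sub>F \<nu> in im0. (A 0 0 + \<nu> * A 0 1 + \<nu>^2 * A 0 2 + R 0 \<nu>)
      + \<nu> * (A 1 0 + \<nu> * A 1 1 + \<nu>^2 * A 1 2 + R 1 \<nu>)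
      + \<nu>^2 * (A 2 0 + \<nu> * A 2 1 + \<nu>^2 * A 2 2 + R 2 \<nu>)
      + \<nu>^3 * G3 \<nu> + \<nu>^4 * G4 \<nu> + lam \<nu> * f \<nu> = 0"
    and R: "\<And>j. j \<le> 2 \<Longrightarrow> R j \<in> nuO 3"
    and G: "G3 \<in> nuO 0" "G4 \<in> nuO 0"
    and lam: "(\<lambda>\<nu>. lam \<nu> - (\<nu> * l0 + \<nu>^2 * l1)) \<in> nuO 3"
    and f: "(\<lambda>\<nu>. f \<nu> - (a + \<nu> * b + \<nu>^2 * d)) \<in> nuO 3"
    and f0: "f \<in> nuO 0"
  shows "A 0 0 = 0" "A 0 1 + A 1 0 + l0 * a = 0"
    "A 0 2 + A 1 1 + A 2 0 + l0 * b + l1 * a = (0::complex)"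
proof -
  let ?X = "A 0 1 + A 1 0 + l0 * a" and ?Y = "A 0 2 + A 1 1 + A 2 0 + l0 * b + l1 * a"
  let ?\<rho> = "\<lambda>\<nu>. lam \<nu> - (\<nu> * l0 + \<nu>^2 * l1)" and ?r = "\<lambda>\<nu>. f \<nu> - (a + \<nu> * b + \<nu>^2 * d)"
  \<comment> \<open>Everything in the equation except the polynomial of degree 2. The product
    \<open>lam \<nu> * f \<nu>\<close> is split by first replacing \<open>lam\<close> and then
    \<open>f\<close> by their polynomials, which leaves \<open>?\<rho> \<nu> * f \<nu>\<close>, the
    terms with \<open>?r\<close>, and the cubic and quartic products.\<close>
  let ?Q = "\<lambda>\<nu>. R 0 \<nu> + \<nu>^1 * R 1 \<nu> + \<nu>^2 * R 2 \<nu>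
    + \<nu>^3 * (A 1 2 + A 2 1 + l0 * d + l1 * b) + \<nu>^3 * G3 \<nu> + \<nu>^4 * (A 2 2 + l1 * d) + \<nu>^4 * G4 \<nu>
    + \<nu>^1 * (l0 * ?r \<nu>) + \<nu>^2 * (l1 * ?r \<nu>) + ?\<rho> \<nu> * f \<nu>"
  have Q1: "(\<lambda>\<nu>. \<nu>^m * g \<nu>) \<in> nuO 3" if "g \<in> nuO n" "3 \<le> m + n" for m n g
    using bigo_im0_weaken[OF bigo_im0_shift[OF that(1)] that(2)] .
  have "?Q \<in> nuO 3"
    by (intro sum_in_bigo(1) R Q1[OF R, of 1] Q1[OF R, of 2] Q1[OF bigo_im0_c] Q1[OF G(1)] Q1[OF G(2)]
        Q1[OF bigo_im0_cmult[OF f]] bigo_im0_mult'[OF lam f0]) simp_all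
  then have "(\<lambda>\<nu>. - ?Q \<nu>) \<in> nuO 3" by (subst landau_o.big.uminus_in_iff)
  moreover have "\<forall>\<^sub>F \<nu> in im0. - ?Q \<nu> = A 0 0 + \<nu> * ?X + \<nu>^2 * ?Y"
    using eq by eventually_elim (simp add: algebra_simps power2_eq_square power3_eq_cube power4_eq_xxxx)
  ultimately have "(\<lambda>\<nu>. A 0 0 + \<nu> * ?X + \<nu>^2 * ?Y) \<in> nuO 3"
    by (rule landau_o.big.in_cong[THEN iffD1, rotated])
  from bigo_im0_quadratic[OF this] show "A 0 0 = 0" "?X = 0" "?Y = 0" by auto
qed

text \<open>Averaging removes all derivatives, so that the averaged equation starts with \<open>\<nu>^2\<close>.\<close>

lemma mean_orders:
  fixes k \<delta> :: complex
  assumes eq: "\<forall>\<^sub>F \<nu> in im0. k * \<nu> * W \<nu> + k^3 * \<nu>^3 * m \<nu> + \<delta> * (k^2 * \<nu>^2 * m \<nu> + k^4 * \<nu>^4 * m \<nu>)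
      + lam \<nu> * m \<nu> = 0"
    and W: "(\<lambda>\<nu>. W \<nu> - (\<nu> * W1 + \<nu>^2 * W2)) \<in> nuO 3"
    and m: "(\<lambda>\<nu>. m \<nu> - (\<nu> * m1 + \<nu>^2 * m2)) \<in> nuO 3"
    and lam: "(\<lambda>\<nu>. lam \<nu> - (\<nu> * l0 + \<nu>^2 * l1)) \<in> nuO 3"
  shows "k * W1 + l0 * m1 = 0" "k * W2 + \<delta> * k^2 * m1 + l0 * m2 + l1 * m1 = 0"
proof -
  let ?X = "k * W1 + l0 * m1" and ?Y = "k * W2 + \<delta> * k^2 * m1 + l0 * m2 + l1 * m1"
  let ?w = "\<lambda>\<nu>. W \<nu> - (\<nu> * W1 + \<nu>^2 * W2)" and ?r = "\<lambda>\<nu>. m \<nu> - (\<nu> * m1 + \<nu>^2 * m2)"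
    and ?\<rho> = "\<lambda>\<nu>. lam \<nu> - (\<nu> * l0 + \<nu>^2 * l1)"
  have Q1: "(\<lambda>\<nu>. \<nu>^i * g \<nu>) \<in> nuO p" if "g \<in> nuO n" "p \<le> i + n" for i n g p
    using bigo_im0_weaken[OF bigo_im0_shift[OF that(1)] that(2)] .
  \<comment> \<open>The expansion of m has no constant term. This yields two cruder bounds that are
    needed besides \<open>m\<close>: m = O(\<nu>) and m - \<nu> m1 = O(\<nu>^2).\<close>
  have "(\<lambda>\<nu>. ?r \<nu> + (\<nu>^1 * m1 + \<nu>^2 * m2)) \<in> nuO 1"
    by (intro sum_in_bigo(1) bigo_im0_weaken[OF m] Q1[OF bigo_im0_c]) simp_all
  then have m': "m \<in> nuO 1" by simp
  have "(\<lambda>\<nu>. ?r \<nu> + \<nu>^2 * m2) \<in> nuO 2"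
    by (intro sum_in_bigo(1) bigo_im0_weaken[OF m] Q1[OF bigo_im0_c]) simp_all
  then have m'': "(\<lambda>\<nu>. m \<nu> - \<nu> * m1) \<in> nuO 2" by (simp add: algebra_simps)
  \<comment> \<open>All that remains besides the orders \<nu>^2 and \<nu>^3. It is O(\<nu>^4)
    although W, m and lam are known only up to O(\<nu>^3): W occurs with a factor \<nu>, the
    remainder of m is multiplied by \<nu> or \<nu>^2, and the remainder of lam is multiplied by m =
    O(\<nu>).\<close>
  let ?Q = "\<lambda>\<nu>. \<nu>^1 * (k * ?w \<nu>) + \<nu>^3 * (k^3 * m \<nu>) + \<nu>^2 * (\<delta> * k^2 * (m \<nu> - \<nu> * m1))
    + \<nu>^4 * (\<delta> * k^4 * m \<nu>) + \<nu>^1 * (l0 * ?r \<nu>) + \<nu>^2 * (l1 * ?r \<nu>) + \<nu>^4 * (l1 * m2) + ?\<rho> \<nu> * m \<nu>"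
  have "?Q \<in> nuO 4"
    by (intro sum_in_bigo(1) Q1[OF bigo_im0_cmult[OF W]] Q1[OF bigo_im0_cmult[OF m']]
        Q1[OF bigo_im0_cmult[OF m'']] Q1[OF bigo_im0_cmult[OF m]] Q1[OF bigo_im0_c]
        bigo_im0_mult'[OF lam m']) simp_all
  then have "(\<lambda>\<nu>. - ?Q \<nu>) \<in> nuO 4" by (subst landau_o.big.uminus_in_iff)
  moreover have "\<forall>\<^sub>F \<nu> in im0. - ?Q \<nu> = 0 + \<nu> * (0 + \<nu> * (?X + \<nu> * ?Y))"
    using eq by eventually_elim (simp add: algebra_simps power2_eq_square power3_eq_cube power4_eq_xxxx)
  ultimately have 1: "(\<lambda>\<nu>. 0 + \<nu> * (0 + \<nu> * (?X + \<nu> * ?Y))) \<in> nuO (Suc 3)"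
    by (subst landau_o.big.in_cong[symmetric]) simp_all
  have t: "((\<lambda>\<nu>. 0 + \<nu> * (?X + \<nu> * ?Y)) \<longlongrightarrow> 0 + 0 * (?X + 0 * ?Y)) im0"
    "((\<lambda>\<nu>. ?X + \<nu> * ?Y) \<longlongrightarrow> ?X + 0 * ?Y) im0"
    "((\<lambda>\<nu>. ?Y) \<longlongrightarrow> ?Y) im0"
    by (intro tendsto_intros im0_tendsto)+
  have 2: "(\<lambda>\<nu>. 0 + \<nu> * (?X + \<nu> * ?Y)) \<in> nuO (Suc 2)"
    using bigo_im0_peel(2)[OF 1 t(1)] by (simp add: numeral_3_eq_3 numeral_2_eq_2)
  have 3: "(\<lambda>\<nu>. ?X + \<nu> * ?Y) \<in> nuO (Suc 1)"
    using bigo_im0_peel(2)[OF 2 t(2)] by (simp add: numeral_2_eq_2)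
  have 4: "(\<lambda>\<nu>. ?Y) \<in> nuO (Suc 0)"
    using bigo_im0_peel(2)[OF 3 t(3)] by simp
  show "?X = 0" "?Y = 0"
    using bigo_im0_peel(1)[OF 3 t(3)] bigo_im0_const[OF 4] by auto
qed

subsection \<open>The Bloch operators\<close>

lemma bloch_D_Cper: "f \<in> Cper (Suc n) \<Longrightarrow> bloch_D \<nu> f \<in> Cper n"
  unfolding bloch_D_def[abs_def] using Cper_D[of f n] Cper_Suc_Cper[of f n] by (intro Cper_add Cper_cmult)

lemma avg_bloch_D: "f \<in> Cper (Suc n) \<Longrightarrow> avg (bloch_D \<nu> f) = \<nu> * avg f"
  unfolding bloch_D_def[abs_def]
  using Cper_cont[of f "Suc n" "{0..1}"] Cper_cont[of "D f" n "{0..1}"] avg_D[of f]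
  by (subst avg_add) (auto simp: avg_cmult Cper_D Cper_mono intro!: continuous_intros)

lemma bloch_D_pow:
  fixes f :: "real \<Rightarrow> complex"
  assumes f: "f \<in> Cper 4"
  shows "bloch_D \<nu> f x = D f x + \<nu> * f x"
    "(bloch_D \<nu> ^^ 2) f x = D (D f) x + 2 * \<nu> * D f x + \<nu>^2 * f x"
    "(bloch_D \<nu> ^^ 3) f x = D (D (D f)) x + 3 * \<nu> * D (D f) x + 3 * \<nu>^2 * D f x + \<nu>^3 * f x"
    "(bloch_D \<nu> ^^ 4) f x = D (D (D (D f))) x + 4 * \<nu> * D (D (D f)) x + 6 * \<nu>^2 * D (D f) x
       + 4 * \<nu>^3 * D f x + \<nu>^4 * f x"
proof -
  note d = Cper_D4_deriv[OF f]
  have m: "((\<lambda>x. a * g x) has_vector_derivative a * g') (at x)"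
    if "(g has_vector_derivative g') (at x)" for a g and g' :: complex and x
    using bounded_linear.has_vector_derivative[OF bl_cmult that] .
  have 1: "bloch_D \<nu> f = (\<lambda>x. D f x + \<nu> * f x)" by (auto simp: bloch_D_def)
  have "D (bloch_D \<nu> f) = (\<lambda>x. D (D f) x + \<nu> * D f x)"
    unfolding 1 by (intro ext D_eqI has_vector_derivative_add m d)
  then have 2: "bloch_D \<nu> (bloch_D \<nu> f) = (\<lambda>x. D (D f) x + 2 * \<nu> * D f x + \<nu>^2 * f x)"
    by (auto simp: bloch_D_def 1 algebra_simps power2_eq_square)
  have "D (bloch_D \<nu> (bloch_D \<nu> f)) = (\<lambda>x. D (D (D f)) x + 2 * \<nu> * D (D f) x + \<nu>^2 * D f x)"
    unfolding 2 by (intro ext D_eqI has_vector_derivative_add m d)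
  then have 3: "bloch_D \<nu> (bloch_D \<nu> (bloch_D \<nu> f))
      = (\<lambda>x. D (D (D f)) x + 3 * \<nu> * D (D f) x + 3 * \<nu>^2 * D f x + \<nu>^3 * f x)"
    unfolding bloch_D_def[of \<nu> "bloch_D \<nu> (bloch_D \<nu> f)"]
    by (auto simp: 2 algebra_simps power2_eq_square power3_eq_cube)
  have "D (bloch_D \<nu> (bloch_D \<nu> (bloch_D \<nu> f)))
      = (\<lambda>x. D (D (D (D f))) x + 3 * \<nu> * D (D (D f)) x + 3 * \<nu>^2 * D (D f) x + \<nu>^3 * D f x)"
    unfolding 3 by (intro ext D_eqI has_vector_derivative_add m d)
  then have 4: "bloch_D \<nu> (bloch_D \<nu> (bloch_D \<nu> (bloch_D \<nu> f))) = (\<lambda>x. D (D (D (D f))) x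
      + 4 * \<nu> * D (D (D f)) x + 6 * \<nu>^2 * D (D f) x + 4 * \<nu>^3 * D f x + \<nu>^4 * f x)"
    unfolding bloch_D_def[of \<nu> "bloch_D \<nu> (bloch_D \<nu> (bloch_D \<nu> f))"]
    by (auto simp: 3 algebra_simps power2_eq_square power3_eq_cube power4_eq_xxxx)
  have pow: "(bloch_D \<nu> ^^ 2) f = bloch_D \<nu> (bloch_D \<nu> f)"
    "(bloch_D \<nu> ^^ 3) f = bloch_D \<nu> (bloch_D \<nu> (bloch_D \<nu> f))"
    "(bloch_D \<nu> ^^ 4) f = bloch_D \<nu> (bloch_D \<nu> (bloch_D \<nu> (bloch_D \<nu> f)))"
    by (simp_all add: eval_nat_numeral)
  show "bloch_D \<nu> f x = D f x + \<nu> * f x" by (simp only: 1)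
  show "(bloch_D \<nu> ^^ 2) f x = D (D f) x + 2 * \<nu> * D f x + \<nu>^2 * f x"
    unfolding pow by (rule fun_cong[OF 2])
  show "(bloch_D \<nu> ^^ 3) f x = D (D (D f)) x + 3 * \<nu> * D (D f) x + 3 * \<nu>^2 * D f x + \<nu>^3 * f x"
    unfolding pow by (rule fun_cong[OF 3])
  show "(bloch_D \<nu> ^^ 4) f x = D (D (D (D f))) x + 4 * \<nu> * D (D (D f)) x + 6 * \<nu>^2 * D (D f) x
       + 4 * \<nu>^3 * D f x + \<nu>^4 * f x"
    unfolding pow by (rule fun_cong[OF 4])
qed

text \<open>\<open>bop \<delta> k s V j\<close> is the coefficient of \<open>\<nu>^j\<close> in \<open>bloch_op \<delta> k s V \<nu>\<close>; row \<open>j\<close> of the table lists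
  the coefficients of \<open>f, f', \<dots>, f''''\<close>.\<close>

definition bcoef :: "real \<Rightarrow> real \<Rightarrow> real \<Rightarrow> real \<Rightarrow> real \<Rightarrow> nat \<Rightarrow> nat \<Rightarrow> real" where
  "bcoef \<delta> k s v v' j n =
    [[6 * k * v', k * (6 * v - s), \<delta> * k^2, k^3, \<delta> * k^4],
     [k * (6 * v - s), 2 * \<delta> * k^2, 3 * k^3, 4 * \<delta> * k^4, 0],
     [\<delta> * k^2, 3 * k^3, 6 * \<delta> * k^4, 0, 0],
     [k^3, 4 * \<delta> * k^4, 0, 0, 0],
     [\<delta> * k^4, 0, 0, 0, 0]] ! j ! n"

definition bop :: "real \<Rightarrow> real \<Rightarrow> real \<Rightarrow> (real \<Rightarrow> real) \<Rightarrow> nat \<Rightarrow> (real \<Rightarrow> complex) \<Rightarrow> real \<Rightarrow> complex" where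
  "bop \<delta> k s V j f x = (\<Sum>n\<le>4. complex_of_real (bcoef \<delta> k s (V x) (D V x) j n) * (D ^^ n) f x)"

lemma sum_le_4: "(\<Sum>n\<le>4. g n) = g 0 + g 1 + g 2 + g 3 + g (4::nat)" for g :: "nat \<Rightarrow> 'a::comm_monoid_add"
  by (simp add: numeral_eq_Suc)

lemma bop_add:
  "f \<in> Cper 4 \<Longrightarrow> g \<in> Cper 4 \<Longrightarrow> bop \<delta> k s V j (\<lambda>x. f x + g x) y = bop \<delta> k s V j f y + bop \<delta> k s V j g y"
  by (simp add: bop_def D_pow_add sum.distrib[symmetric] distrib_left)

lemma bop_cmult:
  "f \<in> Cper 4 \<Longrightarrow> bop \<delta> k s V j (\<lambda>x. a * f x) y = a * bop \<delta> k s V j f y"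
  by (simp add: bop_def D_pow_cmult sum_distrib_left mult_ac)

lemma bop_of_real:
  "f \<in> Cper 4 \<Longrightarrow> bop \<delta> k s V j (\<lambda>x. complex_of_real (f x)) y
    = complex_of_real (\<Sum>n\<le>4. bcoef \<delta> k s (V y) (D V y) j n * (D ^^ n) f y)"
  by (simp add: bop_def D_pow_of_real)

lemma bop_const: "bop \<delta> k s V j (\<lambda>x. a) y = complex_of_real (bcoef \<delta> k s (V y) (D V y) j 0) * a"
  by (simp add: bop_def sum_le_4)

lemma Lop_bop:
  assumes "V \<in> Cper 1" "f \<in> Cper 4"
  shows "Lop \<delta> k s V f x = bop \<delta> k s V 0 f x"
  by (simp add: Lop_eq[OF assms] bop_def sum_le_4 bcoef_def D_numeral scaleR_conv_of_real algebra_simps)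

lemma bloch_op_bop:
  assumes V: "V \<in> Cper 1" and f: "f \<in> Cper 4"
  shows "bloch_op \<delta> k s V \<nu> f x = bop \<delta> k s V 0 f x + \<nu> * bop \<delta> k s V 1 f x + \<nu>^2 * bop \<delta> k s V 2 f x
    + \<nu>^3 * bop \<delta> k s V 3 f x + \<nu>^4 * bop \<delta> k s V 4 f x"
proof -
  have "((\<lambda>z. 6 * V z - s) has_real_derivative 6 * D V x) (at x)"
    using Cper_Suc_D[of V 0 x] V
    by (auto intro!: derivative_eq_intros simp: has_real_derivative_iff_has_vector_derivative[symmetric])
  then have "((\<lambda>z. (6 * V z - s) *\<^sub>R f z) has_vector_derivative (6 * V x - s) *\<^sub>R D f x + (6 * D V x) *\<^sub>R f x) (at x)"
    by (intro has_vector_derivative_scaleR Cper_D4_deriv(1)[OF f])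
  then have B: "bloch_D \<nu> (\<lambda>z. complex_of_real (6 * V z - s) * f z) x
    = (6 * V x - s) *\<^sub>R D f x + (6 * D V x) *\<^sub>R f x + \<nu> * (complex_of_real (6 * V x - s) * f x)"
    unfolding bloch_D_def scaleR_conv_of_real by (simp only: D_eqI)
  show ?thesis
    unfolding bloch_op_def bloch_D_pow[OF f] B
    by (simp add: bop_def sum_le_4 bcoef_def D_numeral scaleR_conv_of_real algebra_simps
        power2_eq_square power3_eq_cube power4_eq_xxxx)
qed

lemma Cper_pot_mult:
  fixes f :: "real \<Rightarrow> complex"
  assumes "V \<in> Cper n" "f \<in> Cper n"
  shows "(\<lambda>z. complex_of_real (6 * V z - s) * f z) \<in> Cper n"
proof -
  have "(\<lambda>z. 6 * V z) \<in> Cper n" using Cper_cmult[OF assms(1)] .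
  then have "(\<lambda>z. 6 * V z - s) \<in> Cper n" by (intro Cper_diff Cper_const)
  then show ?thesis by (intro Cper_mult Cper_of_real assms)
qed

text \<open>Under the average each d/dx + \<nu> becomes the factor \<nu>; only the potential leaves
  a weighted mean.\<close>

lemma avg_bloch_op:
  assumes V: "V \<in> Cper 1" and f: "f \<in> Cper 4"
  shows "avg (bloch_op \<delta> k s V \<nu> f) = k * \<nu> * avg (\<lambda>z. complex_of_real (6 * V z - s) * f z) + k^3 * \<nu>^3 * avg f
    + \<delta> * (k^2 * \<nu>^2 * avg f + k^4 * \<nu>^4 * avg f)"
proof -
  let ?g = "\<lambda>z. complex_of_real (6 * V z - s) * f z"
  have g: "?g \<in> Cper (Suc 0)" using Cper_pot_mult[OF V Cper_mono[OF f]] by simp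
  have p: "(bloch_D \<nu> ^^ j) f \<in> Cper (4 - j) \<and> avg ((bloch_D \<nu> ^^ j) f) = \<nu>^j * avg f" if "j \<le> 4" for j
    using that
  proof (induction j)
    case (Suc j)
    then have "4 - j = Suc (4 - Suc j)" by arith
    then have "(bloch_D \<nu> ^^ j) f \<in> Cper (Suc (4 - Suc j))" using Suc by simp
    from bloch_D_Cper[OF this] avg_bloch_D[OF this] Suc show ?case by simp
  qed (use f in simp)
  have c: "continuous_on {0..1} ((bloch_D \<nu> ^^ j) f)" if "j \<le> 4" for j
    using p[OF that] Cper_cont by blast
  have cg: "continuous_on {0..1} (bloch_D \<nu> ?g)" by (rule Cper_cont[OF bloch_D_Cper[OF g]])
  have "avg (bloch_op \<delta> k s V \<nu> f) = k * avg (bloch_D \<nu> ?g) + k^3 * avg ((bloch_D \<nu> ^^ 3) f)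
     + \<delta> * (k^2 * avg ((bloch_D \<nu> ^^ 2) f) + k^4 * avg ((bloch_D \<nu> ^^ 4) f))"
    unfolding bloch_op_def[abs_def]
    using c[of 2] c[of 3] c[of 4] cg by (simp add: avg_add avg_cmult continuous_intros)
  then show ?thesis
    using p[of 2] p[of 3] p[of 4] avg_bloch_D[OF g] by (simp add: mult_ac)
qed

lemma bop_bigo:
  assumes "\<And>n. n \<le> 4 \<Longrightarrow> (\<lambda>\<nu>. (D ^^ n) (f \<nu>) x) \<in> nuO m"
  shows "(\<lambda>\<nu>. bop \<delta> k s V j (f \<nu>) x) \<in> nuO m"
  unfolding bop_def by (intro big_sum_in_bigo bigo_im0_cmult assms) simp

text \<open>The remainder is small in the C^4 norm, uniformly in x, so the equation can be expanded
  at each point and also after averaging. The last two identities are the orders \<nu>^2 and \<nu>^3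
  of the average; their premises remove its order \<nu> and hold once u0 is a multiple of
  V'.\<close>

lemma bloch_orders:
  assumes V: "V \<in> Cper 1" and be: "bloch_expansion \<delta> k s V lam u l0 l1 u0 u1 u2"
  shows "bop \<delta> k s V 0 u0 x = 0" "bop \<delta> k s V 0 u1 x + bop \<delta> k s V 1 u0 x + l0 * u0 x = 0"
    "bop \<delta> k s V 0 u2 x + bop \<delta> k s V 1 u1 x + bop \<delta> k s V 2 u0 x + l0 * u1 x + l1 * u0 x = 0"
    "avg u0 = 0 \<Longrightarrow> avg (\<lambda>z. complex_of_real (6 * V z - s) * u0 z) = 0 \<Longrightarrow>
       k * avg (\<lambda>z. complex_of_real (6 * V z - s) * u1 z) + l0 * avg u1 = 0"
    "avg u0 = 0 \<Longrightarrow> avg (\<lambda>z. complex_of_real (6 * V z - s) * u0 z) = 0 \<Longrightarrow>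
       k * avg (\<lambda>z. complex_of_real (6 * V z - s) * u2 z) + complex_of_real (\<delta> * k^2) * avg u1 + l0 * avg u2 + l1 * avg u1 = 0"
proof -
  have u: "u0 \<in> Cper 4" "u1 \<in> Cper 4" "u2 \<in> Cper 4"
    and ev: "\<forall>\<^sub>F \<nu> in im0. u \<nu> \<in> Cper 4 \<and> (\<forall>x. bloch_op \<delta> k s V \<nu> (u \<nu>) x = - lam \<nu> * u \<nu> x)"
    and lam: "(\<lambda>\<nu>. lam \<nu> - (\<nu> * l0 + \<nu>^2 * l1)) \<in> nuO 3"
    using be by (auto simp: bloch_expansion_def elim: eventually_mono)
  let ?p = "\<lambda>\<nu> z. u0 z + \<nu> * u1 z + \<nu>^2 * u2 z"
  let ?r = "\<lambda>\<nu> z. u \<nu> z - ?p \<nu> z"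
  obtain B where B: "\<forall>\<^sub>F \<nu> in im0. \<forall>j\<le>4. \<forall>x. norm ((D ^^ j) (?r \<nu>) x) \<le> B * norm \<nu> ^ 3"
    using be by (auto simp: bloch_expansion_def)
  have p: "?p \<nu> \<in> Cper 4" for \<nu> by (intro Cper_add Cper_cmult u)
  have r: "\<forall>\<^sub>F \<nu> in im0. ?r \<nu> \<in> Cper 4"
    using ev by eventually_elim (intro Cper_diff p, simp)
  have rO: "(\<lambda>\<nu>. (D ^^ n) (?r \<nu>) x) \<in> nuO 3" if "n \<le> 4" for n x
    by (rule bigoI[of _ B], use B in eventually_elim) (use that in \<open>auto simp: norm_power\<close>)
  have Dp: "(D ^^ n) (?p \<nu>) x = (D ^^ n) u0 x + \<nu> * (D ^^ n) u1 x + \<nu>^2 * (D ^^ n) u2 x" if "n \<le> 4" for n \<nu> x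
    using that u by (simp add: D_pow_add[where n=4] D_pow_cmult[where n=4] Cper_add Cper_cmult)
  have Du: "\<forall>\<^sub>F \<nu> in im0. \<forall>n\<le>4. \<forall>x. (D ^^ n) (u \<nu>) x = (D ^^ n) (?p \<nu>) x + (D ^^ n) (?r \<nu>) x"
    using r
  proof eventually_elim
    case (elim \<nu>)
    then show ?case using D_pow_add[OF p[of \<nu>] elim] by auto
  qed
  have bp: "bop \<delta> k s V j (?p \<nu>) x = bop \<delta> k s V j u0 x + \<nu> * bop \<delta> k s V j u1 x + \<nu>^2 * bop \<delta> k s V j u2 x" for j \<nu> x
    using u by (simp add: bop_add bop_cmult Cper_add Cper_cmult)
  have bu: "\<forall>\<^sub>F \<nu> in im0. \<forall>j x. bop \<delta> k s V j (u \<nu>) x = bop \<delta> k s V j (?p \<nu>) x + bop \<delta> k s V j (?r \<nu>) x"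
    using r
  proof eventually_elim
    case (elim \<nu>)
    then show ?case using bop_add[OF p[of \<nu>] elim] by auto
  qed
  have uO: "(\<lambda>\<nu>. (D ^^ n) (u \<nu>) x) \<in> nuO 0" if n: "n \<le> 4" for n x
  proof -
    have "(\<lambda>\<nu>. (D ^^ n) u0 x + \<nu>^1 * (D ^^ n) u1 x + \<nu>^2 * (D ^^ n) u2 x + (D ^^ n) (?r \<nu>) x) \<in> nuO 0"
      by (intro sum_in_bigo(1) bigo_im0_c bigo_im0_weaken[OF bigo_im0_shift[OF bigo_im0_c]]
          bigo_im0_weaken[OF rO[OF n]]) simp_all
    then show ?thesis
      by (rule landau_o.big.in_cong[THEN iffD2, rotated], use Du in eventually_elim)
        (use n Dp in simp)
  qed
  let ?A = "\<lambda>j i. bop \<delta> k s V j ([u0, u1, u2] ! i) x"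
  have eq: "\<forall>\<^sub>F \<nu> in im0. (?A 0 0 + \<nu> * ?A 0 1 + \<nu>^2 * ?A 0 2 + bop \<delta> k s V 0 (?r \<nu>) x)
      + \<nu> * (?A 1 0 + \<nu> * ?A 1 1 + \<nu>^2 * ?A 1 2 + bop \<delta> k s V 1 (?r \<nu>) x)
      + \<nu>^2 * (?A 2 0 + \<nu> * ?A 2 1 + \<nu>^2 * ?A 2 2 + bop \<delta> k s V 2 (?r \<nu>) x)
      + \<nu>^3 * bop \<delta> k s V 3 (u \<nu>) x + \<nu>^4 * bop \<delta> k s V 4 (u \<nu>) x + lam \<nu> * u \<nu> x = 0"
    using ev bu
  proof eventually_elim
    case (elim \<nu>)
    have "bop \<delta> k s V 0 (u \<nu>) x + \<nu> * bop \<delta> k s V 1 (u \<nu>) x + \<nu>^2 * bop \<delta> k s V 2 (u \<nu>) x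
      + \<nu>^3 * bop \<delta> k s V 3 (u \<nu>) x + \<nu>^4 * bop \<delta> k s V 4 (u \<nu>) x + lam \<nu> * u \<nu> x = 0"
    proof -
      have "bloch_op \<delta> k s V \<nu> (u \<nu>) x = - lam \<nu> * u \<nu> x" using elim by blast
      then have e: "bop \<delta> k s V 0 (u \<nu>) x + \<nu> * bop \<delta> k s V 1 (u \<nu>) x + \<nu>^2 * bop \<delta> k s V 2 (u \<nu>) x
          + \<nu>^3 * bop \<delta> k s V 3 (u \<nu>) x + \<nu>^4 * bop \<delta> k s V 4 (u \<nu>) x = - lam \<nu> * u \<nu> x"
        using bloch_op_bop[OF V, of "u \<nu>" \<delta> k s \<nu> x] elim by (metis (no_types))
      show ?thesis unfolding e by simp
    qed
    moreover have "bop \<delta> k s V j (u \<nu>) x = ?A j 0 + \<nu> * ?A j 1 + \<nu>^2 * ?A j 2 + bop \<delta> k s V j (?r \<nu>) x" for j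
      using elim bp[of j \<nu> x] by simp
    ultimately show ?case by simp
  qed
  have "(\<lambda>\<nu>. u \<nu> x - (u0 x + \<nu> * u1 x + \<nu>^2 * u2 x)) \<in> nuO 3" using rO[of 0 x] by simp
  moreover have "(\<lambda>\<nu>. u \<nu> x) \<in> nuO 0" using uO[of 0 x] by simp
  ultimately have "?A 0 0 = 0" "?A 0 1 + ?A 1 0 + l0 * u0 x = 0"
    "?A 0 2 + ?A 1 1 + ?A 2 0 + l0 * u1 x + l1 * u0 x = 0"
    using eigen_orders[OF eq bop_bigo[OF rO] bop_bigo[OF uO] bop_bigo[OF uO] lam] by blast+
  then show "bop \<delta> k s V 0 u0 x = 0" "bop \<delta> k s V 0 u1 x + bop \<delta> k s V 1 u0 x + l0 * u0 x = 0"
    "bop \<delta> k s V 0 u2 x + bop \<delta> k s V 1 u1 x + bop \<delta> k s V 2 u0 x + l0 * u1 x + l1 * u0 x = 0"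
    by simp_all
  assume a0: "avg u0 = 0" "avg (\<lambda>z. complex_of_real (6 * V z - s) * u0 z) = 0"
  let ?w = "\<lambda>f. avg (\<lambda>z. complex_of_real (6 * V z - s) * f z)"
  have cV: "continuous_on {0..1} V" by (rule Cper_cont[OF V])
  have cu: "continuous_on {0..1} u0" "continuous_on {0..1} u1" "continuous_on {0..1} u2"
    using u Cper_cont by blast+
  have meq: "\<forall>\<^sub>F \<nu> in im0. k * \<nu> * ?w (u \<nu>) + k^3 * \<nu>^3 * avg (u \<nu>)
      + \<delta> * (k^2 * \<nu>^2 * avg (u \<nu>) + k^4 * \<nu>^4 * avg (u \<nu>)) + lam \<nu> * avg (u \<nu>) = 0"
    using ev
  proof eventually_elim
    case (elim \<nu>)
    have "bloch_op \<delta> k s V \<nu> (u \<nu>) = (\<lambda>x. - lam \<nu> * u \<nu> x)" using elim by auto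
    then have "avg (bloch_op \<delta> k s V \<nu> (u \<nu>)) = - lam \<nu> * avg (u \<nu>)"
      using avg_cmult[of "u \<nu>" "- lam \<nu>"] elim Cper_cont by auto
    then show ?case using avg_bloch_op[OF V, of "u \<nu>" \<delta> k s \<nu>] elim by simp
  qed
  \<comment> \<open>A general continuous weight q, because two means have to be expanded: q = 1
    gives <u>, and q = 6 V - s gives the mean that comes from the potential.\<close>
  have bound: "(\<lambda>\<nu>. avg (\<lambda>z. q z * ?r \<nu> z)) \<in> nuO 3" if q: "continuous_on {0..1} q" for q
  proof -
    have "compact (q ` {0..1})" using q by (rule compact_continuous_image) simp
    then obtain C where C: "\<And>z. z \<in> {0..1} \<Longrightarrow> norm (q z) \<le> C"
      using compact_imp_bounded bounded_iff by (metis imageI)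
    have C0: "0 \<le> C" by (rule order_trans[OF norm_ge_zero C[of 0]]) simp
    show ?thesis
    proof (rule bigoI[of _ "C * B"], use B r in eventually_elim)
      case (elim \<nu>)
      have "norm (avg (\<lambda>z. q z * ?r \<nu> z)) \<le> C * (B * norm \<nu> ^ 3)"
      proof (rule avg_bound)
        show "continuous_on {0..1} (\<lambda>z. q z * ?r \<nu> z)"
          by (intro continuous_on_mult q Cper_cont[OF elim(2)])
        fix z :: real assume "z \<in> {0..1}"
        moreover have "norm (?r \<nu> z) \<le> B * norm \<nu> ^ 3" using elim(1) by (auto dest: spec[of _ 0])
        ultimately show "norm (q z * ?r \<nu> z) \<le> C * (B * norm \<nu> ^ 3)"
          using C C0 by (simp add: norm_mult mult_mono)
      qed
      then show ?case by (simp add: norm_power mult_ac)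
    qed
  qed
  have lin: "\<forall>\<^sub>F \<nu> in im0. avg (\<lambda>z. q z * u \<nu> z) - (avg (\<lambda>z. q z * u0 z) + \<nu> * avg (\<lambda>z. q z * u1 z)
      + \<nu>^2 * avg (\<lambda>z. q z * u2 z)) = avg (\<lambda>z. q z * ?r \<nu> z)" if q: "continuous_on {0..1} q" for q
    using ev
  proof eventually_elim
    case (elim \<nu>)
    have cn: "continuous_on {0..1} (u \<nu>)" using elim Cper_cont by blast
    have "avg (\<lambda>z. q z * ?r \<nu> z) = avg (\<lambda>z. q z * u \<nu> z - (q z * u0 z + \<nu> * (q z * u1 z) + \<nu>^2 * (q z * u2 z)))"
      by (simp add: algebra_simps)
    also have "\<dots> = avg (\<lambda>z. q z * u \<nu> z) - (avg (\<lambda>z. q z * u0 z) + \<nu> * avg (\<lambda>z. q z * u1 z)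
      + \<nu>^2 * avg (\<lambda>z. q z * u2 z))"
      using q cn cu by (simp add: avg_diff avg_add avg_cmult continuous_intros)
    finally show ?case by simp
  qed
  have qO: "(\<lambda>\<nu>. avg (\<lambda>z. q z * u \<nu> z) - (\<nu> * avg (\<lambda>z. q z * u1 z) + \<nu>^2 * avg (\<lambda>z. q z * u2 z))) \<in> nuO 3"
    if "continuous_on {0..1} q" "avg (\<lambda>z. q z * u0 z) = 0" for q
    by (rule landau_o.big.in_cong[THEN iffD2, OF _ bound[OF that(1)]], use lin[OF that(1)] in eventually_elim)
      (use that(2) in simp)
  have c1: "continuous_on {0..1} (\<lambda>z. complex_of_real (6 * V z - s))" by (intro continuous_intros cV)
  have mO: "(\<lambda>\<nu>. avg (u \<nu>) - (\<nu> * avg u1 + \<nu>^2 * avg u2)) \<in> nuO 3"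
    using qO[of "\<lambda>_. 1"] a0 by simp
  show "k * ?w u1 + l0 * avg u1 = 0" "k * ?w u2 + complex_of_real (\<delta> * k^2) * avg u1 + l0 * avg u2 + l1 * avg u1 = 0"
    using mean_orders[OF meq[unfolded of_real_power] qO[OF c1 a0(2)] mO lam] by simp_all
qed

subsection \<open>First and second order of the Bloch expansion\<close>

context waves
begin

abbreviation Lin :: "real \<Rightarrow> real \<Rightarrow> (real \<Rightarrow> 'a::real_normed_vector) \<Rightarrow> real \<Rightarrow> 'a" where
  "Lin k M \<equiv> Lop \<delta> k (c k M) (U k M)"

abbreviation "cU k M y \<equiv> complex_of_real (U k M y)"
abbreviation "cDU k M y \<equiv> complex_of_real (D (U k M) y)"
abbreviation "cUk k M y \<equiv> complex_of_real (Uk k M y)"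

text \<open>\<open>Uk\<close>, \<open>src_k\<close> and \<open>src_M\<close> are the coefficients of \<open>\<partial>\<^sub>T k\<close>, \<open>\<partial>\<^sub>X k\<close> and \<open>\<partial>\<^sub>X M\<close> in the equation
  for \<open>f\<close> in the Whitham system.\<close>

definition src_k :: "real \<Rightarrow> real \<Rightarrow> real \<Rightarrow> real" where
  "src_k k M y = 6 * (U k M y * Uk k M y - UUk k M) + 3 * (k^2 * D (D (Uk k M)) y + k * D (D (U k M)) y)
     + \<delta> * (D (U k M) y + 2 * k * D (Uk k M) y + 6 * k^2 * D (D (D (U k M))) y + 4 * k^3 * D (D (D (Uk k M))) y)"

definition src_M :: "real \<Rightarrow> real \<Rightarrow> real \<Rightarrow> real" where
  "src_M k M y = 6 * (U k M y - M)"

lemma src_M_Cper: "(k, M) \<in> \<Omega> \<Longrightarrow> src_M k M \<in> Cper n"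
  unfolding src_M_def[abs_def] by (intro Cper_cmult Cper_diff Cper_const U_Cper)

lemma avg_src_M: "(k, M) \<in> \<Omega> \<Longrightarrow> avg (src_M k M) = 0"
  unfolding src_M_def[abs_def] avg_mult_real
  by (subst avg_diff) (auto intro!: U_cont simp: avg_U)

text \<open>All terms other than the centred product of U and \<partial>_k U are derivatives of
  periodic functions. So this source has mean 0, the solvability condition of L.\<close>

lemma src_k_split:
  assumes o: "(k, M) \<in> \<Omega>"
  obtains G where "G \<in> Cper 1" "src_k k M = (\<lambda>y. 6 * (U k M y * Uk k M y - UUk k M) + D G y)"
proof -
  have a: "U k M \<in> Cper n" "D (U k M) \<in> Cper n" "D (D (U k M)) \<in> Cper n" "D (D (D (U k M))) \<in> Cper n"
    "Uk k M \<in> Cper n" "D (Uk k M) \<in> Cper n" "D (D (Uk k M)) \<in> Cper n" "D (D (D (Uk k M))) \<in> Cper n" for n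
    by (intro Cper_D U_Cper Uk_Cper o)+
  note d = Cper_Suc_D[OF a(1)] Cper_Suc_D[OF a(2)] Cper_Suc_D[OF a(3)]
    Cper_Suc_D[OF a(5)] Cper_Suc_D[OF a(6)] Cper_Suc_D[OF a(7)]
  have m: "((\<lambda>x. a * g x) has_vector_derivative a * g') (at x)"
    if "(g has_vector_derivative g') (at x)" for a :: real and g g' x
    using bounded_linear.has_vector_derivative[OF bl_cmult that] .
  let ?G = "\<lambda>y. 3 * (k^2 * D (Uk k M) y + k * D (U k M) y)
     + \<delta> * (U k M y + 2 * k * Uk k M y + 6 * k^2 * D (D (U k M)) y + 4 * k^3 * D (D (Uk k M)) y)"
  have "D ?G = (\<lambda>y. 3 * (k^2 * D (D (Uk k M)) y + k * D (D (U k M)) y)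
     + \<delta> * (D (U k M) y + 2 * k * D (Uk k M) y + 6 * k^2 * D (D (D (U k M))) y + 4 * k^3 * D (D (D (Uk k M))) y))"
    by (intro ext D_eqI has_vector_derivative_add m d)
  then have "src_k k M = (\<lambda>y. 6 * (U k M y * Uk k M y - UUk k M) + D ?G y)"
    by (auto simp: src_k_def algebra_simps)
  moreover have "?G \<in> Cper 1"
    by (intro Cper_add Cper_cmult a)
  ultimately show ?thesis using that by blast
qed

lemma src_k_Cper: assumes o: "(k, M) \<in> \<Omega>" shows "src_k k M \<in> Cper 0"
proof -
  obtain G where G: "G \<in> Cper 1" "src_k k M = (\<lambda>y. 6 * (U k M y * Uk k M y - UUk k M) + D G y)"
    using src_k_split[OF o] .
  have "D G \<in> Cper 0" using Cper_D[of G 0] G(1) by simp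
  then show ?thesis
    unfolding G(2) by (intro Cper_add Cper_cmult Cper_diff Cper_mult Cper_const U_Cper Uk_Cper o)
qed

lemma avg_src_k: assumes o: "(k, M) \<in> \<Omega>" shows "avg (src_k k M) = 0"
proof -
  obtain G where G: "G \<in> Cper 1" "src_k k M = (\<lambda>y. 6 * (U k M y * Uk k M y - UUk k M) + D G y)"
    using src_k_split[OF o] .
  have c: "continuous_on {0..1} (D G)" using Cper_D[of G 0] G(1) Cper_cont[of "D G" 0] by simp
  have c2: "continuous_on {0..1} (\<lambda>y. U k M y * Uk k M y)" by (intro continuous_intros U_cont Uk_cont o)
  have "avg (src_k k M) = avg (\<lambda>y. 6 * (U k M y * Uk k M y - UUk k M)) + avg (D G)"
    unfolding G(2) using c U_cont[OF o] Uk_cont[OF o] by (intro avg_add continuous_intros)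
  also have "avg (D G) = 0" using avg_D[OF G(1)] .
  also have "avg (\<lambda>y. 6 * (U k M y * Uk k M y - UUk k M)) = 0"
    unfolding avg_mult_real using c2 by (subst avg_diff) (auto simp: UUk_def)
  finally show ?thesis by simp
qed

text \<open>The factor l0 - c is \<partial>_t - c \<partial>_x acting on a plane wave at leading
  order, divided by \<nu> k. So v^k joins the coefficients of \<partial>_T k and of \<partial>_X k
  in the equation for the Whitham corrector.\<close>

lemma vk_eq:
  assumes o: "(k, M) \<in> \<Omega>"
  shows "vk \<delta> U c k M l0 y = (l0 - complex_of_real (c k M)) * cUk k M y + complex_of_real (src_k k M y)"
proof -
  have "(D ^^ 2) (\<lambda>z. U k M z + k * Uk k M z) y = (D ^^ 2) (U k M) y + k * (D ^^ 2) (Uk k M) y"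
    using D_pow_add[of "U k M" 2 "\<lambda>z. k * Uk k M z" 2] D_pow_cmult[of "Uk k M" 2 2 k]
      U_Cper[OF o, of 2] Uk_Cper[OF o, of 2] Cper_cmult[of "Uk k M" 2 k] by simp
  then show ?thesis
    unfolding vk_def Let_def dk_Q[OF o]
    by (simp add: src_k_def D_numeral algebra_simps power2_eq_square)
qed

lemma vM_eq: "(k, M) \<in> \<Omega> \<Longrightarrow> vM U c k M l0 y = complex_of_real (src_M k M y)"
  by (simp add: vM_def dk_Q src_M_def)

lemma vk_Cper: assumes o: "(k, M) \<in> \<Omega>" shows "vk \<delta> U c k M l0 \<in> Cper 0"
  unfolding vk_eq[OF o, abs_def] using o by (intro Cper_add Cper_cmult Cper_of_real Uk_Cper src_k_Cper)

lemma vM_Cper: assumes o: "(k, M) \<in> \<Omega>" shows "vM U c k M l0 \<in> Cper 0"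
  unfolding vM_eq[OF o, abs_def] using o by (intro Cper_of_real src_M_Cper)

lemma avg_vk: "(k, M) \<in> \<Omega> \<Longrightarrow> avg (vk \<delta> U c k M l0) = 0"
proof -
  assume o: "(k, M) \<in> \<Omega>"
  note cc = Uk_cont[OF o, of "{0..1}"] Cper_cont[OF src_k_Cper[OF o], of "{0..1}"]
  show ?thesis
    unfolding vk_eq[OF o, abs_def]
    using cc by (simp add: avg_add avg_cmult avg_of_real continuous_intros avg_Uk[OF o] avg_src_k[OF o])
qed

lemma avg_vM: assumes o: "(k, M) \<in> \<Omega>" shows "avg (vM U c k M l0) = 0"
  unfolding vM_eq[OF o, abs_def]
  using Cper_cont[OF src_M_Cper[OF o, of 0]] by (subst avg_of_real) (auto simp: avg_src_M[OF o])

lemma avg_pot: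
  assumes "continuous_on {0..1} V" "continuous_on {0..1} f"
  shows "avg (\<lambda>z. complex_of_real (6 * V z - s) * f z)
     = 6 * avg (\<lambda>z. complex_of_real (V z) * f z) - complex_of_real s * avg f"
proof -
  have "avg (\<lambda>z. complex_of_real (6 * V z - s) * f z)
    = avg (\<lambda>z. 6 * (complex_of_real (V z) * f z) - complex_of_real s * f z)"
    by (simp add: algebra_simps)
  also have "\<dots> = 6 * avg (\<lambda>z. complex_of_real (V z) * f z) - complex_of_real s * avg f"
    using assms by (simp add: avg_diff avg_cmult continuous_intros)
  finally show ?thesis .
qed

lemma avg_DU: "(k, M) \<in> \<Omega> \<Longrightarrow> avg (D (U k M)) = 0"
  by (rule avg_D[OF U_Cper])

lemma avg_U_DU: assumes o: "(k, M) \<in> \<Omega>" shows "avg (\<lambda>y. U k M y * D (U k M) y) = 0"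
proof -
  have "(\<lambda>y. U k M y * U k M y) \<in> Cper 1" by (intro Cper_mult U_Cper o)
  from avg_D[OF this] have "avg (D (\<lambda>y. U k M y * U k M y)) = 0" .
  also have "D (\<lambda>y. U k M y * U k M y) = (\<lambda>y. 2 * (U k M y * D (U k M) y))"
    using has_vector_derivative_mult[OF Cper_Suc_D[OF U_Cper[OF o]] Cper_Suc_D[OF U_Cper[OF o]]]
    by (auto intro!: ext D_eqI)
  finally show ?thesis by (simp add: avg_mult_real)
qed

text \<open>The shape of u1, and of u2 once the correctors are added back. The coefficient a of U'
  is invisible in both averages because <U'> = <U U'> = 0, and <\<partial>_k U> = 0 lets the mean
  detect B alone.\<close>

lemma avg_affine:
  fixes a b B :: complex
  assumes o: "(k, M) \<in> \<Omega>" and f: "f = (\<lambda>y. b * cUk k M y + B + a * cDU k M y)"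
  shows "avg f = B" "avg (\<lambda>z. cU k M z * f z) = b * UUk k M + B * M"
proof -
  have c: "continuous_on {0..1} (U k M)" "continuous_on {0..1} (Uk k M)" "continuous_on {0..1} (D (U k M))"
    using U_cont[OF o] Uk_cont[OF o] Cper_cont[OF Cper_D[OF U_Cper[OF o]]] by auto
  show "avg f = B"
    unfolding f using c
    by (simp add: avg_add avg_cmult avg_of_real continuous_intros avg_Uk[OF o] avg_DU[OF o])
  have 1: "avg (\<lambda>z. cU k M z * cDU k M z) = 0"
    using avg_of_real[of "\<lambda>z. U k M z * D (U k M) z", where 'a=complex] avg_U_DU[OF o] c
    by (simp add: continuous_intros)
  have 2: "avg (\<lambda>z. cU k M z * cUk k M z) = UUk k M"
    using avg_of_real[of "\<lambda>z. U k M z * Uk k M z", where 'a=complex] c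
    by (simp add: continuous_intros UUk_def)
  have 3: "avg (cU k M) = M"
    using c by (simp add: avg_of_real avg_U[OF o])
  have "avg (\<lambda>z. cU k M z * f z)
    = avg (\<lambda>z. b * (cU k M z * cUk k M z) + B * cU k M z + a * (cU k M z * cDU k M z))"
    by (simp add: f algebra_simps)
  also have "\<dots> = b * UUk k M + B * M"
    using c by (simp only: avg_add avg_cmult 1 2 3 continuous_intros continuous_on_of_real) simp
  finally show "avg (\<lambda>z. cU k M z * f z) = b * UUk k M + B * M" .
qed

lemma dpar_U: "(k, M) \<in> \<Omega> \<Longrightarrow> dpar (\<lambda>k M. U k M y) k M (a::complex) b = cUk k M y * a + b"
  by (simp add: dpar_def U_M scaleR_conv_of_real)

lemma dpar_c: "(k, M) \<in> \<Omega> \<Longrightarrow> dpar c k M a b = dk c k M *\<^sub>R a + 6 *\<^sub>R b"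
  by (simp add: dpar_def c_M)

lemma solve_vk_vM:
  assumes o: "(k, M) \<in> \<Omega>"
  shows "\<exists>!f. f \<in> Cper 4 \<and> avg (\<lambda>y. f y * cDU k M y) = 0 \<and>
      (\<forall>y. Lin k M f y = complex_of_real k * vk \<delta> U c k M l0 y)"
    "\<exists>!f. f \<in> Cper 4 \<and> avg (\<lambda>y. f y * cDU k M y) = 0 \<and>
      (\<forall>y. Lin k M f y = complex_of_real k * vM U c k M l0 y)"
proof -
  interpret wave_op \<delta> k "c k M" "U k M" by (rule wave_op[OF o])
  show "\<exists>!f. f \<in> Cper 4 \<and> avg (\<lambda>y. f y * cDU k M y) = 0 \<and>
      (\<forall>y. Lin k M f y = complex_of_real k * vk \<delta> U c k M l0 y)"
    using Lop_ex1[of "\<lambda>y. complex_of_real k * vk \<delta> U c k M l0 y"] vk_Cper[OF o] avg_vk[OF o] Cper_cont[OF vk_Cper[OF o]]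
    by (simp add: Cper_cmult avg_cmult mult.commute[of _ "complex_of_real (D _ _)"])
  show "\<exists>!f. f \<in> Cper 4 \<and> avg (\<lambda>y. f y * cDU k M y) = 0 \<and>
      (\<forall>y. Lin k M f y = complex_of_real k * vM U c k M l0 y)"
    using Lop_ex1[of "\<lambda>y. complex_of_real k * vM U c k M l0 y"] vM_Cper[OF o] avg_vM[OF o] Cper_cont[OF vM_Cper[OF o]]
    by (simp add: Cper_cmult avg_cmult mult.commute[of _ "complex_of_real (D _ _)"])
qed

text \<open>\<open>\<L> 1 = 6 k U'\<close> absorbs the multiples of \<open>U'\<close> into a constant.\<close>

lemma Lop_affine_zero:
  assumes o: "(k, M) \<in> \<Omega>" and f: "f \<in> Cper 4"
    and L: "\<And>y. Lin k M f y = b * complex_of_real (Lin k M (Uk k M) y)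
        + 6 * complex_of_real k * B * cDU k M y"
  obtains a where "f = (\<lambda>y. b * cUk k M y + B + a * cDU k M y)" "avg f = B"
proof -
  interpret wave_op \<delta> k "c k M" "U k M" by (rule wave_op[OF o])
  let ?g = "\<lambda>y. b * cUk k M y + B"
  have W: "(cUk k M) \<in> Cper 4" by (intro Cper_of_real Uk_Cper o)
  have g: "?g \<in> Cper 4" by (intro Cper_add Cper_cmult W Cper_const)
  have "Lin k M ?g y = Lin k M f y" for y
    unfolding L using W
    by (simp add: Lop_add[OF V1] Lop_cmult[OF V1] Lop_of_real[OF V1] Lop_const[OF V1] Cper_cmult Uk_Cper[OF o]
        scaleR_conv_of_real)
  then have "Lin k M (\<lambda>y. f y - ?g y) y = 0" for y
    by (simp add: Lop_diff[OF V1 f g])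
  then obtain a where a: "(\<lambda>y. f y - ?g y) = (\<lambda>y. a * cDU k M y)"
    using Lop_zero[OF Cper_diff[OF f g]] by blast
  have e: "f = (\<lambda>y. b * cUk k M y + B + a * cDU k M y)"
    using fun_cong[OF a] by (auto simp: algebra_simps)
  moreover have "avg f = B" by (rule avg_affine(1)[OF o e])
  ultimately show ?thesis using that by blast
qed

text \<open>The coefficient of \<nu> in the Bloch operator, applied to U', is k times the derivative
  of the profile equation in its explicit powers of k (with c frozen). \<open>Lop_Uk\<close>
  expresses the latter through L[\<partial>_k U] and \<partial>_k c.\<close>

lemma bop_DU:
  assumes o: "(k, M) \<in> \<Omega>"
  shows "bop \<delta> k (c k M) (U k M) 1 (cDU k M) y
      = complex_of_real (k^2 * dk c k M * D (U k M) y - k * Lin k M (Uk k M) y)"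
proof -
  have "D (U k M) \<in> Cper 4" by (intro Cper_D U_Cper o)
  then show ?thesis
    by (simp add: bop_of_real sum_le_4 bcoef_def D_numeral Lop_Uk[OF o] del: of_real_mult of_real_add of_real_diff of_real_power)
      (simp add: algebra_simps power2_eq_square power3_eq_cube power4_eq_xxxx)
qed

text \<open>The origin of v^k: it collects the terms of order \<nu>^2 that are proportional to k0.
  The constant on the right is the mean 6 <U \<partial>_k U> removed in v^k; the first order
  relation for M cancels it later.\<close>

lemma bop_Uk:
  assumes o: "(k, M) \<in> \<Omega>"
  shows "complex_of_real k * bop \<delta> k (c k M) (U k M) 1 (cUk k M) y
      + bop \<delta> k (c k M) (U k M) 2 (cDU k M) y
      + complex_of_real (k^2) * l0 * cUk k M y
    = complex_of_real (k^2) * vk \<delta> U c k M l0 y + complex_of_real (6 * k^2 * UUk k M)"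
proof -
  have d: "D (U k M) \<in> Cper 4" "Uk k M \<in> Cper 4" by (intro Cper_D U_Cper Uk_Cper o)+
  have "k * (\<Sum>n\<le>4. bcoef \<delta> k (c k M) (U k M y) (D (U k M) y) 1 n * (D ^^ n) (Uk k M) y)
     + (\<Sum>n\<le>4. bcoef \<delta> k (c k M) (U k M y) (D (U k M) y) 2 n * (D ^^ n) (D (U k M)) y)
     = k^2 * (- c k M * Uk k M y + src_k k M y) + 6 * k^2 * UUk k M"
    by (simp add: sum_le_4 bcoef_def D_numeral src_k_def algebra_simps
        power2_eq_square power3_eq_cube power4_eq_xxxx)
  from arg_cong[OF this, of complex_of_real] show ?thesis
    by (simp add: bop_of_real d vk_eq[OF o] algebra_simps)
qed
end

section \<open>The relations of first and second order from the eigenvalue equation\<close>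

context waves
begin

lemma bloch_mean_orders:
  fixes l0 l1 :: complex and u0 u1 u2 :: "real \<Rightarrow> complex"
  assumes o: "(k, M) \<in> \<Omega>" and be: "bloch_expansion \<delta> k (c k M) (U k M) lam u l0 l1 u0 u1 u2"
    and u0: "u0 = (\<lambda>y. a0 * cDU k M y)"
  shows "k * (6 * avg (\<lambda>z. cU k M z * u1 z) - c k M * avg u1) + l0 * avg u1 = 0"
    "k * (6 * avg (\<lambda>z. cU k M z * u2 z) - c k M * avg u2) + complex_of_real (\<delta> * k^2) * avg u1
      + l0 * avg u2 + l1 * avg u1 = 0"
proof -
  interpret wave_op \<delta> k "c k M" "U k M" by (rule wave_op[OF o])
  have "u0 = (\<lambda>y. 0 * cUk k M y + 0 + a0 * cDU k M y)" unfolding u0 by simp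
  note z = avg_affine[OF o this]
  have u: "u0 \<in> Cper 4" "u1 \<in> Cper 4" "u2 \<in> Cper 4" using be by (auto simp: bloch_expansion_def)
  note pot = avg_pot[OF U_cont[OF o] Cper_cont[OF u(1)]] avg_pot[OF U_cont[OF o] Cper_cont[OF u(2)]]
    avg_pot[OF U_cont[OF o] Cper_cont[OF u(3)]]
  have "avg (\<lambda>z. complex_of_real (6 * U k M z - c k M) * u0 z) = 0"
    unfolding pot(1) z by simp
  from bloch_orders(4,5)[OF V1 be z(1) this]
  show "k * (6 * avg (\<lambda>z. cU k M z * u1 z) - c k M * avg u1) + l0 * avg u1 = 0"
    "k * (6 * avg (\<lambda>z. cU k M z * u2 z) - c k M * avg u2) + complex_of_real (\<delta> * k^2) * avg u1
      + l0 * avg u2 + l1 * avg u1 = 0"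
    unfolding pot(2,3) by simp_all
qed

text \<open>Formulated with the unscaled l0 and with the coefficients a0 = k0 / k and a1 = k1 / k of
  U'; thus a0 k stands for k0.\<close>

lemma bloch_first_order:
  fixes l0 l1 :: complex and u0 u1 u2 :: "real \<Rightarrow> complex"
  assumes o: "(k, M) \<in> \<Omega>" and be: "bloch_expansion \<delta> k (c k M) (U k M) lam u l0 l1 u0 u1 u2"
  obtains a0 a1 :: complex where "u0 = (\<lambda>y. a0 * cDU k M y)"
    "u1 = (\<lambda>y. (a0 * k) * cUk k M y + avg u1 + a1 * cDU k M y)"
    "l0 * a0 + complex_of_real (k^2 * dk c k M) * a0 + complex_of_real (6 * k) * avg u1 = 0"
    "(l0 - complex_of_real (k * c k M)) * avg u1 + complex_of_real (6 * k * UUk k M) * (a0 * k) + complex_of_real (6 * k * M) * avg u1 = 0"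
proof -
  interpret wave_op \<delta> k "c k M" "U k M" by (rule wave_op[OF o])
  have k: "k \<noteq> 0" using k_pos[OF o] by simp
  have u: "u0 \<in> Cper 4" "u1 \<in> Cper 4" "u2 \<in> Cper 4" using be by (auto simp: bloch_expansion_def)
  have dU: "(cDU k M) \<in> Cper 4" by (intro Cper_of_real DV(1))
  note ord = bloch_orders[OF V1 be]
  have "Lin k M u0 y = 0" for y
    using ord(1)[of y] by (simp add: Lop_bop[OF V1 u(1)])
  then obtain a0 where u0: "u0 = (\<lambda>y. a0 * cDU k M y)"
    using Lop_zero[OF u(1)] by blast
  \<comment> \<open>Forced by the order \<nu>: after a0 k L[\<partial>_k U] is split off, what is
    left is a multiple of U', and L[1] = 6 k U' represents it as the image of the constant
    \<open>?B\<close>.\<close>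
  let ?B = "- (l0 * a0 + complex_of_real (k^2 * dk c k M) * a0) / (6 * complex_of_real k)"
  have kB: "6 * complex_of_real k * ?B = - (l0 * a0 + complex_of_real (k^2 * dk c k M) * a0)"
    using k by simp
  have "Lin k M u1 y = (a0 * k) * complex_of_real (Lin k M (Uk k M) y)
        + 6 * complex_of_real k * ?B * cDU k M y" for y
  proof -
    have "Lin k M u1 y
      = - (bop \<delta> k (c k M) (U k M) 1 u0 y + l0 * u0 y)"
      using ord(2)[of y] unfolding Lop_bop[OF V1 u(2)] by (metis (no_types) add.assoc eq_neg_iff_add_eq_0)
    also have "bop \<delta> k (c k M) (U k M) 1 u0 y
      = a0 * complex_of_real (k^2 * dk c k M * D (U k M) y - k * Lin k M (Uk k M) y)"
      unfolding u0 bop_cmult[OF dU] bop_DU[OF o] ..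
    finally show ?thesis unfolding kB u0 by (simp add: algebra_simps power2_eq_square)
  qed
  then obtain a1 where u1: "u1 = (\<lambda>y. (a0 * k) * cUk k M y + ?B + a1 * cDU k M y)"
    and B: "avg u1 = ?B"
    by (rule Lop_affine_zero[OF o u(2)])
  have W: "avg (\<lambda>z. cU k M z * u1 z) = (a0 * k) * UUk k M + avg u1 * M"
    using avg_affine(2)[OF o u1] unfolding B .
  show ?thesis
  proof (rule that[OF u0])
    show "u1 = (\<lambda>y. (a0 * k) * cUk k M y + avg u1 + a1 * cDU k M y)"
      using u1 B by simp
    show "l0 * a0 + complex_of_real (k^2 * dk c k M) * a0 + complex_of_real (6 * k) * avg u1 = 0"
      using B k by (simp add: field_simps)
    show "(l0 - complex_of_real (k * c k M)) * avg u1 + complex_of_real (6 * k * UUk k M) * (a0 * k) + complex_of_real (6 * k * M) * avg u1 = 0"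
      using bloch_mean_orders(1)[OF o be u0] unfolding W by (simp add: algebra_simps)
  qed
qed

text \<open>The hypothesis \<open>rM\<close> is the solvability condition at order \<nu>^2: once k
  v^k and k v^M are split off with their coefficients, the left-hand side of \<open>rM\<close> is
  the constant that remains in the source.\<close>

lemma bloch_second_order:
  fixes l0 l1 a0 a1 M0 :: complex and u0 u1 u2 fk fM :: "real \<Rightarrow> complex"
  assumes o: "(k, M) \<in> \<Omega>" and be: "bloch_expansion \<delta> k (c k M) (U k M) lam u l0 l1 u0 u1 u2"
    and u0: "u0 = (\<lambda>y. a0 * cDU k M y)"
    and u1: "u1 = (\<lambda>y. (a0 * k) * cUk k M y + M0 + a1 * cDU k M y)"
    and rM: "(l0 - complex_of_real (k * c k M)) * M0 + complex_of_real (6 * k * UUk k M) * (a0 * k) + complex_of_real (6 * k * M) * M0 = 0"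
    and fk: "fk \<in> Cper 4" "\<And>y. Lin k M fk y = complex_of_real k * vk \<delta> U c k M (l0 / k) y"
    and fM: "fM \<in> Cper 4" "\<And>y. Lin k M fM y = complex_of_real k * vM U c k M (l0 / k) y"
  obtains a2 :: complex where "u2 = (\<lambda>y. (a1 * k) * cUk k M y + avg u2 + (a0 * k) * (avg fk - fk y)
        + M0 * (avg fM - fM y) + a2 * cDU k M y)"
    "l1 * a0 + l0 * a1 + complex_of_real (k^2 * dk c k M) * a1 + complex_of_real (6 * k) * (avg u2 + (a0 * k) * avg fk + M0 * avg fM) = 0"
    "(l0 - complex_of_real (k * c k M)) * avg u2 + l1 * M0 + complex_of_real (6 * k * UUk k M) * (a1 * k) + complex_of_real (6 * k * M) * avg u2
      = complex_of_real (- \<delta> * k^2) * M0 + complex_of_real (6 * k) * (a0 * k) * (avg (\<lambda>y. cU k M y * fk y) - complex_of_real M * avg fk)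
        + complex_of_real (6 * k) * M0 * (avg (\<lambda>y. cU k M y * fM y) - complex_of_real M * avg fM)"
proof -
  interpret wave_op \<delta> k "c k M" "U k M" by (rule wave_op[OF o])
  have k: "k \<noteq> 0" using k_pos[OF o] by simp
  have u: "u0 \<in> Cper 4" "u1 \<in> Cper 4" "u2 \<in> Cper 4" using be by (auto simp: bloch_expansion_def)
  have dU: "(cDU k M) \<in> Cper 4" by (intro Cper_of_real DV(1))
  have W: "(cUk k M) \<in> Cper 4" by (intro Cper_of_real Uk_Cper o)
  note ord = bloch_orders[OF V1 be]
  \<comment> \<open>Adding the correctors back removes v^k and v^M from the equation for u2, so that
    \<open>?w\<close> satisfies an equation of the same kind as u1.\<close>
  let ?w = "\<lambda>y. u2 y + ((a0 * k) * fk y + M0 * fM y)"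
  let ?B = "- (l1 * a0 + l0 * a1 + complex_of_real (k^2 * dk c k M) * a1) / (6 * complex_of_real k)"
  have kB: "6 * complex_of_real k * ?B = - (l1 * a0 + l0 * a1 + complex_of_real (k^2 * dk c k M) * a1)"
    using k by simp
  have w: "?w \<in> Cper 4" by (intro Cper_add Cper_cmult u fk fM)
  have "Lin k M ?w y = (a1 * k) * complex_of_real (Lin k M (Uk k M) y)
        + 6 * complex_of_real k * ?B * cDU k M y" for y
  proof -
    let ?b1 = "bop \<delta> k (c k M) (U k M) 1 (cUk k M) y"
      and ?b2 = "bop \<delta> k (c k M) (U k M) 2 (cDU k M) y"
      and ?L = "complex_of_real (Lin k M (Uk k M) y)"
      and ?vk = "vk \<delta> U c k M (l0 / k) y" and ?vM = "vM U c k M (l0 / k) y"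
      and ?dU = "cDU k M y" and ?W = "cUk k M y"
      and ?V = "cU k M y"
    have b1: "bop \<delta> k (c k M) (U k M) 1 u1 y = (a0 * k) * ?b1 + k * (6 * ?V - c k M) * M0
        + a1 * (k^2 * dk c k M * ?dU - k * ?L)"
      unfolding u1 using W dU bop_DU[OF o, of y]
      by (simp add: bop_add bop_cmult bop_const Cper_add Cper_cmult bcoef_def)
    have b2: "bop \<delta> k (c k M) (U k M) 2 u0 y = a0 * ?b2"
      unfolding u0 using dU by (simp add: bop_cmult)
    have L2: "Lin k M u2 y = - (bop \<delta> k (c k M) (U k M) 1 u1 y
        + bop \<delta> k (c k M) (U k M) 2 u0 y + l0 * u1 y + l1 * u0 y)"
      using ord(3)[of y] unfolding Lop_bop[OF V1 u(3)] by (metis (no_types) add.assoc eq_neg_iff_add_eq_0)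
    have bW: "k * ?b1 + ?b2 + k^2 * (l0 / k) * ?W = k^2 * ?vk + 6 * k^2 * UUk k M"
      using bop_Uk[OF o, of y "l0 / k"] by simp
    have u1y: "u1 y = (a0 * k) * ?W + M0 + a1 * ?dU" and u0y: "u0 y = a0 * ?dU" by (simp_all add: u1 u0)
    have Lw: "Lin k M ?w y = Lin k M u2 y + (a0 * k) * (k * ?vk) + M0 * (k * ?vM)"
      using u fk fM by (simp add: Lop_add[OF V1] Lop_cmult[OF V1] Cper_add Cper_cmult)
    have vM': "?vM = 6 * (?V - M)" by (simp add: vM_eq[OF o] src_M_def)
    have b2': "?b2 = k^2 * ?vk + 6 * k^2 * UUk k M - k * ?b1 - k * l0 * ?W"
      using bW k by (simp add: field_simps power2_eq_square)
    \<comment> \<open>The terms constant in y, from the mean removed in v^k, the mean removed in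
      v^M, and the constant M0 in u1, combine to the left-hand side of \<open>rM\<close>.\<close>
    have "Lin k M ?w y = (a1 * k) * ?L - (l1 * a0 + l0 * a1 + complex_of_real (k^2 * dk c k M) * a1) * ?dU
       - ((l0 - complex_of_real (k * c k M)) * M0 + complex_of_real (6 * k * UUk k M) * (a0 * k) + complex_of_real (6 * k * M) * M0)"
      unfolding Lw L2 b1 b2 unfolding b2' vM' u1y u0y by (simp add: algebra_simps power2_eq_square)
    then show ?thesis unfolding rM kB by (simp add: algebra_simps)
  qed
  then obtain a2 where a2: "?w = (\<lambda>y. (a1 * k) * cUk k M y + ?B + a2 * cDU k M y)"
    and B: "avg ?w = ?B"
    by (rule Lop_affine_zero[OF o w])
  have c: "continuous_on {0..1} (U k M)" using U_cont[OF o] by auto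
  have cf: "continuous_on {0..1} u2" "continuous_on {0..1} fk" "continuous_on {0..1} fM"
    using Cper_cont u fk fM by blast+
  have B': "?B = avg u2 + (a0 * k * avg fk + M0 * avg fM)"
    unfolding B[symmetric] using cf by (simp add: avg_add avg_cmult continuous_intros)
  have u2: "u2 = (\<lambda>y. (a1 * k) * cUk k M y + avg u2 + (a0 * k) * (avg fk - fk y)
        + M0 * (avg fM - fM y) + a2 * cDU k M y)"
    using fun_cong[OF a2] unfolding B' by (auto simp: algebra_simps)
  have M0: "avg u1 = M0" by (rule avg_affine(1)[OF o u1])
  let ?P = "\<lambda>f. avg (\<lambda>z. cU k M z * f z)"
  have P1: "?P ?w = (a1 * k) * UUk k M + ?B * M" by (rule avg_affine(2)[OF o a2])
  have "?P ?w = avg (\<lambda>z. cU k M z * u2 z + ((a0 * k) * (cU k M z * fk z)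
      + M0 * (cU k M z * fM z)))"
    by (simp add: algebra_simps)
  also have "\<dots> = ?P u2 + ((a0 * k) * ?P fk + M0 * ?P fM)"
    using c cf by (simp add: avg_add avg_cmult continuous_intros)
  \<comment> \<open>The average at order \<nu>^3 contains <U u2>. Pairing \<open>?w\<close> with U
    replaces it by averages of the correctors.\<close>
  finally have P2: "?P u2 = (a1 * k) * UUk k M + (avg u2 + (a0 * k * avg fk + M0 * avg fM)) * M
      - ((a0 * k) * ?P fk + M0 * ?P fM)"
    using P1 unfolding B' by (simp add: algebra_simps)
  have m': "k * (6 * ?P u2 - c k M * avg u2) + \<delta> * k^2 * M0 + l0 * avg u2 + l1 * M0 = 0"
    using bloch_mean_orders(2)[OF o be u0] by (simp add: M0)
  show ?thesis
  proof (rule that[OF u2])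
    show "l1 * a0 + l0 * a1 + complex_of_real (k^2 * dk c k M) * a1 + complex_of_real (6 * k) * (avg u2 + (a0 * k) * avg fk + M0 * avg fM) = 0"
      using kB[unfolded B'] by (simp only: of_real_mult of_real_numeral) algebra
    show "(l0 - complex_of_real (k * c k M)) * avg u2 + l1 * M0 + complex_of_real (6 * k * UUk k M) * (a1 * k) + complex_of_real (6 * k * M) * avg u2
      = complex_of_real (- \<delta> * k^2) * M0 + complex_of_real (6 * k) * (a0 * k) * (?P fk - complex_of_real M * avg fk) + complex_of_real (6 * k) * M0 * (?P fM - complex_of_real M * avg fM)"
      using m' unfolding P2 by (simp add: algebra_simps)
  qed
qed

lemma avg_U_centred:
  assumes o: "(k, M) \<in> \<Omega>" and f: "f \<in> Cper n"
  shows "avg (\<lambda>y. complex_of_real (6 * U k M y) * (f y - avg f))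
    = 6 * (avg (\<lambda>y. cU k M y * f y) - complex_of_real M * avg f)"
proof -
  have c: "continuous_on {0..1} (U k M)" "continuous_on {0..1} f" using U_cont[OF o] Cper_cont[OF f] by auto
  have "avg (\<lambda>y. complex_of_real (6 * U k M y) * (f y - avg f))
    = avg (\<lambda>y. 6 * (cU k M y * f y - avg f * cU k M y))"
    by (simp add: algebra_simps)
  also have "\<dots> = 6 * (avg (\<lambda>y. cU k M y * f y) - avg f * avg (cU k M))"
    using c by (simp add: avg_diff avg_cmult continuous_intros)
  finally show ?thesis using c by (simp add: avg_of_real avg_U[OF o])
qed

text \<open>Passes to the scaled unknowns k0 = k a0 and k1 = k a1. The relations for M come out
  multiplied by k, which is cancelled since k > 0.\<close>

lemma bloch_expansion_relations:
  fixes l0 l1 :: complex and u0 u1 u2 :: "real \<Rightarrow> complex"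
  assumes o: "(k, M) \<in> \<Omega>" and be: "bloch_expansion \<delta> k (c k M) (U k M) lam u l0 l1 u0 u1 u2"
  shows "\<exists>k0 k1.
      (\<forall>y. u0 y = k0 / complex_of_real k * cDU k M y) \<and>
      (\<forall>y. u1 y = dpar (\<lambda>k M. U k M y) k M k0 (avg u1) + k1 / complex_of_real k * cDU k M y) \<and>
      rel1_k c k M (l0 / k) k0 (avg u1) = 0 \<and>
      rel1_M U c k M (l0 / k) k0 (avg u1) = 0 \<and>
      (\<forall>fk\<in>Cper 4. \<forall>fM\<in>Cper 4.
        (\<forall>y. Lin k M fk y = complex_of_real k * vk \<delta> U c k M (l0 / k) y) \<longrightarrow>
        (\<forall>y. Lin k M fM y = complex_of_real k * vM U c k M (l0 / k) y) \<longrightarrow>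
         (\<exists>k2. \<forall>y. u2 y = dpar (\<lambda>k M. U k M y) k M k1 (avg u2) + k0 * (avg fk - fk y) + avg u1 * (avg fM - fM y)
                          + k2 / complex_of_real k * cDU k M y) \<and>
         rel2_k c k M (l0 / k) (l1 / k) k0 (avg u1) k1 (avg u2) fk fM = 0 \<and>
         rel2_M \<delta> U c k M (l0 / k) (l1 / k) k0 (avg u1) k1 (avg u2) fk fM = 0)"
proof -
  have k: "complex_of_real k \<noteq> 0" using k_pos[OF o] by simp
  obtain a0 a1 :: complex where 1: "u0 = (\<lambda>y. a0 * cDU k M y)"
    "u1 = (\<lambda>y. (a0 * k) * cUk k M y + avg u1 + a1 * cDU k M y)"
    "l0 * a0 + complex_of_real (k^2 * dk c k M) * a0 + complex_of_real (6 * k) * avg u1 = 0"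
    "(l0 - complex_of_real (k * c k M)) * avg u1 + complex_of_real (6 * k * UUk k M) * (a0 * k) + complex_of_real (6 * k * M) * avg u1 = 0"
    using bloch_first_order[OF o be] .
  have r1k: "rel1_k c k M (l0 / k) (a0 * k) (avg u1) = 0"
    using 1(3) k by (simp add: rel1_k_def dpar_c[OF o] scaleR_conv_of_real field_simps power2_eq_square)
  have "k * rel1_M U c k M (l0 / k) (a0 * k) (avg u1) = 0"
    using 1(4) k by (simp add: rel1_M_def dpar_avg_sq[OF o] scaleR_conv_of_real field_simps)
  then have r1M: "rel1_M U c k M (l0 / k) (a0 * k) (avg u1) = 0" using k by simp
  show ?thesis
  proof (rule exI[of _ "a0 * k"], rule exI[of _ "a1 * k"], intro conjI r1k r1M allI ballI impI)
    show "u0 y = a0 * k / k * cDU k M y" for y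
      using k by (simp add: 1(1))
    show "u1 y = dpar (\<lambda>k M. U k M y) k M (a0 * k) (avg u1) + a1 * k / k * cDU k M y" for y
      using k by (subst 1(2)) (simp add: dpar_U[OF o] mult.commute)
    fix fk fM :: "real \<Rightarrow> complex"
    assume fk: "fk \<in> Cper 4" "\<forall>y. Lin k M fk y = k * vk \<delta> U c k M (l0 / k) y"
      and fM: "fM \<in> Cper 4" "\<forall>y. Lin k M fM y = k * vM U c k M (l0 / k) y"
    obtain a2 :: complex where 2: "u2 = (\<lambda>y. (a1 * k) * cUk k M y + avg u2 + (a0 * k) * (avg fk - fk y)
        + avg u1 * (avg fM - fM y) + a2 * cDU k M y)"
      "l1 * a0 + l0 * a1 + complex_of_real (k^2 * dk c k M) * a1 + complex_of_real (6 * k) * (avg u2 + (a0 * k) * avg fk + avg u1 * avg fM) = 0"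
      "(l0 - complex_of_real (k * c k M)) * avg u2 + l1 * avg u1 + complex_of_real (6 * k * UUk k M) * (a1 * k) + complex_of_real (6 * k * M) * avg u2
      = complex_of_real (- \<delta> * k^2) * avg u1 + complex_of_real (6 * k) * (a0 * k) * (avg (\<lambda>y. cU k M y * fk y) - complex_of_real M * avg fk)
        + complex_of_real (6 * k) * avg u1 * (avg (\<lambda>y. cU k M y * fM y) - complex_of_real M * avg fM)"
      using bloch_second_order[OF o be 1(1,2,4) fk(1) fk(2)[rule_format] fM(1) fM(2)[rule_format]] .
    show "\<exists>k2. \<forall>y. u2 y = dpar (\<lambda>k M. U k M y) k M (a1 * k) (avg u2) + a0 * k * (avg fk - fk y)
        + avg u1 * (avg fM - fM y) + k2 / complex_of_real k * cDU k M y"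
      using k by (intro exI[of _ "a2 * k"] allI, subst 2(1)) (simp add: dpar_U[OF o] mult.commute)
    show "rel2_k c k M (l0 / k) (l1 / k) (a0 * k) (avg u1) (a1 * k) (avg u2) fk fM = 0"
      using 2(2) k by (simp add: rel2_k_def dpar_c[OF o] scaleR_conv_of_real algebra_simps power2_eq_square)
    have "k * rel2_M \<delta> U c k M (l0 / k) (l1 / k) (a0 * k) (avg u1) (a1 * k) (avg u2) fk fM
      = (l0 - complex_of_real (k * c k M)) * avg u2 + l1 * avg u1 + complex_of_real (6 * k * UUk k M) * (a1 * k) + complex_of_real (6 * k * M) * avg u2
      - (complex_of_real (- \<delta> * k^2) * avg u1 + complex_of_real (6 * k) * (a0 * k) * (avg (\<lambda>y. cU k M y * fk y) - complex_of_real M * avg fk)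
        + complex_of_real (6 * k) * avg u1 * (avg (\<lambda>y. cU k M y * fM y) - complex_of_real M * avg fM))"
      unfolding rel2_M_def dpar_avg_sq[OF o] avg_U_centred[OF o fk(1)] avg_U_centred[OF o fM(1)]
      using k by (simp add: scaleR_conv_of_real field_simps power2_eq_square)
    then show "rel2_M \<delta> U c k M (l0 / k) (l1 / k) (a0 * k) (avg u1) (a1 * k) (avg u2) fk fM = 0"
      using 2(3) k by simp
  qed
qed

end

subsection \<open>The Whitham system\<close>

text \<open>For these fields \<open>dk\<close> differentiates in x and \<open>dM\<close> in t. The
  last two facts are the chain rule needed for the moving coordinate x - c t.\<close>

lemma smooth_params_derivs:
  assumes "smooth_params \<kappa> \<mu>"
  shows "((\<lambda>x. \<kappa> x t) has_real_derivative dk \<kappa> x t) (at x)"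
    "((\<lambda>x. \<mu> x t) has_real_derivative dk \<mu> x t) (at x)"
    "(\<kappa> x has_real_derivative dM \<kappa> x t) (at t)"
    "(\<mu> x has_real_derivative dM \<mu> x t) (at t)"
    "((\<lambda>x. dk \<mu> x t) has_real_derivative dk (dk \<mu>) x t) (at x)"
    "continuous_on A (\<lambda>x. dk \<kappa> x t)" "continuous_on A (\<lambda>x. dk \<mu> x t)"
    "(a has_real_derivative a') (at s) \<Longrightarrow> (b has_real_derivative b') (at s) \<Longrightarrow>
       ((\<lambda>s. \<kappa> (a s) (b s)) has_real_derivative dk \<kappa> (a s) (b s) * a' + dM \<kappa> (a s) (b s) * b') (at s)"
    "(a has_real_derivative a') (at s) \<Longrightarrow> (b has_real_derivative b') (at s) \<Longrightarrow>
       ((\<lambda>s. \<mu> (a s) (b s)) has_real_derivative dk \<mu> (a s) (b s) * a' + dM \<mu> (a s) (b s) * b') (at s)"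
proof -
  have k: "smooth_on UNIV (\<lambda>(x, t). \<kappa> x t)" and m: "smooth_on UNIV (\<lambda>(x, t). \<mu> x t)"
    using assms by (auto simp: smooth_params_def)
  note pk = smooth2_partials[OF open_UNIV k] and pm = smooth2_partials[OF open_UNIV m]
  show "((\<lambda>x. \<kappa> x t) has_real_derivative dk \<kappa> x t) (at x)" by (rule pk(3)) simp
  show "((\<lambda>x. \<mu> x t) has_real_derivative dk \<mu> x t) (at x)" by (rule pm(3)) simp
  show "(\<kappa> x has_real_derivative dM \<kappa> x t) (at t)" by (rule pk(4)) simp
  show "(\<mu> x has_real_derivative dM \<mu> x t) (at t)" by (rule pm(4)) simp
  show "((\<lambda>x. dk \<mu> x t) has_real_derivative dk (dk \<mu>) x t) (at x)"
    by (rule smooth2_has_dk[OF open_UNIV pm(1)]) simp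
  have c: "continuous_on A (\<lambda>x. h x t)" if "smooth_on UNIV (\<lambda>(x, t). h x t)" for h :: "real \<Rightarrow> real \<Rightarrow> real"
  proof -
    have "continuous_on A (\<lambda>x. (\<lambda>(x, t). h x t) (x, t))"
      by (rule continuous_on_compose2[OF smooth_on_cont[OF that]]) (auto intro!: continuous_intros)
    then show ?thesis by simp
  qed
  show "continuous_on A (\<lambda>x. dk \<kappa> x t)" "continuous_on A (\<lambda>x. dk \<mu> x t)"
    using c[OF pk(1)] c[OF pm(1)] by auto
  show "(a has_real_derivative a') (at s) \<Longrightarrow> (b has_real_derivative b') (at s) \<Longrightarrow>
       ((\<lambda>s. \<kappa> (a s) (b s)) has_real_derivative dk \<kappa> (a s) (b s) * a' + dM \<kappa> (a s) (b s) * b') (at s)"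
    by (rule pk(5)) simp_all
  show "(a has_real_derivative a') (at s) \<Longrightarrow> (b has_real_derivative b') (at s) \<Longrightarrow>
       ((\<lambda>s. \<mu> (a s) (b s)) has_real_derivative dk \<mu> (a s) (b s) * a' + dM \<mu> (a s) (b s) * b') (at s)"
    by (rule pm(5)) simp_all
qed

abbreviation field_x :: "(real \<Rightarrow> real \<Rightarrow> real \<Rightarrow> real) \<Rightarrow> real \<Rightarrow> real \<Rightarrow> real \<Rightarrow> real" where
  "field_x f x t y \<equiv> D (\<lambda>x. f x t y) x"

lemma smooth3_partials:
  fixes f :: "real \<Rightarrow> real \<Rightarrow> real \<Rightarrow> real"
  assumes f: "smooth_on UNIV (\<lambda>(x, t, y). f x t y)"
  shows smooth3_x: "smooth_on UNIV (\<lambda>(x, t, y). field_x f x t y)"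
    and smooth3_D: "smooth_on UNIV (\<lambda>(x, t, y). D (f x t) y)"
    and smooth3_has_x: "((\<lambda>x. f x t y) has_real_derivative field_x f x t y) (at x)"
    and smooth3_has_D: "(f x t has_real_derivative D (f x t) y) (at y)"
proof -
  let ?F = "\<lambda>(x, t, y). f x t y"
  have 1: "((\<lambda>x. f x t y) has_real_derivative frechet_derivative ?F (at (x, t, y)) (1, 0, 0)) (at x)" for x t y
  proof -
    have "((\<lambda>x. (x, t, y)) has_vector_derivative (1, 0, 0)) (at x)"
      by (auto intro!: derivative_eq_intros simp: has_vector_derivative_Pair)
    from smooth_on_curve[OF f this] show ?thesis by simp
  qed
  have 3: "(f x t has_real_derivative frechet_derivative ?F (at (x, t, y)) (0, 0, 1)) (at y)" for x t y
  proof -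
    have "((\<lambda>y. (x, t, y)) has_vector_derivative (0, 0, 1)) (at y)"
      by (auto intro!: derivative_eq_intros simp: has_vector_derivative_Pair)
    from smooth_on_curve[OF f this] show ?thesis by simp
  qed
  have x: "field_x f x t y = frechet_derivative ?F (at (x, t, y)) (1, 0, 0)"
    and y: "D (f x t) y = frechet_derivative ?F (at (x, t, y)) (0, 0, 1)" for x t y
    using D_eqI_real[OF 1] D_eqI_real[OF 3] by simp_all
  have B: "(1, 0, 0) \<in> (Basis :: (real \<times> real \<times> real) set)" "(0, 0, 1) \<in> (Basis :: (real \<times> real \<times> real) set)"
    by (auto simp: Basis_prod_def zero_prod_def)
  have "(\<lambda>(x, t, y). field_x f x t y) = (\<lambda>x. frechet_derivative ?F (at x) (1, 0, 0))"
    "(\<lambda>(x, t, y). D (f x t) y) = (\<lambda>x. frechet_derivative ?F (at x) (0, 0, 1))"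
    using x y by auto
  then show "smooth_on UNIV (\<lambda>(x, t, y). field_x f x t y)" "smooth_on UNIV (\<lambda>(x, t, y). D (f x t) y)"
    using smooth_on_partial[OF f B(1)] smooth_on_partial[OF f B(2)] by simp_all
  show "((\<lambda>x. f x t y) has_real_derivative field_x f x t y) (at x)" unfolding x by (rule 1)
  show "(f x t has_real_derivative D (f x t) y) (at y)" unfolding y by (rule 3)
qed

lemma smooth3_Cper:
  fixes f :: "real \<Rightarrow> real \<Rightarrow> real \<Rightarrow> real"
  assumes "smooth_on UNIV (\<lambda>(x, t, y). f x t y)" "\<And>x t y. f x t (y + 1) = f x t y"
  shows "f x t \<in> Cper n"
  using assms
proof (induction n arbitrary: f)
  case 0
  have "continuous_on UNIV (\<lambda>y. (\<lambda>(x, t, y). f x t y) (x, t, y))"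
    by (rule continuous_on_compose2[OF smooth_on_cont[OF 0(1)]]) (auto intro!: continuous_intros)
  then show ?case using 0 by (simp add: Cper_0)
next
  case (Suc n)
  have "D (f x t) \<in> Cper n"
    by (rule Suc.IH[of "\<lambda>x t. D (f x t)"]) (use Suc.prems in \<open>auto intro: smooth3_D D_periodic\<close>)
  then show ?case
    using smooth3_has_D[OF Suc.prems(1)] Suc.prems
    by (intro Cper_SucI[of _ "D (f x t)"]) (auto simp: has_real_derivative_iff_has_vector_derivative)
qed

lemma smooth3_cont:
  fixes f :: "real \<Rightarrow> real \<Rightarrow> real \<Rightarrow> real"
  assumes "smooth_on UNIV (\<lambda>(x, t, y). f x t y)" "continuous_on A a" "continuous_on A b"
  shows "continuous_on A (\<lambda>z. f (a z) t (b z))"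
proof -
  have "continuous_on A (\<lambda>z. (\<lambda>(x, t, y). f x t y) (a z, t, b z))"
    by (rule continuous_on_compose2[OF smooth_on_cont[OF assms(1)]]) (auto intro!: continuous_intros assms)
  then show ?thesis by simp
qed

lemma smooth_periodic_fieldD:
  assumes "smooth_periodic_field f"
  shows "f x t \<in> Cper n" "((\<lambda>x. f x t y) has_real_derivative field_x f x t y) (at x)"
    "continuous_on A a \<Longrightarrow> continuous_on A b \<Longrightarrow> continuous_on A (\<lambda>z. f (a z) t (b z))"
    "continuous_on A a \<Longrightarrow> continuous_on A b \<Longrightarrow> continuous_on A (\<lambda>z. field_x f (a z) t (b z))"
proof -
  have f: "smooth_on UNIV (\<lambda>(x, t, y). f x t y)" and p: "\<And>x t y. f x t (y + 1) = f x t y"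
    using assms by (auto simp: smooth_periodic_field_def)
  show "f x t \<in> Cper n" by (rule smooth3_Cper[OF f p])
  show "((\<lambda>x. f x t y) has_real_derivative field_x f x t y) (at x)" by (rule smooth3_has_x[OF f])
  show "continuous_on A a \<Longrightarrow> continuous_on A b \<Longrightarrow> continuous_on A (\<lambda>z. f (a z) t (b z))"
    by (rule smooth3_cont[OF f])
  show "continuous_on A a \<Longrightarrow> continuous_on A b \<Longrightarrow> continuous_on A (\<lambda>z. field_x f (a z) t (b z))"
    by (rule smooth3_cont[OF smooth3_x[OF f]])
qed

lemma avg_field_deriv:
  fixes f f' :: "real \<Rightarrow> real \<Rightarrow> real"
  assumes d: "\<And>X y. ((\<lambda>X. f X y) has_real_derivative f' X y) (at X)"
    and cf: "continuous_on UNIV (\<lambda>(X, y). f X y)" and cf': "continuous_on UNIV (\<lambda>(X, y). f' X y)"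
  shows "((\<lambda>X. avg (f X)) has_real_derivative avg (f' X)) (at X)"
proof -
  have c: "continuous_on {0..1} (f X)" for X
  proof -
    have "continuous_on {0..1} (\<lambda>y. (\<lambda>(X, y). f X y) (X, y))"
      by (rule continuous_on_compose2[OF cf]) (auto intro!: continuous_intros)
    then show ?thesis by simp
  qed
  show ?thesis
    by (rule vec_deriv_real, rule avg_has_vector_derivative[OF open_UNIV, of _ f f'])
      (auto intro: real_deriv_vec d c continuous_on_subset[OF cf'])
qed

context waves
begin

lemma avg_U_centred_real:
  assumes o: "(k, M) \<in> \<Omega>" and f: "continuous_on {0..1} f"
  shows "avg (\<lambda>y. 6 * U k M y * (f y - avg f)) = 6 * (avg (\<lambda>y. U k M y * f y) - M * avg f)"
proof -
  have "avg (\<lambda>y. 6 * U k M y * (f y - avg f))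
    = avg (\<lambda>y. 6 * (U k M y * f y - avg f * U k M y))"
    by (simp add: algebra_simps)
  also have "\<dots> = 6 * (avg (\<lambda>y. U k M y * f y) - avg f * avg (U k M))"
    unfolding avg_mult_real using U_cont[OF o] f
    by (subst avg_diff) (auto simp: avg_mult_real intro!: continuous_intros)
  finally show ?thesis by (simp add: avg_U[OF o])
qed

text \<open>The hypotheses list derivatives in place of smoothness, so that the formula applies at
  once to rescaled and to shifted fields. As y-derivatives of U do not vary with M, \<partial>_X M
  enters only through the centred square of U.\<close>

lemma whitham_f_eq:
  assumes o: "(\<kappa> X T, \<mu> X T) \<in> \<Omega>"
    and \<kappa>: "\<And>X. ((\<lambda>X. \<kappa> X T) has_real_derivative \<kappa>x X) (at X)" "((\<lambda>T. \<kappa> X T) has_real_derivative \<kappa>t) (at T)"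
    and \<mu>: "\<And>X. ((\<lambda>X. \<mu> X T) has_real_derivative \<mu>x X) (at X)" "((\<lambda>T. \<mu> X T) has_real_derivative \<mu>t) (at T)"
    and c: "continuous_on UNIV \<kappa>x" "continuous_on UNIV \<mu>x"
  shows "whitham_f \<delta> U c \<kappa> \<mu> f X T y
    = Lop \<delta> (\<kappa> X T) (c (\<kappa> X T) (\<mu> X T)) (U (\<kappa> X T) (\<mu> X T)) (f X T) y
      - (Uk (\<kappa> X T) (\<mu> X T) y * \<kappa>t + src_k (\<kappa> X T) (\<mu> X T) y * \<kappa>x X + src_M (\<kappa> X T) (\<mu> X T) y * \<mu>x X)"
proof -
  let ?k = "\<kappa> X T" and ?M = "\<mu> X T"
  let ?I = "{X. (\<kappa> X T, \<mu> X T) \<in> \<Omega>}" and ?J = "{T. (\<kappa> X T, \<mu> X T) \<in> \<Omega>}"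
  have ck: "continuous_on UNIV (\<lambda>X. \<kappa> X T)" "continuous_on UNIV (\<lambda>X. \<mu> X T)"
    using \<kappa>(1) \<mu>(1) by (auto simp: continuous_on_eq_continuous_at intro: DERIV_isCont)
  have I: "open ?I" "X \<in> ?I"
    using open_vimage[OF O continuous_on_Pair[OF ck]] o by (auto simp: vimage_def)
  note x = U_chain[of "\<lambda>X. \<kappa> X T" X "\<lambda>X. \<mu> X T", OF o \<kappa>(1)[of X] \<mu>(1)[of X], of y]
    and t = U_chain(1)[of "\<lambda>T. \<kappa> X T" T "\<lambda>T. \<mu> X T", OF o \<kappa>(2) \<mu>(2), of y]
  have sq: "((\<lambda>X. avg (\<lambda>y. (U (\<kappa> X T) (\<mu> X T) y)^2)) has_real_derivative
     2 * UUk ?k ?M * \<kappa>x X + 2 * ?M * \<mu>x X) (at X)"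
    by (rule avg_U_square_curve[OF I]) (use \<kappa> \<mu> c in \<open>auto intro: continuous_on_subset\<close>)
  have ev: "\<forall>\<^sub>F T in nhds T. (\<kappa> X T, \<mu> X T) \<in> \<Omega>"
  proof -
    have "((\<lambda>T. (\<kappa> X T, \<mu> X T)) \<longlongrightarrow> (\<kappa> X T, \<mu> X T)) (nhds T)"
      using DERIV_isCont[OF \<kappa>(2)] DERIV_isCont[OF \<mu>(2)]
      by (intro tendsto_Pair) (simp_all add: isCont_def tendsto_at_iff_tendsto_nhds)
    then show ?thesis using O o by (auto simp: tendsto_def)
  qed
  \<comment> \<open>The parameters are known to lie in \<Omega> only for times near T; replacing <U>
    by \<mu> there is enough for the derivative at T.\<close>
  have DT: "D (\<lambda>T. U (\<kappa> X T) (\<mu> X T) y - avg (U (\<kappa> X T) (\<mu> X T))) T = Uk ?k ?M y * \<kappa>t"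
  proof -
    have "D (\<lambda>T. U (\<kappa> X T) (\<mu> X T) y - avg (U (\<kappa> X T) (\<mu> X T))) T = D (\<lambda>T. U (\<kappa> X T) (\<mu> X T) y - \<mu> X T) T"
      by (rule D_cong_ev, rule eventually_mono[OF ev]) (simp add: avg_U)
    also have "\<dots> = Uk ?k ?M y * \<kappa>t"
      using DERIV_diff[OF t \<mu>(2)] by (intro D_eqI_real) simp
    finally show ?thesis .
  qed
  have DQ: "D (\<lambda>X. (U (\<kappa> X T) (\<mu> X T) y)^2 - avg (\<lambda>z. (U (\<kappa> X T) (\<mu> X T) z)^2)) X
    = 2 * (U ?k ?M y * Uk ?k ?M y - UUk ?k ?M) * \<kappa>x X + 2 * (U ?k ?M y - ?M) * \<mu>x X"
    by (rule D_eqI_real, (rule derivative_eq_intros x(1) sq refl)+) (simp add: algebra_simps)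
  show ?thesis
    unfolding whitham_f_def Let_def D_numeral DT DQ D_eqI_real[OF x(2)] D_eqI_real[OF x(3)] D_eqI_real[OF x(4)]
      D_eqI_real[OF \<kappa>(1)]
    by (simp add: src_k_def src_M_def algebra_simps)
qed

text \<open>Both residuals are written as explicit expressions in the derivatives of the fields.
  This reduces the rescaling to a count of factors of \<epsilon> and the linearization to a count of
  factors of s.\<close>

lemma whitham_kM_eq:
  assumes o: "(\<kappa> X T, \<mu> X T) \<in> \<Omega>"
    and \<kappa>: "\<And>X. ((\<lambda>X. \<kappa> X T) has_real_derivative \<kappa>x X) (at X)" "((\<lambda>T. \<kappa> X T) has_real_derivative \<kappa>t) (at T)"
    and \<mu>: "\<And>X. ((\<lambda>X. \<mu> X T) has_real_derivative \<mu>x X) (at X)" "((\<lambda>T. \<mu> X T) has_real_derivative \<mu>t) (at T)"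
    and c: "continuous_on UNIV \<kappa>x" "continuous_on UNIV \<mu>x"
    and f: "\<And>X y. ((\<lambda>X. f X T y) has_real_derivative fx X y) (at X)"
    and cf: "continuous_on UNIV (\<lambda>(X, y). f X T y)" and cfx: "continuous_on UNIV (\<lambda>(X, y). fx X y)"
  shows "whitham_k \<epsilon> c \<kappa> \<mu> f X T = \<kappa>t + \<kappa>x X * c (\<kappa> X T) (\<mu> X T)
      + \<kappa> X T * (dk c (\<kappa> X T) (\<mu> X T) * \<kappa>x X + 6 * \<mu>x X)
      + 6 * \<epsilon> * (\<kappa>x X * avg (f X T) + \<kappa> X T * avg (fx X))"
    "(\<mu>x has_real_derivative \<mu>xx) (at X) \<Longrightarrow> whitham_M \<epsilon> \<delta> U \<kappa> \<mu> f X T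
      = \<mu>t + 6 * UUk (\<kappa> X T) (\<mu> X T) * \<kappa>x X + 6 * \<mu> X T * \<mu>x X
      - 6 * \<epsilon> * (\<kappa>x X * avg (\<lambda>y. Uk (\<kappa> X T) (\<mu> X T) y * f X T y)
          + avg (\<lambda>y. U (\<kappa> X T) (\<mu> X T) y * fx X y) - \<mu> X T * avg (fx X))
      + \<epsilon> * \<delta> * \<mu>xx"
proof -
  let ?k = "\<kappa> X T" and ?M = "\<mu> X T"
  let ?I = "{X. (\<kappa> X T, \<mu> X T) \<in> \<Omega>}"
  have ck: "continuous_on UNIV (\<lambda>X. \<kappa> X T)" "continuous_on UNIV (\<lambda>X. \<mu> X T)"
    using \<kappa>(1) \<mu>(1) by (auto simp: continuous_on_eq_continuous_at intro: DERIV_isCont)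
  have I: "open ?I" "X \<in> ?I"
    using open_vimage[OF O continuous_on_Pair[OF ck]] o by (auto simp: vimage_def)
  have evI: "\<forall>\<^sub>F X in nhds X. X \<in> ?I" using I eventually_nhds by blast
  note favg = avg_field_deriv[where f="\<lambda>X. f X T", OF f cf cfx]
  have kc: "((\<lambda>X. c (\<kappa> X T) (\<mu> X T)) has_real_derivative dk c ?k ?M * \<kappa>x X + 6 * \<mu>x X) (at X)"
    using smooth2_chain[OF O smc, of "\<lambda>X. \<kappa> X T" X "\<lambda>X. \<mu> X T", OF o \<kappa>(1)[of X] \<mu>(1)[of X]] by (simp add: c_M[OF o])
  have "((\<lambda>X. \<kappa> X T * c (\<kappa> X T) (\<mu> X T)) has_real_derivative
      \<kappa>x X * c ?k ?M + \<kappa> X T * (dk c ?k ?M * \<kappa>x X + 6 * \<mu>x X)) (at X)"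
    by (rule derivative_eq_intros \<kappa>(1) kc refl)+ simp
  moreover have "((\<lambda>X. avg (\<lambda>y. 6 * \<kappa> X T * f X T y)) has_real_derivative
      6 * (\<kappa>x X * avg (f X T) + ?k * avg (fx X))) (at X)"
    unfolding avg_mult_real by (rule derivative_eq_intros \<kappa>(1) favg refl)+ (simp add: algebra_simps)
  ultimately show "whitham_k \<epsilon> c \<kappa> \<mu> f X T = \<kappa>t + \<kappa>x X * c (\<kappa> X T) (\<mu> X T)
      + \<kappa> X T * (dk c (\<kappa> X T) (\<mu> X T) * \<kappa>x X + 6 * \<mu>x X)
      + 6 * \<epsilon> * (\<kappa>x X * avg (f X T) + \<kappa> X T * avg (fx X))"
    unfolding whitham_k_def D_eqI_real[OF \<kappa>(2)] by (simp add: D_eqI_real)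
  assume \<mu>xx: "(\<mu>x has_real_derivative \<mu>xx) (at X)"
  have sq: "((\<lambda>X. avg (\<lambda>y. (U (\<kappa> X T) (\<mu> X T) y)^2)) has_real_derivative
     2 * UUk ?k ?M * \<kappa>x X + 2 * ?M * \<mu>x X) (at X)"
    by (rule avg_U_square_curve[OF I]) (use \<kappa> \<mu> c in \<open>auto intro: continuous_on_subset\<close>)
  have sq3: "D (\<lambda>X. avg (\<lambda>y. 3 * (U (\<kappa> X T) (\<mu> X T) y)^2)) X = 6 * UUk ?k ?M * \<kappa>x X + 6 * ?M * \<mu>x X"
    unfolding avg_mult_real by (rule D_eqI_real, (rule derivative_eq_intros sq refl)+) simp
  have cs: "continuous_on {0..1} (f X T)" for X
  proof -
    have "continuous_on {0..1} (\<lambda>y. (\<lambda>(X, y). f X T y) (X, y))"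
      by (rule continuous_on_compose2[OF cf]) (auto intro!: continuous_intros)
    then show ?thesis by simp
  qed
  have Uf: "((\<lambda>X. avg (\<lambda>y. U (\<kappa> X T) (\<mu> X T) y * f X T y)) has_real_derivative
     \<kappa>x X * avg (\<lambda>y. Uk ?k ?M y * f X T y) + \<mu>x X * avg (f X T) + avg (\<lambda>y. U ?k ?M y * fx X y)) (at X)"
    by (rule avg_U_field_curve[OF I, where f="\<lambda>X. f X T"])
      (use \<kappa> \<mu> c f cf cfx in \<open>auto intro: continuous_on_subset\<close>)
  have "D (\<lambda>X. avg (\<lambda>y. 6 * U (\<kappa> X T) (\<mu> X T) y * (f X T y - avg (f X T)))) X
    = D (\<lambda>X. 6 * (avg (\<lambda>y. U (\<kappa> X T) (\<mu> X T) y * f X T y) - \<mu> X T * avg (f X T))) X"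
    by (rule D_cong_ev, rule eventually_mono[OF evI]) (simp add: avg_U_centred_real cs)
  \<comment> \<open>The terms \<open>\<mu>x X * avg (f X T)\<close> cancel: adding a constant to U
    does not change <U (f - <f>)>.\<close>
  also have "\<dots> = 6 * (\<kappa>x X * avg (\<lambda>y. Uk ?k ?M y * f X T y) + avg (\<lambda>y. U ?k ?M y * fx X y) - ?M * avg (fx X))"
    by (rule D_eqI_real, (rule derivative_eq_intros Uf \<mu>(1) favg refl)+) (simp add: algebra_simps)
  finally have c6: "D (\<lambda>X. avg (\<lambda>y. 6 * U (\<kappa> X T) (\<mu> X T) y * (f X T y - avg (f X T)))) X
     = 6 * (\<kappa>x X * avg (\<lambda>y. Uk ?k ?M y * f X T y) + avg (\<lambda>y. U ?k ?M y * fx X y) - ?M * avg (fx X))" .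
  have "D (\<lambda>X. \<mu> X T) = \<mu>x" using \<mu>(1) by (intro ext D_eqI_real)
  then have "(D ^^ 2) (\<lambda>X. \<mu> X T) X = \<mu>xx" using D_eqI_real[OF \<mu>xx] by (simp add: D_numeral)
  then show "whitham_M \<epsilon> \<delta> U \<kappa> \<mu> f X T
      = \<mu>t + 6 * UUk (\<kappa> X T) (\<mu> X T) * \<kappa>x X + 6 * \<mu> X T * \<mu>x X
      - 6 * \<epsilon> * (\<kappa>x X * avg (\<lambda>y. Uk (\<kappa> X T) (\<mu> X T) y * f X T y)
          + avg (\<lambda>y. U (\<kappa> X T) (\<mu> X T) y * fx X y) - \<mu> X T * avg (fx X))
      + \<epsilon> * \<delta> * \<mu>xx"
    unfolding whitham_M_def D_eqI_real[OF \<mu>(2)] sq3 c6 by simp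
qed

text \<open>At a fixed point (X, T) the equation reads L[h] = source, and the source is a
  combination of three functions of mean 0.\<close>

lemma whitham_f_determined:
  assumes sm: "smooth_params \<kappa> \<mu>" and o: "(\<kappa> X T, \<mu> X T) \<in> \<Omega>"
  shows "\<exists>!h. h \<in> Cper 4 \<and> whitham_orth U \<kappa> \<mu> (\<lambda>_ _. h) X T = 0 \<and>
             (\<forall>y. whitham_f \<delta> U c \<kappa> \<mu> (\<lambda>_ _. h) X T y = 0)"
proof -
  let ?k = "\<kappa> X T" and ?M = "\<mu> X T"
  interpret wave_op \<delta> ?k "c ?k ?M" "U ?k ?M" by (rule wave_op[OF o])
  note d = smooth_params_derivs[OF sm]
  let ?s = "\<lambda>y. Uk ?k ?M y * dM \<kappa> X T + src_k ?k ?M y * dk \<kappa> X T + src_M ?k ?M y * dk \<mu> X T"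
  have s: "Uk ?k ?M \<in> Cper 0" "src_k ?k ?M \<in> Cper 0" "src_M ?k ?M \<in> Cper 0"
    by (intro Uk_Cper src_k_Cper src_M_Cper o)+
  have 1: "?s \<in> Cper 0" by (intro Cper_add Cper_mult Cper_const s)
  have 2: "avg ?s = 0"
  proof -
    have "avg ?s = avg (\<lambda>y. dM \<kappa> X T * Uk ?k ?M y + dk \<kappa> X T * src_k ?k ?M y + dk \<mu> X T * src_M ?k ?M y)"
      by (simp add: mult.commute)
    also have "\<dots> = 0"
      using s[THEN Cper_cont, of "{0..1}"]
      by (simp add: avg_add avg_cmult continuous_intros avg_Uk[OF o] avg_src_k[OF o] avg_src_M[OF o])
    finally show ?thesis .
  qed
  have "whitham_f \<delta> U c \<kappa> \<mu> (\<lambda>_ _. h) X T y = Lop \<delta> ?k (c ?k ?M) (U ?k ?M) h y - ?s y" for h y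
    by (rule whitham_f_eq[of \<kappa> X T \<mu>]) (use o d in auto)
  then show ?thesis
    using Lop_ex1_real[OF 1 2] by (simp add: whitham_orth_def mult.commute)
qed

text \<open>The corrector is linear in first derivatives of (k, M), hence its factor 1/\<epsilon>.
  Then \<epsilon> \<partial>_X f and \<epsilon> \<partial>_X^2 M scale like a first derivative, and
  every residual is multiplied by 1/\<epsilon>.\<close>

lemma whitham_rescale:
  assumes \<epsilon>: "\<epsilon> > 0" and sm: "smooth_params \<kappa> \<mu>" and o: "\<And>X T. (\<kappa> X T, \<mu> X T) \<in> \<Omega>"
    and f: "smooth_periodic_field f"
  shows "whitham_solution \<epsilon> \<delta> U c (\<lambda>X T. \<kappa> (X / \<epsilon>) (T / \<epsilon>)) (\<lambda>X T. \<mu> (X / \<epsilon>) (T / \<epsilon>))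
                          (\<lambda>X T y. f (X / \<epsilon>) (T / \<epsilon>) y / \<epsilon>)
         \<longleftrightarrow> whitham_solution 1 \<delta> U c \<kappa> \<mu> f"
proof -
  note d = smooth_params_derivs[OF sm] and fd = smooth_periodic_fieldD[OF f]
  let ?\<kappa> = "\<lambda>X T. \<kappa> (X / \<epsilon>) (T / \<epsilon>)" and ?\<mu> = "\<lambda>X T. \<mu> (X / \<epsilon>) (T / \<epsilon>)"
    and ?f = "\<lambda>X T y. f (X / \<epsilon>) (T / \<epsilon>) y / \<epsilon>"
  have sc: "((\<lambda>X. h (X / \<epsilon>)) has_real_derivative h' / \<epsilon>) (at X)"
    if h: "(h has_real_derivative h') (at (X / \<epsilon>))" for h h' X
  proof -
    have "((\<lambda>X. X / \<epsilon>) has_real_derivative 1 / \<epsilon>) (at X)"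
      using \<epsilon> by (auto intro!: derivative_eq_intros)
    from DERIV_chain2[where g="\<lambda>X. X / \<epsilon>" and f=h, OF h this] show ?thesis by simp
  qed
  have cc: "continuous_on UNIV (\<lambda>X. h (X / \<epsilon>))" if "continuous_on UNIV h" for h :: "real \<Rightarrow> real"
    by (rule continuous_on_compose2[OF that]) (use \<epsilon> in \<open>auto intro!: continuous_intros\<close>)
  have k1: "((\<lambda>X. ?\<kappa> X T) has_real_derivative dk \<kappa> (X / \<epsilon>) (T / \<epsilon>) / \<epsilon>) (at X)"
    and k2: "((\<lambda>T. ?\<kappa> X T) has_real_derivative dM \<kappa> (X / \<epsilon>) (T / \<epsilon>) / \<epsilon>) (at T)"
    and m1: "((\<lambda>X. ?\<mu> X T) has_real_derivative dk \<mu> (X / \<epsilon>) (T / \<epsilon>) / \<epsilon>) (at X)"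
    and m2: "((\<lambda>T. ?\<mu> X T) has_real_derivative dM \<mu> (X / \<epsilon>) (T / \<epsilon>) / \<epsilon>) (at T)" for X T
    using sc[of "\<lambda>x. \<kappa> x (T / \<epsilon>)", OF d(1)] sc[of "\<kappa> (X / \<epsilon>)", OF d(3)]
      sc[of "\<lambda>x. \<mu> x (T / \<epsilon>)", OF d(2)] sc[of "\<mu> (X / \<epsilon>)", OF d(4)] by auto
  have m3: "((\<lambda>X. dk \<mu> (X / \<epsilon>) (T / \<epsilon>) / \<epsilon>) has_real_derivative dk (dk \<mu>) (X / \<epsilon>) (T / \<epsilon>) / \<epsilon> / \<epsilon>) (at X)" for X T
    by (rule DERIV_cdivide) (rule sc[of "\<lambda>x. dk \<mu> x (T / \<epsilon>)", OF d(5)])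
  have ck: "continuous_on UNIV (\<lambda>X. dk \<kappa> (X / \<epsilon>) (T / \<epsilon>) / \<epsilon>)" "continuous_on UNIV (\<lambda>X. dk \<mu> (X / \<epsilon>) (T / \<epsilon>) / \<epsilon>)" for T
    using cc[OF d(6)] cc[OF d(7)] \<epsilon> by (auto intro!: continuous_intros)
  have f1: "((\<lambda>X. ?f X T y) has_real_derivative field_x f (X / \<epsilon>) (T / \<epsilon>) y / \<epsilon> / \<epsilon>) (at X)" for X T y
    by (rule DERIV_cdivide) (rule sc[of "\<lambda>x. f x (T / \<epsilon>) y", OF fd(2)])
  have cx: "continuous_on UNIV (\<lambda>z::real \<times> real. fst z / \<epsilon>)" using \<epsilon> by (auto intro!: continuous_intros)
  have f2: "continuous_on UNIV (\<lambda>(X, y). ?f X T y)" "continuous_on UNIV (\<lambda>(X, y). field_x f (X / \<epsilon>) (T / \<epsilon>) y / \<epsilon> / \<epsilon>)" for T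
    unfolding split_beta using \<epsilon> by (auto intro!: continuous_intros fd(3,4) cx)
  have f3: "continuous_on UNIV (\<lambda>(X, y). f X T y)" "continuous_on UNIV (\<lambda>(X, y). field_x f X T y)" for T
    unfolding split_beta by (auto intro!: continuous_intros fd(3,4))
  have e: "whitham_k \<epsilon> c ?\<kappa> ?\<mu> ?f X T = whitham_k 1 c \<kappa> \<mu> f (X / \<epsilon>) (T / \<epsilon>) / \<epsilon>"
    "whitham_M \<epsilon> \<delta> U ?\<kappa> ?\<mu> ?f X T = whitham_M 1 \<delta> U \<kappa> \<mu> f (X / \<epsilon>) (T / \<epsilon>) / \<epsilon>"
    "whitham_orth U ?\<kappa> ?\<mu> ?f X T = whitham_orth U \<kappa> \<mu> f (X / \<epsilon>) (T / \<epsilon>) / \<epsilon>"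
    "whitham_f \<delta> U c ?\<kappa> ?\<mu> ?f X T y = whitham_f \<delta> U c \<kappa> \<mu> f (X / \<epsilon>) (T / \<epsilon>) y / \<epsilon>" for X T y
  proof -
    have V: "U (\<kappa> (X / \<epsilon>) (T / \<epsilon>)) (\<mu> (X / \<epsilon>) (T / \<epsilon>)) \<in> Cper 1" by (rule U_Cper[OF o])
    have s: "avg (\<lambda>y. h y / \<epsilon>) = avg h / \<epsilon>" for h :: "real \<Rightarrow> real"
      using avg_mult_real[of "1 / \<epsilon>" h] by simp
    note A = whitham_kM_eq[of ?\<kappa> X T ?\<mu>, OF o k1 k2 m1 m2 ck f1 f2]
      and B = whitham_kM_eq[of \<kappa> "X / \<epsilon>" "T / \<epsilon>" \<mu>, OF o d(1) d(3) d(2) d(4) d(6) d(7) fd(2) f3]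
    show "whitham_k \<epsilon> c ?\<kappa> ?\<mu> ?f X T = whitham_k 1 c \<kappa> \<mu> f (X / \<epsilon>) (T / \<epsilon>) / \<epsilon>"
      unfolding A(1) B(1) s using \<epsilon> by (simp add: field_simps)
    have t: "avg (\<lambda>y. g y * (h y / \<epsilon>)) = avg (\<lambda>y. g y * h y) / \<epsilon>" for g h :: "real \<Rightarrow> real"
      using s[of "\<lambda>y. g y * h y"] by simp
    show "whitham_M \<epsilon> \<delta> U ?\<kappa> ?\<mu> ?f X T = whitham_M 1 \<delta> U \<kappa> \<mu> f (X / \<epsilon>) (T / \<epsilon>) / \<epsilon>"
      unfolding A(2)[OF m3] B(2)[OF d(5)] s t using \<epsilon> by (simp add: field_simps)
    show "whitham_orth U ?\<kappa> ?\<mu> ?f X T = whitham_orth U \<kappa> \<mu> f (X / \<epsilon>) (T / \<epsilon>) / \<epsilon>"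
      unfolding whitham_orth_def
      using s[of "\<lambda>y. f (X / \<epsilon>) (T / \<epsilon>) y * D (U (\<kappa> (X / \<epsilon>) (T / \<epsilon>)) (\<mu> (X / \<epsilon>) (T / \<epsilon>))) y"] by simp
    have L: "Lop \<delta> (\<kappa> (X / \<epsilon>) (T / \<epsilon>)) r (U (\<kappa> (X / \<epsilon>) (T / \<epsilon>)) (\<mu> (X / \<epsilon>) (T / \<epsilon>))) (?f X T) y
      = Lop \<delta> (\<kappa> (X / \<epsilon>) (T / \<epsilon>)) r (U (\<kappa> (X / \<epsilon>) (T / \<epsilon>)) (\<mu> (X / \<epsilon>) (T / \<epsilon>))) (f (X / \<epsilon>) (T / \<epsilon>)) y / \<epsilon>" for r
      using Lop_scaleR[OF V fd(1), of \<delta> _ r "1 / \<epsilon>"] by simp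
    show "whitham_f \<delta> U c ?\<kappa> ?\<mu> ?f X T y = whitham_f \<delta> U c \<kappa> \<mu> f (X / \<epsilon>) (T / \<epsilon>) y / \<epsilon>"
      unfolding whitham_f_eq[of ?\<kappa> X T ?\<mu>, OF o k1 k2 m1 m2 ck]
        whitham_f_eq[of \<kappa> "X / \<epsilon>" "T / \<epsilon>" \<mu>, OF o d(1) d(3) d(2) d(4) d(6) d(7)] L
      by (simp add: diff_divide_distrib add_divide_distrib)
  qed
  \<comment> \<open>Division by \<epsilon> maps the plane onto itself, so the rescaled equations are
    tested at all points.\<close>
  have all: "(\<forall>X T. P (X / \<epsilon>) (T / \<epsilon>)) \<longleftrightarrow> (\<forall>X T. P X T)" for P
  proof
    assume h: "\<forall>X T. P (X / \<epsilon>) (T / \<epsilon>)"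
    show "\<forall>X T. P X T"
    proof (intro allI)
      fix X T show "P X T" using h[rule_format, of "X * \<epsilon>" "T * \<epsilon>"] \<epsilon> by simp
    qed
  qed simp
  show ?thesis
    unfolding whitham_solution_def e
    using \<epsilon> by (simp add: all[of "\<lambda>X T. whitham_k 1 c \<kappa> \<mu> f X T = 0 \<and> whitham_M 1 \<delta> U \<kappa> \<mu> f X T = 0 \<and>
            whitham_orth U \<kappa> \<mu> f X T = 0 \<and> (\<forall>y. whitham_f \<delta> U c \<kappa> \<mu> f X T y = 0)"])
qed

lemma whitham_constant:
  "whitham_solution 1 \<delta> U c (\<lambda>_ _. k) (\<lambda>_ _. M) (\<lambda>_ _ _. 0)"
  by (simp add: whitham_solution_def whitham_k_def whitham_M_def whitham_orth_def whitham_f_def Let_def Lop_def)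

end

subsection \<open>Linearization about a constant state\<close>

text \<open>Caratheodory's form of the derivative. With it, linearizing at s = 0 asks only for
  continuity of the quotient G; the wave family, its averages and L, all evaluated at moving
  parameters, are not differentiated in s.\<close>

lemma has_derivative_times_id:
  fixes F G :: "real \<Rightarrow> real"
  assumes "open J" "0 \<in> J" "\<And>s. s \<in> J \<Longrightarrow> F s = s * G s" "continuous_on J G"
  shows "(F has_real_derivative G 0) (at 0)"
proof -
  have "isCont G 0" using assms(4) by (simp add: continuous_on_eq_continuous_at assms(1,2))
  then have "((\<lambda>s. s * G s) has_real_derivative G 0) (at 0)"
    unfolding CARAT_DERIV by (intro exI[of _ G]) simp
  then show ?thesis
    by (rule has_field_derivative_transform_within_open[OF _ assms(1,2)]) (simp add: assms(3))
qed

context waves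
begin

lemma lin_f_eq:
  assumes o: "(k, M) \<in> \<Omega>"
  shows "lin_f \<delta> U c k M \<kappa> \<mu> g x t y = Lin k M (g x t) y
    - (Uk k M y *\<^sub>R (D (\<lambda>t. \<kappa> x t) t - c k M *\<^sub>R D (\<lambda>x. \<kappa> x t) x)
       + src_k k M y *\<^sub>R D (\<lambda>x. \<kappa> x t) x + src_M k M y *\<^sub>R D (\<lambda>x. \<mu> x t) x)"
  unfolding lin_f_def Let_def dk_Q[OF o]
  by (simp add: src_k_def src_M_def D_numeral algebra_simps)

text \<open>The base state is constant and its corrector is 0, so derivatives of the perturbed
  fields and the corrector itself all carry a factor s. Every term of each residual contains such a
  factor, and the quotient has coefficients that are continuous in the perturbed parameters.\<close>

lemma linearization:
  assumes o: "(k, M) \<in> \<Omega>" and sm: "smooth_params \<kappa> \<mu>" and g: "smooth_periodic_field g"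
  defines "\<kappa>s \<equiv> \<lambda>s x t. k + s * \<kappa> (x - c k M * t) t" and "\<mu>s \<equiv> \<lambda>s x t. M + s * \<mu> (x - c k M * t) t"
    and "fs \<equiv> \<lambda>s x t y. s * g (x - c k M * t) t y"
  shows "((\<lambda>s. whitham_k 1 c (\<kappa>s s) (\<mu>s s) (fs s) x t)
           has_real_derivative lin_k c k M \<kappa> \<mu> g (x - c k M * t) t) (at 0)"
    "((\<lambda>s. whitham_M 1 \<delta> U (\<kappa>s s) (\<mu>s s) (fs s) x t)
           has_real_derivative lin_M \<delta> U c k M \<kappa> \<mu> g (x - c k M * t) t) (at 0)"
    "((\<lambda>s. whitham_orth U (\<kappa>s s) (\<mu>s s) (fs s) x t)
           has_real_derivative lin_orth U k M g (x - c k M * t) t) (at 0)"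
    "((\<lambda>s. whitham_f \<delta> U c (\<kappa>s s) (\<mu>s s) (fs s) x t y)
           has_real_derivative lin_f \<delta> U c k M \<kappa> \<mu> g (x - c k M * t) t y) (at 0)"
proof -
  note d = smooth_params_derivs[OF sm] and gd = smooth_periodic_fieldD[OF g]
  define cs where "cs = c k M"
  define z where "z = x - cs * t"
  define kk where "kk s = k + s * \<kappa> z t" for s
  define mm where "mm s = M + s * \<mu> z t" for s
  \<comment> \<open>The values of s for which the perturbed parameters at this one point (x, t) lie
    in \<Omega>; continuity makes this an open neighbourhood of 0.\<close>
  let ?J = "{s. (kk s, mm s) \<in> \<Omega>}"
  have ckm: "continuous_on A kk" "continuous_on A mm" for A
    unfolding kk_def[abs_def] mm_def[abs_def] by (intro continuous_intros)+
  have J: "open ?J" "0 \<in> ?J"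
    using open_vimage[OF O continuous_on_Pair[OF ckm]] o by (auto simp: vimage_def kk_def mm_def)
  have at: "\<kappa>s s x t = kk s" "\<mu>s s x t = mm s" "fs s x t = (\<lambda>y. s * g z t y)" for s
    by (simp_all add: \<kappa>s_def \<mu>s_def fs_def kk_def mm_def z_def cs_def)
  have sh: "((\<lambda>X. h (X - cs * t)) has_real_derivative h') (at X)"
    if h: "(h has_real_derivative h') (at (X - cs * t))" for h h' X
  proof -
    have "((\<lambda>X. X - cs * t) has_real_derivative 1) (at X)" by (auto intro!: derivative_eq_intros)
    from DERIV_chain2[where g="\<lambda>X. X - cs * t" and f=h, OF h this] show ?thesis by simp
  qed
  have k1: "((\<lambda>X. \<kappa>s s X t) has_real_derivative s * dk \<kappa> (X - cs * t) t) (at X)"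
    and m1: "((\<lambda>X. \<mu>s s X t) has_real_derivative s * dk \<mu> (X - cs * t) t) (at X)" for s X
    unfolding \<kappa>s_def \<mu>s_def cs_def[symmetric]
    by ((rule derivative_eq_intros sh[OF d(1)] sh[OF d(2)] refl)+, simp)+
  have zt: "((\<lambda>T. x - cs * T) has_real_derivative - cs) (at t)" "((\<lambda>T. T) has_real_derivative 1) (at t)"
    by (auto intro!: derivative_eq_intros)
  \<comment> \<open>The moving coordinate depends on time: its chain rule produces the terms - c
    \<partial>_x of the linear system.\<close>
  have k2: "((\<lambda>T. \<kappa>s s x T) has_real_derivative s * (dM \<kappa> z t - cs * dk \<kappa> z t)) (at t)"
    and m2: "((\<lambda>T. \<mu>s s x T) has_real_derivative s * (dM \<mu> z t - cs * dk \<mu> z t)) (at t)" for s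
    using DERIV_add[OF DERIV_const[of k] DERIV_cmult[OF d(8)[OF zt], of s]]
      DERIV_add[OF DERIV_const[of M] DERIV_cmult[OF d(9)[OF zt], of s]]
    by (simp_all add: \<kappa>s_def \<mu>s_def cs_def[symmetric] z_def[symmetric] algebra_simps)
  have m3: "((\<lambda>X. s * dk \<mu> (X - cs * t) t) has_real_derivative s * dk (dk \<mu>) z t) (at x)" for s
    unfolding z_def by (rule DERIV_cmult) (rule sh[of "\<lambda>x. dk \<mu> x t", OF d(5)])
  have cc: "continuous_on UNIV (\<lambda>X. h (X - cs * t))" if "continuous_on UNIV h" for h :: "real \<Rightarrow> real"
    by (rule continuous_on_compose2[OF that]) (auto intro!: continuous_intros)
  have c1: "continuous_on UNIV (\<lambda>X. s * dk \<kappa> (X - cs * t) t)" "continuous_on UNIV (\<lambda>X. s * dk \<mu> (X - cs * t) t)" for s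
    by (intro continuous_on_mult_left cc d(6) d(7))+
  have f1: "((\<lambda>X. fs s X t y) has_real_derivative s * field_x g (X - cs * t) t y) (at X)" for s X y
    unfolding fs_def cs_def[symmetric] by (rule DERIV_cmult) (rule sh[of "\<lambda>x. g x t y", OF gd(2)])
  have cx: "continuous_on UNIV (\<lambda>z::real \<times> real. fst z - cs * t)" by (intro continuous_intros)
  have f2: "continuous_on UNIV (\<lambda>(X, y). fs s X t y)" "continuous_on UNIV (\<lambda>(X, y). s * field_x g (X - cs * t) t y)" for s
    unfolding fs_def cs_def[symmetric] split_beta by (intro continuous_on_mult_left gd(3,4) cx continuous_intros)+
  have avs: "avg (\<lambda>y. a y * (s * b y)) = s * avg (\<lambda>y. a y * b y)" for s and a b :: "real \<Rightarrow> real"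
    using avg_mult_real[of s "\<lambda>y. a y * b y"] by (simp add: mult_ac)
  have cavg: "continuous_on ?J (\<lambda>s. avg (\<lambda>y. W (kk s) (mm s) y * h y))"
    if W: "smooth_family \<Omega> W" and h: "\<And>A. continuous_on A h" for W h
  proof -
    have "continuous_on (?J \<times> cbox 0 1) (\<lambda>p. W (kk (fst p)) (mm (fst p)) (snd p) * h (snd p))"
      by (intro continuous_on_mult smooth_family_cont[OF W] continuous_on_compose2[OF ckm(1)[of UNIV]]
          continuous_on_compose2[OF ckm(2)[of UNIV]] continuous_on_compose2[OF h[of UNIV]] continuous_intros) auto
    then show ?thesis
      using integral_continuous_on_param[of ?J 0 1 "\<lambda>s y. W (kk s) (mm s) y * h y"]
      by (simp add: avg_def split_beta)
  qed
  have cW: "continuous_on ?J (\<lambda>s. W (kk s) (mm s) y)" if "smooth_family \<Omega> W" for W y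
    by (rule smooth_family_cont[OF that ckm]) auto
  have ch: "continuous_on ?J (\<lambda>s. h (kk s) (mm s))" if "smooth_on \<Omega> (\<lambda>(k, M). h k M)" for h :: "real \<Rightarrow> real \<Rightarrow> real"
  proof -
    have "continuous_on ?J (\<lambda>s. (\<lambda>(k, M). h k M) (kk s, mm s))"
      by (rule continuous_on_compose2[OF smooth_on_cont[OF that]]) (auto intro!: continuous_intros ckm)
    then show ?thesis by simp
  qed
  have cU: "continuous_on ?J (\<lambda>s. UUk (kk s) (mm s))"
  proof -
    have "continuous_on (?J \<times> cbox 0 1) (\<lambda>p. U (kk (fst p)) (mm (fst p)) (snd p) * Uk (kk (fst p)) (mm (fst p)) (snd p))"
      by (intro continuous_on_mult smooth_family_cont[OF smU] smooth_family_cont[OF smUk]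
          continuous_on_compose2[OF ckm(1)[of UNIV]] continuous_on_compose2[OF ckm(2)[of UNIV]] continuous_intros) auto
    then show ?thesis
      using integral_continuous_on_param[of ?J 0 1 "\<lambda>s y. U (kk s) (mm s) y * Uk (kk s) (mm s) y"]
      by (simp add: UUk_def avg_def split_beta)
  qed
  have gc: "continuous_on A (\<lambda>y. g z t y)" "continuous_on A (\<lambda>y. field_x g z t y)" for A
    by (auto intro!: gd(3,4) continuous_intros)
  have lin: "D (\<lambda>x. avg (g x t)) z = avg (field_x g z t)"
    by (rule D_eqI_real, rule avg_field_deriv[where f="\<lambda>x. g x t", OF gd(2)])
      (auto simp: split_beta intro!: gd(3,4) continuous_intros)
  have Dk: "D (\<lambda>x. \<kappa> x t) z = dk \<kappa> z t" "D (\<lambda>x. \<mu> x t) z = dk \<mu> z t" "D (\<lambda>t. \<kappa> z t) t = dM \<kappa> z t"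
    "D (\<lambda>t. \<mu> z t) t = dM \<mu> z t"
    by (simp_all add: dk_def dM_def)
  note e = whitham_kM_eq[where \<kappa>="\<kappa>s s" and X=x and T=t and \<mu>="\<mu>s s"
      and \<kappa>x="\<lambda>X. s * dk \<kappa> (X - cs * t) t" and \<mu>x="\<lambda>X. s * dk \<mu> (X - cs * t) t"
      and f="fs s" and fx="\<lambda>X y. s * field_x g (X - cs * t) t y" for s,
      OF _ k1 k2 m1 m2 c1 f1 f2, unfolded at, folded z_def]
  show "((\<lambda>s. whitham_k 1 c (\<kappa>s s) (\<mu>s s) (fs s) x t)
           has_real_derivative lin_k c k M \<kappa> \<mu> g (x - c k M * t) t) (at 0)"
  proof -
    let ?G = "\<lambda>s. (dM \<kappa> z t - cs * dk \<kappa> z t) + dk \<kappa> z t * c (kk s) (mm s)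
      + kk s * (dk c (kk s) (mm s) * dk \<kappa> z t + 6 * dk \<mu> z t)
      + 6 * (s * dk \<kappa> z t * avg (g z t) + kk s * avg (field_x g z t))"
    have "((\<lambda>s. whitham_k 1 c (\<kappa>s s) (\<mu>s s) (fs s) x t) has_real_derivative ?G 0) (at 0)"
    proof (rule has_derivative_times_id[OF J])
      fix s assume "s \<in> ?J"
      then have o': "(kk s, mm s) \<in> \<Omega>" by simp
      show "whitham_k 1 c (\<kappa>s s) (\<mu>s s) (fs s) x t = s * ?G s"
        unfolding e(1)[OF o'] avg_mult_real by (simp add: algebra_simps)
    next
      show "continuous_on ?J ?G"
        by (intro continuous_intros ckm ch smc smooth2_dk[OF O smc])
    qed
    \<comment> \<open>At s = 0 the term - c \<partial>_x \<kappa> of the moving frame cancels c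
      \<partial>_x \<kappa> from \<partial>_X(k c), so \<open>lin_k\<close> has no transport term.
      In \<open>lin_M\<close> that term survives.\<close>
    moreover have "?G 0 = lin_k c k M \<kappa> \<mu> g (x - c k M * t) t"
      unfolding cs_def[symmetric] z_def[symmetric] lin_k_def Dk lin
      by (simp add: kk_def mm_def cs_def dpar_c[OF o] algebra_simps)
    ultimately show ?thesis by simp
  qed
  show "((\<lambda>s. whitham_M 1 \<delta> U (\<kappa>s s) (\<mu>s s) (fs s) x t)
           has_real_derivative lin_M \<delta> U c k M \<kappa> \<mu> g (x - c k M * t) t) (at 0)"
  proof -
    let ?G = "\<lambda>s. (dM \<mu> z t - cs * dk \<mu> z t) + 6 * UUk (kk s) (mm s) * dk \<kappa> z t + 6 * mm s * dk \<mu> z t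
      - 6 * (s * dk \<kappa> z t * avg (\<lambda>y. Uk (kk s) (mm s) y * g z t y)
          + avg (\<lambda>y. U (kk s) (mm s) y * field_x g z t y) - mm s * avg (field_x g z t))
      + \<delta> * dk (dk \<mu>) z t"
    have "((\<lambda>s. whitham_M 1 \<delta> U (\<kappa>s s) (\<mu>s s) (fs s) x t) has_real_derivative ?G 0) (at 0)"
    proof (rule has_derivative_times_id[OF J])
      fix s assume "s \<in> ?J"
      then have o': "(kk s, mm s) \<in> \<Omega>" by simp
      show "whitham_M 1 \<delta> U (\<kappa>s s) (\<mu>s s) (fs s) x t = s * ?G s"
        unfolding e(2)[OF o' m3] avg_mult_real avs by (simp add: algebra_simps)
    next
      show "continuous_on ?J ?G"
        by (intro continuous_intros ckm cU cavg smU smUk gc)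
    qed
    moreover have "?G 0 = lin_M \<delta> U c k M \<kappa> \<mu> g (x - c k M * t) t"
    proof -
      have c0: "continuous_on {0..1} (g X t)" for X using gd(3)[of "{0..1}" "\<lambda>_. X" "\<lambda>y. y"] by (simp add: continuous_intros)
      have Ug: "((\<lambda>X. avg (\<lambda>y. U k M y * g X t y)) has_real_derivative avg (\<lambda>y. U k M y * field_x g z t y)) (at z)"
        by (rule avg_field_deriv[where f="\<lambda>X y. U k M y * g X t y" and f'="\<lambda>X y. U k M y * field_x g X t y"])
          (auto simp: split_beta intro!: DERIV_cmult gd continuous_intros continuous_on_compose2[OF U_cont[OF o, of UNIV]])
      have ag: "((\<lambda>x. avg (g x t)) has_real_derivative avg (field_x g z t)) (at z)"
        by (rule avg_field_deriv[where f="\<lambda>x. g x t", OF gd(2)])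
          (auto simp: split_beta intro!: gd(3,4) continuous_intros)
      have "D (\<lambda>x. avg (\<lambda>y. (6 * U k M y) *\<^sub>R (g x t y - avg (g x t)))) z
        = D (\<lambda>x. 6 * (avg (\<lambda>y. U k M y * g x t y) - M * avg (g x t))) z"
        by (simp add: avg_U_centred_real[OF o c0])
      also have "\<dots> = 6 * (avg (\<lambda>y. U k M y * field_x g z t y) - M * avg (field_x g z t))"
        by (rule D_eqI_real) (intro DERIV_cmult DERIV_diff Ug ag)
      finally have 6: "D (\<lambda>x. avg (\<lambda>y. (6 * U k M y) *\<^sub>R (g x t y - avg (g x t)))) z
        = 6 * (avg (\<lambda>y. U k M y * field_x g z t y) - M * avg (field_x g z t))" .
      have "D (\<lambda>x. \<mu> x t) = (\<lambda>x. dk \<mu> x t)" by (auto simp: dk_def)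
      then have 2: "(D ^^ 2) (\<lambda>x. \<mu> x t) z = dk (dk \<mu>) z t" by (simp add: D_numeral dk_def)
      show ?thesis
        unfolding cs_def[symmetric] z_def[symmetric] lin_M_def Dk 6 2 dpar_avg_sq[OF o]
        by (simp add: kk_def mm_def cs_def algebra_simps)
    qed
    ultimately show ?thesis by simp
  qed
  show "((\<lambda>s. whitham_orth U (\<kappa>s s) (\<mu>s s) (fs s) x t)
           has_real_derivative lin_orth U k M g (x - c k M * t) t) (at 0)"
  proof -
    let ?G = "\<lambda>s. avg (\<lambda>y. D (U (kk s) (mm s)) y * g z t y)"
    have "((\<lambda>s. whitham_orth U (\<kappa>s s) (\<mu>s s) (fs s) x t) has_real_derivative ?G 0) (at 0)"
    proof (rule has_derivative_times_id[OF J])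
      fix s assume "s \<in> ?J"
      show "whitham_orth U (\<kappa>s s) (\<mu>s s) (fs s) x t = s * ?G s"
        unfolding whitham_orth_def at avs[symmetric] by (simp add: mult_ac)
    next
      show "continuous_on ?J ?G" by (rule cavg[OF smooth_family_D[OF smU] gc(1)])
    qed
    moreover have "?G 0 = lin_orth U k M g (x - c k M * t) t"
      unfolding cs_def[symmetric] z_def[symmetric] lin_orth_def by (simp add: kk_def mm_def)
    ultimately show ?thesis by simp
  qed
  show "((\<lambda>s. whitham_f \<delta> U c (\<kappa>s s) (\<mu>s s) (fs s) x t y)
           has_real_derivative lin_f \<delta> U c k M \<kappa> \<mu> g (x - c k M * t) t y) (at 0)"
  proof -
    let ?G = "\<lambda>s. Lop \<delta> (kk s) (c (kk s) (mm s)) (U (kk s) (mm s)) (g z t) y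
      - (Uk (kk s) (mm s) y * (dM \<kappa> z t - cs * dk \<kappa> z t) + src_k (kk s) (mm s) y * dk \<kappa> z t
         + src_M (kk s) (mm s) y * dk \<mu> z t)"
    note ef = whitham_f_eq[where \<kappa>="\<kappa>s s" and X=x and T=t and \<mu>="\<mu>s s"
      and \<kappa>x="\<lambda>X. s * dk \<kappa> (X - cs * t) t" and \<mu>x="\<lambda>X. s * dk \<mu> (X - cs * t) t" for s, OF _ k1 k2 m1 m2 c1, unfolded at, folded z_def]
    have "((\<lambda>s. whitham_f \<delta> U c (\<kappa>s s) (\<mu>s s) (fs s) x t y) has_real_derivative ?G 0) (at 0)"
    proof (rule has_derivative_times_id[OF J])
      fix s assume "s \<in> ?J"
      then have o': "(kk s, mm s) \<in> \<Omega>" by simp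
      show "whitham_f \<delta> U c (\<kappa>s s) (\<mu>s s) (fs s) x t y = s * ?G s"
        unfolding ef[OF o'] at using Lop_scaleR[OF U_Cper[OF o'] gd(1), of \<delta> _ _ s]
        by (simp add: algebra_simps)
    next
      note s1 = smooth_family_D[OF smU] and k1 = smooth_family_D[OF smUk]
      note s2 = smooth_family_D[OF s1] and k2 = smooth_family_D[OF k1]
      note s3 = smooth_family_D[OF s2] and k3 = smooth_family_D[OF k2]
      \<comment> \<open>The expanded form of the operator holds only where the profile is known to
        be periodic and differentiable, that is for s in \<open>?J\<close>; there it displays the
        dependence on s.\<close>
      have "continuous_on ?J (\<lambda>s. Lop \<delta> (kk s) (c (kk s) (mm s)) (U (kk s) (mm s)) (g z t) y)
        \<longleftrightarrow> continuous_on ?J (\<lambda>s. kk s *\<^sub>R ((6 * U (kk s) (mm s) y - c (kk s) (mm s)) *\<^sub>R D (g z t) y + (6 * D (U (kk s) (mm s)) y) *\<^sub>R g z t y)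
     + (kk s)^3 *\<^sub>R D (D (D (g z t))) y + \<delta> *\<^sub>R ((kk s)^2 *\<^sub>R D (D (g z t)) y + (kk s)^4 *\<^sub>R D (D (D (D (g z t)))) y))"
        by (rule continuous_on_cong) (simp_all add: Lop_eq[OF U_Cper gd(1)])
      moreover have "continuous_on ?J (\<lambda>s. kk s *\<^sub>R ((6 * U (kk s) (mm s) y - c (kk s) (mm s)) *\<^sub>R D (g z t) y + (6 * D (U (kk s) (mm s)) y) *\<^sub>R g z t y)
     + (kk s)^3 *\<^sub>R D (D (D (g z t))) y + \<delta> *\<^sub>R ((kk s)^2 *\<^sub>R D (D (g z t)) y + (kk s)^4 *\<^sub>R D (D (D (D (g z t)))) y))"
        by (intro continuous_intros ckm cW[OF smU] cW[OF s1] ch smc)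
      ultimately have L: "continuous_on ?J (\<lambda>s. Lop \<delta> (kk s) (c (kk s) (mm s)) (U (kk s) (mm s)) (g z t) y)" by simp
      show "continuous_on ?J ?G"
        unfolding src_k_def src_M_def
        by (intro continuous_intros L ckm cU cW[OF smU] cW[OF smUk] cW[OF s1] cW[OF s2] cW[OF s3] cW[OF k1] cW[OF k2] cW[OF k3])
    qed
    moreover have "?G 0 = lin_f \<delta> U c k M \<kappa> \<mu> g (x - c k M * t) t y"
      unfolding cs_def[symmetric] z_def[symmetric] lin_f_eq[OF o] Dk
      by (simp add: kk_def mm_def cs_def)
    ultimately show ?thesis by simp
  qed
qed

end

subsection \<open>Plane waves\<close>

lemma plane_wave_derivs:
  "((\<lambda>t. plane_wave k \<nu> l x t * a) has_vector_derivative l * (plane_wave k \<nu> l x t * a)) (at t)"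
  "((\<lambda>x. plane_wave k \<nu> l x t * a) has_vector_derivative \<nu> * k * (plane_wave k \<nu> l x t * a)) (at x)"
proof -
  have "((\<lambda>z. exp (l * z + \<nu> * k * x) * a) has_field_derivative l * (exp (l * of_real t + \<nu> * k * x) * a)) (at (of_real t))"
    by (auto intro!: derivative_eq_intros)
  from has_vector_derivative_real_field[OF this]
  show "((\<lambda>t. plane_wave k \<nu> l x t * a) has_vector_derivative l * (plane_wave k \<nu> l x t * a)) (at t)"
    by (simp add: plane_wave_def)
  have "((\<lambda>z. exp (l * t + \<nu> * k * z) * a) has_field_derivative \<nu> * k * (exp (l * t + \<nu> * k * of_real x) * a)) (at (of_real x))"
    by (auto intro!: derivative_eq_intros)
  from has_vector_derivative_real_field[OF this]
  show "((\<lambda>x. plane_wave k \<nu> l x t * a) has_vector_derivative \<nu> * k * (plane_wave k \<nu> l x t * a)) (at x)"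
    by (simp add: plane_wave_def)
qed

lemma D_plane_wave:
  "D (\<lambda>t. plane_wave k \<nu> l x t * a) t = l * (plane_wave k \<nu> l x t * a)"
  "D (\<lambda>x. plane_wave k \<nu> l x t * a) = (\<lambda>x. plane_wave k \<nu> l x t * (\<nu> * k * a))"
  using D_eqI[OF plane_wave_derivs(1)] D_eqI[OF plane_wave_derivs(2)] by (auto simp: mult_ac)

lemma plane_wave_nonzero: "plane_wave k \<nu> l x t \<noteq> 0"
  by (simp add: plane_wave_def)

text \<open>The common asymptotic expansion behind both residuals; \<open>w\<close> is \<open>a\<close> or \<open>b\<close>.\<close>

lemma residual_expansion:
  fixes k :: complex
  assumes l: "(\<lambda>\<nu>. l \<nu> - (\<nu> * k * l0 + \<nu>^2 * k * l1)) \<in> nuO 3"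
    and a: "(\<lambda>\<nu>. a \<nu> - (a0 + \<nu> * a1)) \<in> nuO 2"
    and b: "(\<lambda>\<nu>. b \<nu> - (b0 + \<nu> * b1)) \<in> nuO 2"
    and w: "(\<lambda>\<nu>. w \<nu> - (w0 + \<nu> * w1)) \<in> nuO 2"
  shows "(\<lambda>\<nu>. l \<nu> * w \<nu> + \<nu> * k * (p * a \<nu> + q * b \<nu>)
       + \<nu> * k * (\<nu> * a \<nu> * \<alpha> + \<nu> * b \<nu> * \<beta> + (l \<nu> - \<nu> * k * l0) * a \<nu> * \<gamma>) + \<nu>^2 * k * \<eta> * b \<nu>
     - k * (\<nu> * (l0 * w0 + p * a0 + q * b0)
          + \<nu>^2 * (l0 * w1 + l1 * w0 + p * a1 + q * b1 + \<alpha> * a0 + \<beta> * b0 + \<eta> * b0))) \<in> nuO 3"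
proof -
  let ?rl = "\<lambda>\<nu>. l \<nu> - (\<nu> * k * l0 + \<nu>^2 * k * l1)" and ?ra = "\<lambda>\<nu>. a \<nu> - (a0 + \<nu> * a1)"
    and ?rb = "\<lambda>\<nu>. b \<nu> - (b0 + \<nu> * b1)" and ?rw = "\<lambda>\<nu>. w \<nu> - (w0 + \<nu> * w1)"
  have Q1: "(\<lambda>\<nu>. \<nu>^i * g \<nu>) \<in> nuO p" if "g \<in> nuO n" "p \<le> i + n" for i n g p
    using bigo_im0_weaken[OF bigo_im0_shift[OF that(1)] that(2)] .
  have first: "(\<lambda>\<nu>. f \<nu> - f0) \<in> nuO 1" and bdd: "f \<in> nuO 0"
    if f: "(\<lambda>\<nu>. f \<nu> - (f0 + \<nu> * f1)) \<in> nuO 2" for f f0 f1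
  proof -
    have "(\<lambda>\<nu>. (f \<nu> - (f0 + \<nu> * f1)) + \<nu>^1 * f1) \<in> nuO 1"
      by (intro sum_in_bigo(1) bigo_im0_weaken[OF f] Q1[OF bigo_im0_c]) simp_all
    then show 1: "(\<lambda>\<nu>. f \<nu> - f0) \<in> nuO 1" by (simp add: algebra_simps)
    have "(\<lambda>\<nu>. (f \<nu> - f0) + f0) \<in> nuO 0"
      by (intro sum_in_bigo(1) bigo_im0_weaken[OF 1] bigo_im0_c) simp_all
    then show "f \<in> nuO 0" by simp
  qed
  have "(\<lambda>\<nu>. ?rl \<nu> + \<nu>^2 * (k * l1)) \<in> nuO 2"
    by (intro sum_in_bigo(1) bigo_im0_weaken[OF l] Q1[OF bigo_im0_c]) simp_all
  then have l': "(\<lambda>\<nu>. l \<nu> - \<nu> * k * l0) \<in> nuO 2" by (simp add: algebra_simps)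
  \<comment> \<open>Each summand combines an error of the expansions with bounded factors and enough
    powers of \<nu>. In the term with \<gamma>, l - \<nu> k l0 is only O(\<nu>^2), and the outer
    factor \<nu> supplies the third order.\<close>
  have "(\<lambda>\<nu>. ?rl \<nu> * w \<nu> + \<nu>^1 * (k * l0 * ?rw \<nu>) + \<nu>^2 * (k * l1 * (w \<nu> - w0))
     + \<nu>^1 * (k * p * ?ra \<nu>) + \<nu>^1 * (k * q * ?rb \<nu>) + \<nu>^2 * (k * \<alpha> * (a \<nu> - a0))
     + \<nu>^2 * (k * \<beta> * (b \<nu> - b0)) + \<nu>^1 * (k * \<gamma> * ((l \<nu> - \<nu> * k * l0) * a \<nu>))
     + \<nu>^2 * (k * \<eta> * (b \<nu> - b0))) \<in> nuO 3"
    by (intro sum_in_bigo(1) bigo_im0_mult'[OF l bdd[OF w]] Q1[OF bigo_im0_cmult[OF w]]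
        Q1[OF bigo_im0_cmult[OF first[OF w]]] Q1[OF bigo_im0_cmult[OF a]] Q1[OF bigo_im0_cmult[OF b]]
        Q1[OF bigo_im0_cmult[OF first[OF a]]] Q1[OF bigo_im0_cmult[OF first[OF b]]]
        Q1[OF bigo_im0_cmult[OF bigo_im0_mult[OF l' bdd[OF a]]]]) simp_all
  then show ?thesis by (simp add: algebra_simps power2_eq_square)
qed

context waves
begin

text \<open>Right-hand side of the corrector equation for amplitudes a and b, with the exponential
  divided out: \<partial>_t has become l and \<partial>_x has become \<nu> k.\<close>

definition plane_source :: "real \<Rightarrow> real \<Rightarrow> complex \<Rightarrow> complex \<Rightarrow> complex \<Rightarrow> complex \<Rightarrow> real \<Rightarrow> complex" where
  "plane_source k M \<nu> l a b y = (l - complex_of_real (c k M) * (\<nu> * complex_of_real k)) * a * cUk k M y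
     + \<nu> * complex_of_real k * a * complex_of_real (src_k k M y) + \<nu> * complex_of_real k * b * complex_of_real (src_M k M y)"

lemma plane_source_Cper: "(k, M) \<in> \<Omega> \<Longrightarrow> plane_source k M \<nu> l a b \<in> Cper 0"
  unfolding plane_source_def[abs_def] by (intro Cper_add Cper_cmult Cper_of_real Uk_Cper src_k_Cper src_M_Cper)

lemma avg_plane_source:
  assumes o: "(k, M) \<in> \<Omega>" shows "avg (plane_source k M \<nu> l a b) = 0"
  unfolding plane_source_def[abs_def]
  using Uk_cont[OF o, of "{0..1}"] Cper_cont[OF src_k_Cper[OF o], of "{0..1}"] Cper_cont[OF src_M_Cper[OF o, of 0], of "{0..1}"]
  by (simp add: avg_add avg_cmult avg_of_real continuous_intros avg_Uk[OF o] avg_src_k[OF o] avg_src_M[OF o])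

lemma lin_f_plane_wave:
  assumes o: "(k, M) \<in> \<Omega>"
  shows "lin_f \<delta> U c k M (\<lambda>x t. plane_wave k \<nu> l x t * a) (\<lambda>x t. plane_wave k \<nu> l x t * b) g x t y
    = Lin k M (g x t) y - plane_wave k \<nu> l x t * plane_source k M \<nu> l a b y"
  unfolding lin_f_eq[OF o] D_plane_wave plane_source_def by (simp add: scaleR_conv_of_real algebra_simps)

text \<open>The exponential does not depend on y and passes through L and through the orthogonality
  condition, so a single profile G gives the corrector at all (x, t).\<close>

lemma plane_wave_corrector:
  assumes o: "(k, M) \<in> \<Omega>"
  obtains G where "G \<in> Cper 4" "\<And>y. Lin k M G y = plane_source k M \<nu> l a b y"
    "\<And>g. lin_corrector \<delta> U c k M (\<lambda>x t. plane_wave k \<nu> l x t * a) (\<lambda>x t. plane_wave k \<nu> l x t * b) g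
      \<longleftrightarrow> g = (\<lambda>x t y. plane_wave k \<nu> l x t * G y)"
proof -
  interpret wave_op \<delta> k "c k M" "U k M" by (rule wave_op[OF o])
  let ?E = "plane_wave k \<nu> l"
  obtain G where G: "G \<in> Cper 4" "avg (\<lambda>y. cDU k M y * G y) = 0"
    "\<And>y. Lin k M G y = plane_source k M \<nu> l a b y"
    using Lop_ex1[OF plane_source_Cper[OF o] avg_plane_source[OF o]] by blast
  have c: "continuous_on {0..1} (\<lambda>y. cDU k M y * G y)"
    using Cper_cont[OF DV(1)] Cper_cont[OF G(1)] by (intro continuous_intros)
  have E: "(\<lambda>y. ?E x t * G y) \<in> Cper 4" "Lin k M (\<lambda>y. ?E x t * G y) y = ?E x t * plane_source k M \<nu> l a b y"
    "avg (\<lambda>y. cDU k M y * (?E x t * G y)) = 0" for x t y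
  proof -
    show "(\<lambda>y. ?E x t * G y) \<in> Cper 4" by (rule Cper_cmult[OF G(1)])
    show "Lin k M (\<lambda>y. ?E x t * G y) y = ?E x t * plane_source k M \<nu> l a b y"
      unfolding Lop_cmult[OF V1 G(1)] G(3) ..
    show "avg (\<lambda>y. cDU k M y * (?E x t * G y)) = 0"
      using avg_cmult[OF c, of "?E x t"] G(2) by (simp add: mult.left_commute)
  qed
  have "lin_corrector \<delta> U c k M (\<lambda>x t. ?E x t * a) (\<lambda>x t. ?E x t * b) g \<longleftrightarrow> g = (\<lambda>x t y. ?E x t * G y)" for g
  proof
    assume g: "lin_corrector \<delta> U c k M (\<lambda>x t. ?E x t * a) (\<lambda>x t. ?E x t * b) g"
    have "g x t = (\<lambda>y. ?E x t * G y)" for x t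
    proof (rule Lop_unique)
      show "g x t \<in> Cper 4" "(\<lambda>y. ?E x t * G y) \<in> Cper 4"
        using g E by (auto simp: lin_corrector_def)
      show "Lin k M (g x t) y = Lin k M (\<lambda>y. ?E x t * G y) y" for y
        using g E(2) by (simp add: lin_corrector_def lin_f_plane_wave[OF o])
      show "avg (\<lambda>y. cDU k M y * g x t y) = avg (\<lambda>y. cDU k M y * (?E x t * G y))"
        using g E(3) by (simp add: lin_corrector_def lin_orth_def scaleR_conv_of_real)
    qed
    then show "g = (\<lambda>x t y. ?E x t * G y)" by blast
  next
    assume "g = (\<lambda>x t y. ?E x t * G y)"
    then show "lin_corrector \<delta> U c k M (\<lambda>x t. ?E x t * a) (\<lambda>x t. ?E x t * b) g"
      using E by (simp add: lin_corrector_def lin_f_plane_wave[OF o] lin_orth_def scaleR_conv_of_real)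
  qed
  then show ?thesis using that G by blast
qed

lemma lin_k_plane_wave:
  fixes \<nu> l a b :: complex
  assumes o: "(k, M) \<in> \<Omega>" and G: "G \<in> Cper 4"
  shows "lin_k c k M (\<lambda>x t. plane_wave k \<nu> l x t * a) (\<lambda>x t. plane_wave k \<nu> l x t * b) (\<lambda>x t y. plane_wave k \<nu> l x t * G y) x t
    = plane_wave k \<nu> l x t * (l * a + \<nu> * k * (k * dk c k M * a + 6 * k * b) + \<nu> * k * (6 * k * avg G))"
proof -
  have "D (\<lambda>x. avg (\<lambda>y. plane_wave k \<nu> l x t * G y)) x = plane_wave k \<nu> l x t * (\<nu> * k * avg G)"
    using Cper_cont[OF G, of "{0..1}"] by (simp add: avg_cmult D_plane_wave)
  then show ?thesis
    unfolding lin_k_def D_plane_wave by (simp add: dpar_c[OF o] scaleR_conv_of_real algebra_simps)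
qed

lemma lin_M_plane_wave:
  fixes \<nu> l a b :: complex
  assumes o: "(k, M) \<in> \<Omega>" and G: "G \<in> Cper 4"
  shows "lin_M \<delta> U c k M (\<lambda>x t. plane_wave k \<nu> l x t * a) (\<lambda>x t. plane_wave k \<nu> l x t * b) (\<lambda>x t y. plane_wave k \<nu> l x t * G y) x t
    = plane_wave k \<nu> l x t * (l * b + \<nu> * k * (6 * UUk k M * a + (6 * M - c k M) * b)
       + \<nu> * k * (- avg (\<lambda>y. complex_of_real (6 * U k M y) * (G y - avg G))) + \<nu>^2 * k * (\<delta> * k) * b)"
proof -
  let ?E = "plane_wave k \<nu> l"
  have c: "continuous_on {0..1} (\<lambda>y. complex_of_real (6 * U k M y) * (G y - avg G))"
    using Cper_cont[OF G] U_cont[OF o] by (intro continuous_intros)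
  have "avg (\<lambda>y. (6 * U k M y) *\<^sub>R (?E x t * G y - avg (\<lambda>y. ?E x t * G y)))
    = avg (\<lambda>y. ?E x t * (complex_of_real (6 * U k M y) * (G y - avg G)))" for x
    unfolding avg_cmult[OF Cper_cont[OF G]] by (simp add: scaleR_conv_of_real algebra_simps)
  then have "avg (\<lambda>y. (6 * U k M y) *\<^sub>R (?E x t * G y - avg (\<lambda>y. ?E x t * G y)))
    = ?E x t * avg (\<lambda>y. complex_of_real (6 * U k M y) * (G y - avg G))" for x
    using avg_cmult[OF c] by simp
  then have 6: "D (\<lambda>x. avg (\<lambda>y. (6 * U k M y) *\<^sub>R (?E x t * G y - avg (\<lambda>y. ?E x t * G y)))) x
    = ?E x t * (\<nu> * k * avg (\<lambda>y. complex_of_real (6 * U k M y) * (G y - avg G)))"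
    by (simp only: D_plane_wave)
  show ?thesis
    unfolding lin_M_def D_plane_wave 6 D_numeral dpar_avg_sq[OF o]
    by (simp add: scaleR_conv_of_real algebra_simps power2_eq_square)
qed

text \<open>The expansion of the residuals needs no assumption that they vanish, so the coefficients
  of \<nu> and \<nu>^2 are identified as k times the four relations. Setting the residuals to zero
  is a separate conclusion.\<close>

lemma plane_wave_relations:
  fixes l0 l1 k0 k1 M0 M1 :: complex and k :: real
  assumes o: "(k, M) \<in> \<Omega>"
    and lh: "(\<lambda>\<nu>. lh \<nu> - (\<nu> * complex_of_real k * l0 + \<nu>^2 * complex_of_real k * l1)) \<in> nuO 3"
    and kh: "(\<lambda>\<nu>. kh \<nu> - (k0 + \<nu> * k1)) \<in> nuO 2"
    and Mh: "(\<lambda>\<nu>. Mh \<nu> - (M0 + \<nu> * M1)) \<in> nuO 2"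
    and g: "\<forall>\<^sub>F \<nu> in im0. lin_corrector \<delta> U c k M (\<lambda>x t. plane_wave k \<nu> (lh \<nu>) x t * kh \<nu>)
        (\<lambda>x t. plane_wave k \<nu> (lh \<nu>) x t * Mh \<nu>) (g \<nu>)"
    and fk: "fk \<in> Cper 4" "\<And>y. Lin k M fk y = complex_of_real k * vk \<delta> U c k M l0 y"
    and fM: "fM \<in> Cper 4" "\<And>y. Lin k M fM y = complex_of_real k * vM U c k M l0 y"
  defines "A1 \<equiv> rel1_k c k M l0 k0 M0" and "B1 \<equiv> rel1_M U c k M l0 k0 M0"
    and "A2 \<equiv> rel2_k c k M l0 l1 k0 M0 k1 M1 fk fM" and "B2 \<equiv> rel2_M \<delta> U c k M l0 l1 k0 M0 k1 M1 fk fM"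
    and "LK \<equiv> \<lambda>\<nu>. lin_k c k M (\<lambda>x t. plane_wave k \<nu> (lh \<nu>) x t * kh \<nu>) (\<lambda>x t. plane_wave k \<nu> (lh \<nu>) x t * Mh \<nu>) (g \<nu>)"
    and "LM \<equiv> \<lambda>\<nu>. lin_M \<delta> U c k M (\<lambda>x t. plane_wave k \<nu> (lh \<nu>) x t * kh \<nu>) (\<lambda>x t. plane_wave k \<nu> (lh \<nu>) x t * Mh \<nu>) (g \<nu>)"
  shows "\<exists>\<rho> \<sigma>. \<rho> \<in> nuO 3 \<and> \<sigma> \<in> nuO 3 \<and>
      (\<forall>\<^sub>F \<nu> in im0. \<forall>x t.
         LK \<nu> x t = plane_wave k \<nu> (lh \<nu>) x t * (complex_of_real k * (\<nu> * A1 + \<nu>^2 * A2) + \<rho> \<nu>) \<and>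
         LM \<nu> x t = plane_wave k \<nu> (lh \<nu>) x t * (complex_of_real k * (\<nu> * B1 + \<nu>^2 * B2) + \<sigma> \<nu>))" (is ?expansion)
    and "(\<forall>\<^sub>F \<nu> in im0. \<forall>x t. LK \<nu> x t = 0 \<and> LM \<nu> x t = 0) \<Longrightarrow> A1 = 0 \<and> B1 = 0 \<and> A2 = 0 \<and> B2 = 0"
proof -
  interpret wave_op \<delta> k "c k M" "U k M" by (rule wave_op[OF o])
  have k: "complex_of_real k \<noteq> 0" using k_pos[OF o] by simp
  let ?E = "\<lambda>\<nu>. plane_wave k \<nu> (lh \<nu>)"
  let ?q = "\<lambda>f. avg (\<lambda>y. complex_of_real (6 * U k M y) * (f y - avg f))"
  have "(cUk k M) \<in> Cper 0" "avg (cUk k M) = 0"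
    using Uk_Cper[OF o] Uk_cont[OF o] by (auto intro: Cper_of_real simp: avg_of_real avg_Uk[OF o])
  \<comment> \<open>v^k contains l0, while the corrector contains the exact \<open>lh \<nu>\<close>.
    The mismatch (lh - \<nu> k l0) \<partial>_k U in the source is absorbed by a multiple of h; h
    exists because <\<partial>_k U> = 0.\<close>
  then obtain h where h: "h \<in> Cper 4" "\<And>y. Lin k M h y = cUk k M y"
    using Lop_solve by blast
  \<comment> \<open>Both amplitudes are put in the form of \<open>residual_expansion\<close>. Its
    parameter \<eta> is 0 here, and it is \<delta> k in \<open>FM\<close>, where it stems from
    \<delta> \<partial>_x^2 M.\<close>
  define FK where "FK \<nu> = lh \<nu> * kh \<nu> + \<nu> * k * (complex_of_real (k * dk c k M) * kh \<nu> + complex_of_real (6 * k) * Mh \<nu>)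
     + \<nu> * k * (\<nu> * kh \<nu> * (6 * k * avg fk) + \<nu> * Mh \<nu> * (6 * k * avg fM) + (lh \<nu> - \<nu> * k * l0) * kh \<nu> * (6 * k * avg h))
     + \<nu>^2 * k * 0 * Mh \<nu>" for \<nu> :: complex
  define FM where "FM \<nu> = lh \<nu> * Mh \<nu> + \<nu> * k * (complex_of_real (6 * UUk k M) * kh \<nu> + complex_of_real (6 * M - c k M) * Mh \<nu>)
     + \<nu> * k * (\<nu> * kh \<nu> * (- ?q fk) + \<nu> * Mh \<nu> * (- ?q fM) + (lh \<nu> - \<nu> * k * l0) * kh \<nu> * (- ?q h))
     + \<nu>^2 * k * complex_of_real (\<delta> * k) * Mh \<nu>" for \<nu> :: complex
  have F: "\<forall>\<^sub>F \<nu> in im0. \<forall>x t. LK \<nu> x t = ?E \<nu> x t * FK \<nu> \<and> LM \<nu> x t = ?E \<nu> x t * FM \<nu>"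
    using g
  proof eventually_elim
    case (elim \<nu>)
    obtain G where G: "G \<in> Cper 4" "\<And>y. Lin k M G y = plane_source k M \<nu> (lh \<nu>) (kh \<nu>) (Mh \<nu>) y"
      and gG: "\<And>g. lin_corrector \<delta> U c k M (\<lambda>x t. ?E \<nu> x t * kh \<nu>) (\<lambda>x t. ?E \<nu> x t * Mh \<nu>) g
        \<longleftrightarrow> g = (\<lambda>x t y. ?E \<nu> x t * G y)"
      using plane_wave_corrector[OF o] by blast
    have g\<nu>: "g \<nu> = (\<lambda>x t y. ?E \<nu> x t * G y)" using elim gG by blast
    define H where "H y = (\<nu> * kh \<nu>) * fk y + ((\<nu> * Mh \<nu>) * fM y + ((lh \<nu> - \<nu> * k * l0) * kh \<nu>) * h y)" for y
    have H: "H \<in> Cper 4" unfolding H_def[abs_def] by (intro Cper_add Cper_cmult fk fM h)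
    have "Lin k M H y = plane_source k M \<nu> (lh \<nu>) (kh \<nu>) (Mh \<nu>) y" for y
    proof -
      have "Lin k M H y = (\<nu> * kh \<nu>) * Lin k M fk y
        + ((\<nu> * Mh \<nu>) * Lin k M fM y + ((lh \<nu> - \<nu> * k * l0) * kh \<nu>) * Lin k M h y)"
        unfolding H_def[abs_def] by (simp add: Lop_add[OF V1] Lop_cmult[OF V1] Cper_add Cper_cmult fk(1) fM(1) h(1))
      then show ?thesis
        unfolding fk(2) fM(2) h(2) vk_eq[OF o] vM_eq[OF o] plane_source_def by (simp add: algebra_simps)
    qed
    then have "Lin k M (\<lambda>y. G y - H y) y = 0" for y
      by (simp add: Lop_diff[OF V1 G(1) H] G(2))
    \<comment> \<open>\<open>fk\<close>, \<open>fM\<close> and h are arbitrary solutions, so G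
      agrees with \<open>H\<close> only up to a multiple of U'. Both averages of G used below ignore
      it, since <U'> = <U U'> = 0.\<close>
    then obtain r where r: "(\<lambda>y. G y - H y) = (\<lambda>y. r * cDU k M y)"
      using Lop_zero[OF Cper_diff[OF G(1) H]] by blast
    have GH: "G y = (\<nu> * kh \<nu>) * fk y + (\<nu> * Mh \<nu>) * fM y + ((lh \<nu> - \<nu> * k * l0) * kh \<nu>) * h y + r * cDU k M y" for y
      using fun_cong[OF r, of y] by (simp add: H_def algebra_simps)
    note cc = Cper_cont[OF fk(1), of "{0..1}"] Cper_cont[OF fM(1), of "{0..1}"] Cper_cont[OF h(1), of "{0..1}"]
      Cper_cont[OF DV(1), of "{0..1}"] U_cont[OF o, of "{0..1}"]
    have aG: "avg G = (\<nu> * kh \<nu>) * avg fk + (\<nu> * Mh \<nu>) * avg fM + ((lh \<nu> - \<nu> * k * l0) * kh \<nu>) * avg h"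
      unfolding GH[abs_def] using cc
      by (simp add: avg_add avg_cmult avg_of_real avg_DU[OF o] continuous_intros)
    have UdU: "avg (\<lambda>z. cU k M z * cDU k M z) = 0"
      using avg_affine(2)[OF o refl, of 0 0 1] by simp
    let ?P = "\<lambda>f. avg (\<lambda>y. cU k M y * f y)"
    have "?P G = avg (\<lambda>y. (\<nu> * kh \<nu>) * (cU k M y * fk y) + (\<nu> * Mh \<nu>) * (cU k M y * fM y)
        + ((lh \<nu> - \<nu> * k * l0) * kh \<nu>) * (cU k M y * h y)
        + r * (cU k M y * cDU k M y))"
      unfolding GH by (simp add: algebra_simps)
    also have "\<dots> = (\<nu> * kh \<nu>) * ?P fk + (\<nu> * Mh \<nu>) * ?P fM + ((lh \<nu> - \<nu> * k * l0) * kh \<nu>) * ?P h"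
      using cc by (simp add: avg_add avg_cmult UdU continuous_intros)
    finally have PG: "?P G = (\<nu> * kh \<nu>) * ?P fk + (\<nu> * Mh \<nu>) * ?P fM + ((lh \<nu> - \<nu> * k * l0) * kh \<nu>) * ?P h" .
    have qG: "?q G = (\<nu> * kh \<nu>) * ?q fk + (\<nu> * Mh \<nu>) * ?q fM + ((lh \<nu> - \<nu> * k * l0) * kh \<nu>) * ?q h"
      unfolding avg_U_centred[OF o G(1)] avg_U_centred[OF o fk(1)] avg_U_centred[OF o fM(1)] avg_U_centred[OF o h(1)] PG
      by (simp add: aG algebra_simps)
    show ?case
      unfolding LK_def LM_def g\<nu> lin_k_plane_wave[OF o G(1)] lin_M_plane_wave[OF o G(1)] qG unfolding aG
      by (simp add: FK_def FM_def algebra_simps)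
  qed
  have A: "A1 = l0 * k0 + complex_of_real (k * dk c k M) * k0 + complex_of_real (6 * k) * M0"
    "A2 = l0 * k1 + l1 * k0 + complex_of_real (k * dk c k M) * k1 + complex_of_real (6 * k) * M1
      + (6 * k * avg fk) * k0 + (6 * k * avg fM) * M0 + 0 * M0"
    by (simp_all add: A1_def A2_def rel1_k_def rel2_k_def dpar_c[OF o] scaleR_conv_of_real algebra_simps)
  have B: "B1 = l0 * M0 + complex_of_real (6 * UUk k M) * k0 + complex_of_real (6 * M - c k M) * M0"
    "B2 = l0 * M1 + l1 * M0 + complex_of_real (6 * UUk k M) * k1 + complex_of_real (6 * M - c k M) * M1
      + (- ?q fk) * k0 + (- ?q fM) * M0 + complex_of_real (\<delta> * k) * M0"
    unfolding B1_def B2_def rel1_M_def rel2_M_def dpar_avg_sq[OF o]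
    by (simp_all add: scaleR_conv_of_real algebra_simps)
  let ?\<rho> = "\<lambda>\<nu>. FK \<nu> - k * (\<nu> * A1 + \<nu>^2 * A2)" and ?\<sigma> = "\<lambda>\<nu>. FM \<nu> - k * (\<nu> * B1 + \<nu>^2 * B2)"
  have \<rho>: "?\<rho> \<in> nuO 3" and \<sigma>: "?\<sigma> \<in> nuO 3"
    unfolding FK_def FM_def A B
    by (rule residual_expansion[OF lh kh Mh kh] residual_expansion[OF lh kh Mh Mh])+
  show ?expansion
    using \<rho> \<sigma> F by (intro exI[of _ ?\<rho>] exI[of _ ?\<sigma>] conjI) simp_all
  assume zero: "\<forall>\<^sub>F \<nu> in im0. \<forall>x t. LK \<nu> x t = 0 \<and> LM \<nu> x t = 0"
  \<comment> \<open>The exponential has no zeros, so vanishing residuals mean vanishing amplitudes.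
    The polynomials of degree 2 are then themselves O(\<nu>^3), and their coefficients
    vanish.\<close>
  have z: "\<forall>\<^sub>F \<nu> in im0. FK \<nu> = 0 \<and> FM \<nu> = 0"
    using F zero by eventually_elim (auto simp: plane_wave_nonzero)
  have "(\<lambda>\<nu>. 0 + \<nu> * (- k * A1) + \<nu>^2 * (- k * A2)) \<in> nuO 3"
    by (rule landau_o.big.in_cong[THEN iffD1, OF _ \<rho>], use z in eventually_elim) (simp add: algebra_simps)
  then have a: "A1 = 0 \<and> A2 = 0" using bigo_im0_quadratic(2,3) k by fastforce
  have "(\<lambda>\<nu>. 0 + \<nu> * (- k * B1) + \<nu>^2 * (- k * B2)) \<in> nuO 3"
    by (rule landau_o.big.in_cong[THEN iffD1, OF _ \<sigma>], use z in eventually_elim) (simp add: algebra_simps)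
  then have b: "B1 = 0 \<and> B2 = 0" using bigo_im0_quadratic(2,3) k by fastforce
  show "A1 = 0 \<and> B1 = 0 \<and> A2 = 0 \<and> B2 = 0" using a b by simp
qed

end

section \<open>Assembly of (a), (b) and (c)\<close>

theorem mainTheorem5:
  fixes \<delta> :: real and \<Omega> :: "(real \<times> real) set"
    and U :: "real \<Rightarrow> real \<Rightarrow> real \<Rightarrow> real" and c :: "real \<Rightarrow> real \<Rightarrow> real"
    and ks Ms :: real
  assumes "\<delta> > 0"
    and "wave_family \<delta> \<Omega> U c"
    and "spectral_structure \<delta> \<Omega> U c"
    and "(ks, Ms) \<in> \<Omega>"
  shows
    "let kc = complex_of_real ks;
         L = (Lop \<delta> ks (c ks Ms) (U ks Ms) :: (real \<Rightarrow> complex) \<Rightarrow> real \<Rightarrow> complex);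
         U' = (\<lambda>y. complex_of_real (D (U ks Ms) y));
         dU = (\<lambda>(a::complex) b y. dpar (\<lambda>k M. U k M y) ks Ms a b) in
    \<comment> \<open>(a) and (b)\<close>
    (\<forall>lam u l0 l1 u0 u1 u2. bloch_expansion \<delta> ks (c ks Ms) (U ks Ms) lam u l0 l1 u0 u1 u2 \<longrightarrow>
        (let lt0 = l0 / kc; lt1 = l1 / kc; M0 = avg u1; M1 = avg u2;
             wk = vk \<delta> U c ks Ms lt0; wM = vM U c ks Ms lt0 in
         (\<exists>k0 k1.
            (\<forall>y. u0 y = k0 / kc * U' y) \<and>
            (\<forall>y. u1 y = dU k0 M0 y + k1 / kc * U' y) \<and>
            rel1_k c ks Ms lt0 k0 M0 = 0 \<and>
            rel1_M U c ks Ms lt0 k0 M0 = 0 \<and>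
            avg wk = 0 \<and> avg wM = 0 \<and>
            (\<exists>!fk. fk \<in> Cper 4 \<and> avg (\<lambda>y. fk y * U' y) = 0 \<and> (\<forall>y. L fk y = kc * wk y)) \<and>
            (\<exists>!fM. fM \<in> Cper 4 \<and> avg (\<lambda>y. fM y * U' y) = 0 \<and> (\<forall>y. L fM y = kc * wM y)) \<and>
            (\<forall>fk\<in>Cper 4. \<forall>fM\<in>Cper 4. (\<forall>y. L fk y = kc * wk y) \<longrightarrow> (\<forall>y. L fM y = kc * wM y) \<longrightarrow>
               (\<exists>k2. \<forall>y. u2 y = dU k1 M1 y + k0 * (avg fk - fk y) + M0 * (avg fM - fM y)
                                + k2 / kc * U' y) \<and>
               rel2_k c ks Ms lt0 lt1 k0 M0 k1 M1 fk fM = 0 \<and>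
               rel2_M \<delta> U c ks Ms lt0 lt1 k0 M0 k1 M1 fk fM = 0)))) \<and>
    \<comment> \<open>(c) the equations for f determine it\<close>
     (\<forall>\<kappa> \<mu>. smooth_params \<kappa> \<mu> \<and> (\<forall>X T. (\<kappa> X T, \<mu> X T) \<in> \<Omega>) \<longrightarrow>
        (\<forall>X T. \<exists>!h. h \<in> Cper 4 \<and> whitham_orth U \<kappa> \<mu> (\<lambda>_ _. h) X T = 0 \<and>
                  (\<forall>y. whitham_f \<delta> U c \<kappa> \<mu> (\<lambda>_ _. h) X T y = 0))) \<and>
    \<comment> \<open>(c) rescaling of \<epsilon> to 1\<close>
     (\<forall>\<epsilon>>0. \<forall>\<kappa> \<mu> f.
        smooth_params \<kappa> \<mu> \<and> (\<forall>X T. (\<kappa> X T, \<mu> X T) \<in> \<Omega>) \<and> smooth_periodic_field f \<longrightarrow>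
        (whitham_solution \<epsilon> \<delta> U c (\<lambda>X T. \<kappa> (X / \<epsilon>) (T / \<epsilon>)) (\<lambda>X T. \<mu> (X / \<epsilon>) (T / \<epsilon>))
                          (\<lambda>X T y. f (X / \<epsilon>) (T / \<epsilon>) y / \<epsilon>)
         \<longleftrightarrow> whitham_solution 1 \<delta> U c \<kappa> \<mu> f)) \<and>
    \<comment> \<open>(c) linearization about the constant state in the co-moving frame\<close>
     whitham_solution 1 \<delta> U c (\<lambda>_ _. ks) (\<lambda>_ _. Ms) (\<lambda>_ _ _. 0) \<and>
     (\<forall>\<kappa> \<mu> g. smooth_params \<kappa> \<mu> \<and> smooth_periodic_field g \<longrightarrow>
        (let cs = c ks Ms;
             \<kappa>s = (\<lambda>s x t. ks + s * \<kappa> (x - cs * t) t);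
             \<mu>s = (\<lambda>s x t. Ms + s * \<mu> (x - cs * t) t);
             fs = (\<lambda>s x t y. s * g (x - cs * t) t y) in
         (\<forall>x t.
            ((\<lambda>s. whitham_k 1 c (\<kappa>s s) (\<mu>s s) (fs s) x t)
               has_real_derivative lin_k c ks Ms \<kappa> \<mu> g (x - cs * t) t) (at 0) \<and>
            ((\<lambda>s. whitham_M 1 \<delta> U (\<kappa>s s) (\<mu>s s) (fs s) x t)
               has_real_derivative lin_M \<delta> U c ks Ms \<kappa> \<mu> g (x - cs * t) t) (at 0) \<and>
            ((\<lambda>s. whitham_orth U (\<kappa>s s) (\<mu>s s) (fs s) x t)
               has_real_derivative lin_orth U ks Ms g (x - cs * t) t) (at 0) \<and>
            (\<forall>y. ((\<lambda>s. whitham_f \<delta> U c (\<kappa>s s) (\<mu>s s) (fs s) x t y)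
               has_real_derivative lin_f \<delta> U c ks Ms \<kappa> \<mu> g (x - cs * t) t y) (at 0))))) \<and>
    \<comment> \<open>(c) plane waves\<close>
     (\<forall>lh kh Mh lt0 lt1 k0 k1 M0 M1.
        (\<lambda>\<nu>. lh \<nu> - (\<nu> * kc * lt0 + \<nu>^2 * kc * lt1)) \<in> O[im0](\<lambda>\<nu>. \<nu>^3) \<and>
        (\<lambda>\<nu>. kh \<nu> - (k0 + \<nu> * k1)) \<in> O[im0](\<lambda>\<nu>. \<nu>^2) \<and>
        (\<lambda>\<nu>. Mh \<nu> - (M0 + \<nu> * M1)) \<in> O[im0](\<lambda>\<nu>. \<nu>^2) \<longrightarrow>
        (let E = (\<lambda>\<nu>. plane_wave ks \<nu> (lh \<nu>));
             \<kappa> = (\<lambda>\<nu> x t. E \<nu> x t * kh \<nu>);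
             \<mu> = (\<lambda>\<nu> x t. E \<nu> x t * Mh \<nu>) in
         (\<forall>\<nu>. \<exists>!g. lin_corrector \<delta> U c ks Ms (\<kappa> \<nu>) (\<mu> \<nu>) g) \<and>
         (\<forall>g. (\<forall>\<^sub>F \<nu> in im0. lin_corrector \<delta> U c ks Ms (\<kappa> \<nu>) (\<mu> \<nu>) (g \<nu>)) \<longrightarrow>
           (\<forall>fk\<in>Cper 4. \<forall>fM\<in>Cper 4.
              (\<forall>y. L fk y = kc * vk \<delta> U c ks Ms lt0 y) \<longrightarrow>
              (\<forall>y. L fM y = kc * vM U c ks Ms lt0 y) \<longrightarrow>
              (let A1 = rel1_k c ks Ms lt0 k0 M0; B1 = rel1_M U c ks Ms lt0 k0 M0;
                   A2 = rel2_k c ks Ms lt0 lt1 k0 M0 k1 M1 fk fM;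
                   B2 = rel2_M \<delta> U c ks Ms lt0 lt1 k0 M0 k1 M1 fk fM in
               (\<exists>\<rho> \<sigma>. \<rho> \<in> O[im0](\<lambda>\<nu>. \<nu>^3) \<and> \<sigma> \<in> O[im0](\<lambda>\<nu>. \<nu>^3) \<and>
                  (\<forall>\<^sub>F \<nu> in im0. \<forall>x t.
                     lin_k c ks Ms (\<kappa> \<nu>) (\<mu> \<nu>) (g \<nu>) x t
                       = E \<nu> x t * (kc * (\<nu> * A1 + \<nu>^2 * A2) + \<rho> \<nu>) \<and>
                     lin_M \<delta> U c ks Ms (\<kappa> \<nu>) (\<mu> \<nu>) (g \<nu>) x t
                       = E \<nu> x t * (kc * (\<nu> * B1 + \<nu>^2 * B2) + \<sigma> \<nu>))) \<and>
               ((\<forall>\<^sub>F \<nu> in im0. \<forall>x t. lin_k c ks Ms (\<kappa> \<nu>) (\<mu> \<nu>) (g \<nu>) x t = 0 \<and>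
                                     lin_M \<delta> U c ks Ms (\<kappa> \<nu>) (\<mu> \<nu>) (g \<nu>) x t = 0) \<longrightarrow>
                A1 = 0 \<and> B1 = 0 \<and> A2 = 0 \<and> B2 = 0))))))"
proof -
  interpret waves \<delta> \<Omega> U c by unfold_locales fact+
  note o = \<open>(ks, Ms) \<in> \<Omega>\<close>
  show ?thesis
    unfolding Let_def
  proof (intro conjI, goal_cases)
    case 1
    show ?case
    proof (intro allI impI, goal_cases)
      case (1 lam u l0 l1 u0 u1 u2)
      from bloch_expansion_relations[OF o 1] show ?case
      proof (elim exE, goal_cases)
        case (1 k0 k1)
        note r1 = conjunct2[OF 1] note r2 = conjunct2[OF r1] note r3 = conjunct2[OF r2]
        show ?case
          by (rule exI[of _ k0], rule exI[of _ k1])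
            (rule conjI[OF conjunct1[OF 1]] conjI[OF conjunct1[OF r1]] conjI[OF conjunct1[OF r2]]
              conjI[OF conjunct1[OF r3]] conjI[OF avg_vk[OF o]] conjI[OF avg_vM[OF o]]
              conjI[OF solve_vk_vM(1)[OF o]] conjI[OF solve_vk_vM(2)[OF o]] conjunct2[OF r3])+
      qed
    qed
  next
    case 2
    show ?case using whitham_f_determined by blast
  next
    case 3
    show ?case using whitham_rescale by blast
  next
    case 4
    show ?case by (rule whitham_constant)
  next
    case 5
    show ?case
      by (intro allI impI conjI; elim conjE; rule linearization[OF o])
  next
    case 6
    show ?case
    proof (intro allI impI, elim conjE, goal_cases)
      case (1 lh kh Mh lt0 lt1 k0 k1 M0 M1)
      have ex: "\<exists>!g. lin_corrector \<delta> U c ks Ms (\<lambda>x t. plane_wave ks \<nu> (lh \<nu>) x t * kh \<nu>)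
          (\<lambda>x t. plane_wave ks \<nu> (lh \<nu>) x t * Mh \<nu>) g" for \<nu>
        by (rule plane_wave_corrector[OF o, of \<nu> "lh \<nu>" "kh \<nu>" "Mh \<nu>"]) auto
      note lh = 1(1) and kh = 1(2) and Mh = 1(3)
      show ?case
      proof (rule conjI, rule allI, rule ex, intro allI impI ballI, goal_cases)
        case (1 g fk fM)
        note rel = plane_wave_relations[OF o lh kh Mh 1(1) 1(2) 1(4)[rule_format] 1(3) 1(5)[rule_format]]
        show ?case by (rule conjI[OF rel(1) impI[OF rel(2)]])
      qed
    qed
  qed
qed

end
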